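(* For every fixed $\eta>0$ there exist constants $\delta=\delta(\eta)>0$, $K=K(\eta)>0$ and $q_0=q_0(\eta)$ such that for every prime $q\ge q_0$ and every real $N$ with $q^{1/2+\eta}<N\le q-1$, $$\Big|\,|\mathcal{L}(N,q)\cap\mathcal{P}|-\frac12\pi(N)\Big|\le K\,N^{1-\delta}.$$
   Context: Let $q>1$ be an odd integer. For $a\in\mathbf{Z}$ with $(a,q)=1$, $\bar a$ denotes the unique integer with $1\le \bar a\le q-1$ and $a\bar a\equiv 1 \pmod q$. Define $\mathcal{L}(q)=\{1\le a\le q-1 : (a,q)=1,\ 2\nmid a+\bar a\}$ and $\mathcal{L}(N,q)=[1,N]\cap\mathcal{L}(q)$. $\mathcal{P}$ is the set of all primes and $\pi(N)$ is the number of primes up to $N$. *)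

theory Defs
  imports Complex_Main "HOL-Number_Theory.Number_Theory"
begin

definition inverse_mod :: "int \<Rightarrow> int \<Rightarrow> int" where
  "inverse_mod q a = (THE b. 1 \<le> b \<and> b \<le> q - 1 \<and> [a * b = 1] (mod q))"

text \<open>The description is proper for \<open>q > 1\<close> and \<open>a\<close> coprime to \<open>q\<close>:\<close>

lemma inverse_mod_ex1:
  fixes q a :: int
  assumes "q > 1" and "coprime a q"
  shows "\<exists>!b. 1 \<le> b \<and> b \<le> q - 1 \<and> [a * b = 1] (mod q)"
proof -
  obtain x where x: "[a * x = 1] (mod q)"
    using assms(2) cong_solve_coprime_int by blast
  have c: "[a * (x mod q) = 1] (mod q)"
    using x by (simp add: cong_def mod_mult_right_eq)
  have nz: "x mod q \<noteq> 0"
  proof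
    assume "x mod q = 0"
    with c assms(1) show False by (simp add: cong_def)
  qed
  have r: "0 \<le> x mod q" "x mod q < q"
    using assms(1) by simp_all
  show ?thesis
  proof (rule ex1I[of _ "x mod q"])
    show "1 \<le> x mod q \<and> x mod q \<le> q - 1 \<and> [a * (x mod q) = 1] (mod q)"
      using c nz r by linarith
  next
    fix b
    assume b: "1 \<le> b \<and> b \<le> q - 1 \<and> [a * b = 1] (mod q)"
    have "[a * b = a * (x mod q)] (mod q)"
      using b c cong_sym cong_trans by blast
    then have "[b = x mod q] (mod q)"
      using assms(2) cong_mult_lcancel by blast
    then show "b = x mod q"
      using b r by (simp add: cong_def)
  qed
qed

lemma inverse_mod:
  fixes q a :: int
  assumes "q > 1" and "coprime a q"
  shows "1 \<le> inverse_mod q a" and "inverse_mod q a \<le> q - 1"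
    and "[a * inverse_mod q a = 1] (mod q)"
  using theI'[OF inverse_mod_ex1[OF assms]] unfolding inverse_mod_def by blast+

definition lehmer_numbers :: "int \<Rightarrow> int set" where
  "lehmer_numbers q =
     {a. 1 \<le> a \<and> a \<le> q - 1 \<and> coprime a q \<and> \<not> 2 dvd (a + inverse_mod q a)}"

definition lehmer_numbers_upto :: "real \<Rightarrow> int \<Rightarrow> int set" where
  "lehmer_numbers_upto N q = {a. 1 \<le> a \<and> real_of_int a \<le> N} \<inter> lehmer_numbers q"

text \<open>On \<open>int\<close>, \<open>prime\<close> holds of positive primes only.\<close>

definition primes :: "int set" where
  "primes = {p. prime p}"

definition prime_pi :: "real \<Rightarrow> nat" where
  "prime_pi x = card {p \<in> primes. real_of_int p \<le> x}"

end

theory Submission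
  imports Defs "HOL-Analysis.Kronecker_Approximation_Theorem" "HOL-Analysis.Harmonic_Numbers"
    "HOL-Analysis.Complex_Transcendental" "HOL-Computational_Algebra.Squarefree"
    "HOL-Computational_Algebra.Polynomial"
begin

text \<open>An odd prime \<open>p < q\<close> is a Lehmer number iff its inverse is even, that is, iff the inverse of
  \<open>2 p\<close> lies in the lower half of the residues. By Fourier expansion of that interval, it suffices to
  save a power of \<open>q\<close> in \<open>\<Sum> e(h p\<^sup>-\<^sup>1 / q)\<close> over the primes \<open>p \<le> X\<close>, for \<open>X \<ge> q\<close> to the power \<open>1/2 + \<eta>\<close>.

  A Buchstab decomposition of the sieve identity at a small level \<open>D\<close> splits this sum into sums over
  \<open>d l\<close> with \<open>d \<le> D\<close> and smooth \<open>l\<close>, and bilinear sums. For the former, shifting \<open>l\<close> by products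
  \<open>u v\<close> reduces the sum to a high moment of short sums of inverses, which is computed by counting roots of
  polynomials modulo \<open>q\<close>. Hoelder's inequality bounds a bilinear sum over \<open>m \<le> M\<close>, \<open>n \<le> N\<close> by the
  number of solutions of congruences between sums of inverses. For sums of \<open>k\<close> inverses of \<open>m \<le> M\<close>
  with \<open>M\<close> to the power \<open>2 k - 1\<close> below \<open>q\<close> the congruence is an equation between rational numbers, which
  forces the product of all variables to be powerful; for two inverses in a long interval a Dirichlet
  approximation turns it into few factorisation problems over the integers. Everything else is the
  divisor bound.\<close>

section \<open>Additive characters and inverses modulo a prime\<close>

text \<open>The exponent 1/2 has two sources. In the sums over \<open>l\<close>, with shifts u v for
  u \<le> U and v \<le> V, the Y U pairs (n, u) are placed among q^2 parameter pairs, and the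
  complete moment beats the trivial bound once Y U exceeds a power of q slightly above 1; if Y is
  just above q^(1/2), the need for U V < Y leaves U about q^(1/2). In the bilinear sums the energies
  are at best of diagonal size M^2 and N^2, and then Hoelder's inequality with k = 2 gains q / (M
  N)^2 in the eighth power, so M N must exceed q^(1/2). The bilinear bound also needs both variables
  above a fixed power of q, and this shapes the sieve. A divisor d beyond the level satisfies d
  \<le> D \<open>lpf\<close> d \<le> D sqrt X, hence X / d is at least sqrt X / D: no range with one
  very short variable arises. D has to be a power of q so that d itself is long, but one so small
  that summing trivially over d \<le> D costs less than the saving in the sums over
  \<open>l\<close>. No bound for complete Kloosterman sums is used.\<close>

definition add_char :: "nat \<Rightarrow> int \<Rightarrow> complex" where
  "add_char q x = cis (2 * pi * real_of_int x / real q)"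

lemma add_char_add: "add_char q (x + y) = add_char q x * add_char q y"
  by (simp add: add_char_def cis_mult add_divide_distrib distrib_left)

lemma add_char_0 [simp]: "add_char q 0 = 1"
  by (simp add: add_char_def)

lemma norm_add_char [simp]: "cmod (add_char q x) = 1"
  by (simp add: add_char_def)

lemma cnj_add_char: "cnj (add_char q x) = add_char q (- x)"
  by (simp add: add_char_def cis_cnj)

lemma add_char_diff: "add_char q (x - y) = add_char q x * cnj (add_char q y)"
  using add_char_add[of q x "- y"] by (simp add: cnj_add_char)

lemma add_char_power: "add_char q x ^ n = add_char q (int n * x)"
  by (induction n) (simp_all add: add_char_add distrib_right)

lemma add_char_sum: "finite I \<Longrightarrow> add_char q (\<Sum>i\<in>I. f i) = (\<Prod>i\<in>I. add_char q (f i))"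
  by (induction I rule: finite_induct) (simp_all add: add_char_add)

lemma add_char_eq_1_iff:
  assumes "q > 0"
  shows "add_char q x = 1 \<longleftrightarrow> int q dvd x"
proof -
  have "add_char q x = 1 \<longleftrightarrow> (\<exists>k::int. 2 * pi * real_of_int x / real q = of_int k * (2 * pi))"
    unfolding add_char_def cis_conv_exp exp_eq_1 by (simp add: mult_ac)
  also have "\<dots> \<longleftrightarrow> (\<exists>k::int. real_of_int x = real_of_int (k * int q))"
    using assms by (simp add: field_simps)
  also have "\<dots> \<longleftrightarrow> (\<exists>k::int. x = k * int q)"
    by (simp only: of_int_eq_iff)
  also have "\<dots> \<longleftrightarrow> int q dvd x"
    by (auto simp: dvd_def mult.commute)
  finally show ?thesis .
qed

lemma add_char_cong:
  assumes "q > 0" "[x = y] (mod int q)"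
  shows "add_char q x = add_char q y"
proof -
  have "add_char q (x - y) = 1"
    using assms by (simp add: add_char_eq_1_iff cong_iff_dvd_diff)
  then have "add_char q x * cnj (add_char q y) = 1"
    by (simp add: add_char_diff)
  then have "add_char q x * (cnj (add_char q y) * add_char q y) = add_char q y"
    by (metis mult.assoc mult_1)
  moreover have "cnj (add_char q y) * add_char q y = 1"
    using add_char_diff[of q y y] by (simp add: mult.commute)
  ultimately show ?thesis by simp
qed

lemma sum_add_char_orthogonality:
  assumes "q > 0"
  shows "(\<Sum>t<q. add_char q (int t * x)) = (if int q dvd x then of_nat q else 0)"
proof (cases "int q dvd x")
  case True
  then have "add_char q (int t * x) = 1" for t
    using assms by (simp add: add_char_eq_1_iff)
  with True show ?thesis by simp
next
  case False
  then have ne: "add_char q x \<noteq> 1"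
    using assms by (simp add: add_char_eq_1_iff)
  have "(\<Sum>t<q. add_char q (int t * x)) = (\<Sum>t<q. add_char q x ^ t)"
    by (simp add: add_char_power)
  also have "\<dots> = (add_char q x ^ q - 1) / (add_char q x - 1)"
    using ne by (rule geometric_sum)
  also have "add_char q x ^ q = 1"
    using assms by (simp add: add_char_power add_char_eq_1_iff)
  finally show ?thesis using False by simp
qed

lemma parseval_card:
  fixes w :: "'a \<Rightarrow> int"
  assumes "q > 0" "finite P"
  shows "(\<Sum>t<q. (cmod (\<Sum>p\<in>P. add_char q (int t * w p)))\<^sup>2)
    = real q * real (card {(p, p'). p \<in> P \<and> p' \<in> P \<and> [w p = w p'] (mod int q)})"
proof -
  let ?R = "{(p, p'). p \<in> P \<and> p' \<in> P \<and> [w p = w p'] (mod int q)}"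
  have "complex_of_real (\<Sum>t<q. (cmod (\<Sum>p\<in>P. add_char q (int t * w p)))\<^sup>2)
      = (\<Sum>t<q. \<Sum>p\<in>P. \<Sum>p'\<in>P. add_char q (int t * (w p - w p')))"
    by (simp add: complex_norm_square sum_product add_char_diff right_diff_distrib
        flip: of_real_power)
  also have "\<dots> = (\<Sum>p\<in>P. \<Sum>p'\<in>P. \<Sum>t<q. add_char q (int t * (w p - w p')))"
    by (subst sum.swap, rule sum.cong[OF refl], subst sum.swap, rule refl)
  also have "\<dots> = (\<Sum>(p, p')\<in>P \<times> P. if int q dvd (w p - w p') then of_nat q else 0)"
    using assms by (simp add: sum_add_char_orthogonality sum.cartesian_product)
  also have "\<dots> = (\<Sum>(p, p')\<in>?R. of_nat q)"
    by (rule sum.mono_neutral_cong_right) (use assms in \<open>auto simp: cong_iff_dvd_diff split: if_splits\<close>)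
  also have "\<dots> = complex_of_real (real q * real (card ?R))"
    by (simp add: case_prod_unfold)
  finally show ?thesis
    by (simp only: of_real_eq_iff)
qed

text \<open>Junk value: \<open>modinv q x\<close> is divisible by \<open>q\<close> when \<open>x\<close> is. The power makes the
  inverse totally multiplicative and compatible with congruences without side conditions.\<close>

definition modinv :: "nat \<Rightarrow> int \<Rightarrow> int" where
  "modinv q x = x ^ (q - 2)"

lemma modinv_mult: "modinv q (x * y) = modinv q x * modinv q y"
  by (simp add: modinv_def power_mult_distrib)

lemma modinv_cong: "[x = y] (mod int q) \<Longrightarrow> [modinv q x = modinv q y] (mod int q)"
  by (simp add: modinv_def cong_pow)

lemma not_dvd_small:
  "0 < n \<Longrightarrow> n < q \<Longrightarrow> \<not> int q dvd int n"
  by (auto dest: zdvd_imp_le)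

context
  fixes q :: nat
  assumes q: "prime q"
begin

lemma modinv_right:
  assumes "\<not> int q dvd x"
  shows "[x * modinv q x = 1] (mod int q)"
proof -
  have q2: "q \<ge> 2" using q prime_ge_2_nat by blast
  define y where "y = nat (x mod int q)"
  have y: "[int y = x] (mod int q)"
    using q2 by (simp add: y_def cong_def)
  have "\<not> q dvd y"
    using y assms by (metis cong_dvd_iff int_dvd_int_iff)
  then have "[y ^ (q - 1) = 1] (mod q)"
    using q fermat_theorem by blast
  then have "[int y ^ (q - 1) = 1] (mod int q)"
    by (metis cong_int_iff of_nat_1 of_nat_power)
  then have "[x ^ (q - 1) = 1] (mod int q)"
    using y by (meson cong_pow cong_sym cong_trans)
  moreover have "x * modinv q x = x ^ (q - 1)"
    using q2 by (simp add: modinv_def Suc_diff_Suc numeral_2_eq_2 flip: power_Suc)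
  ultimately show ?thesis by simp
qed

lemma prime_int_q: "prime (int q)"
  using q by simp

lemma modinv_not_dvd:
  assumes "\<not> int q dvd x"
  shows "\<not> int q dvd modinv q x"
  using assms prime_int_q unfolding modinv_def by (meson prime_dvd_power)

lemma modinv_inj:
  assumes "\<not> int q dvd x" "\<not> int q dvd y" "[modinv q x = modinv q y] (mod int q)"
  shows "[x = y] (mod int q)"
proof -
  have "[x * (y * modinv q y) = y * (x * modinv q x)] (mod int q)"
    using assms(3) by (metis cong_scalar_left cong_sym mult.commute mult.left_commute)
  moreover have "[x * (y * modinv q y) = x * 1] (mod int q)"
    "[y * (x * modinv q x) = y * 1] (mod int q)"
    using assms modinv_right by (meson cong_scalar_left)+
  ultimately show ?thesis
    by (metis cong_sym cong_trans mult_1_right)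
qed

lemma cong_mult_lcancel_prime:
  assumes "\<not> int q dvd h"
  shows "[h * x = h * y] (mod int q) \<longleftrightarrow> [x = y] (mod int q)"
  using assms prime_int_q
  by (metis cong_iff_dvd_diff prime_dvd_mult_iff right_diff_distrib dvd_mult)

end

section \<open>Fourier completion and bilinear forms\<close>

text \<open>A weak form of Jordan's inequality, with 1/2 in place of 2 / pi. Up to pi / 3 the
  difference of the two sides is increasing because cos is at least 1/2 there; beyond, sin is at
  least sqrt 3 / 2 > 0.8 while x / 2 is at most pi / 4 < 0.8.\<close>

lemma sin_ge_half:
  fixes x :: real
  assumes "0 \<le> x" "x \<le> pi / 2"
  shows "x / 2 \<le> sin x"
proof (cases "x \<le> pi / 3")
  case True
  have "sin 0 - 0 / 2 \<le> sin x - x / 2"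
  proof (rule DERIV_nonneg_imp_nondecreasing[OF assms(1)])
    fix t assume t: "0 \<le> t" "t \<le> x"
    have "cos (pi / 3) \<le> cos t"
      using t True by (intro cos_monotone_0_pi_le) auto
    then have "0 \<le> cos t - 1 / 2" by (simp add: cos_60)
    moreover have "((\<lambda>t. sin t - t / 2) has_real_derivative (cos t - 1 / 2)) (at t)"
      by (auto intro!: derivative_eq_intros)
    ultimately show "\<exists>y. ((\<lambda>t. sin t - t / 2) has_real_derivative y) (at t) \<and> 0 \<le> y"
      by blast
  qed
  then show ?thesis by simp
next
  case False
  have "sin (pi / 3) \<le> sin x"
    using False assms by (intro sin_monotone_2pi_le) auto
  moreover have "sqrt 3 \<ge> 1.7"
    by (rule real_le_rsqrt) (simp add: power2_eq_square)
  moreover have "pi < 3.2" using pi_less_4 pi_approx by simp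
  ultimately show ?thesis
    using assms by (simp add: sin_60)
qed

text \<open>The Fourier coefficient at frequency \<open>h\<close> of the indicator function of
  {0..Y} on the residues modulo \<open>q\<close>.\<close>

definition interval_coeff :: "nat \<Rightarrow> nat \<Rightarrow> nat \<Rightarrow> complex" where
  "interval_coeff q Y h = (\<Sum>y\<le>Y. add_char q (- (int h * int y))) / of_nat q"

text \<open>A majorant of the coefficients that does not depend on \<open>Y\<close>; this is what
  permits an endpoint that varies with the other variable in \<open>bilin_bound_decouple\<close>.
  The sum of two reciprocals replaces the reciprocal of the distance from \<open>h\<close> to the
  nearest multiple of \<open>q\<close>, and is easier to add up.\<close>

definition interval_coeff_bound :: "nat \<Rightarrow> nat \<Rightarrow> real" where
  "interval_coeff_bound q h = (if h = 0 then 1 else 1 / real h + 1 / real (q - h))"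

definition interval_coeff_l1 :: "nat \<Rightarrow> real" where
  "interval_coeff_l1 q = (\<Sum>h<q. interval_coeff_bound q h)"

lemma sum_interval_coeff:
  assumes "Y < q" "v < q"
  shows "(\<Sum>h<q. interval_coeff q Y h * add_char q (int h * int v)) = (if v \<le> Y then 1 else 0)"
proof -
  have q: "q > 0" using assms by simp
  have "(\<Sum>h<q. interval_coeff q Y h * add_char q (int h * int v))
      = (\<Sum>h<q. \<Sum>y\<le>Y. add_char q (int h * (int v - int y))) / of_nat q"
    by (simp add: interval_coeff_def sum_divide_distrib sum_distrib_right sum_distrib_left
        right_diff_distrib add_char_diff cnj_add_char mult.commute)
  also have "\<dots> = (\<Sum>y\<le>Y. \<Sum>h<q. add_char q (int h * (int v - int y))) / of_nat q"
    by (subst sum.swap) simp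
  also have "\<dots> = (\<Sum>y\<le>Y. if int q dvd (int v - int y) then of_nat q else 0) / of_nat q"
    by (simp add: sum_add_char_orthogonality[OF q])
  also have "\<dots> = (\<Sum>y\<le>Y. if y = v then of_nat q else 0) / of_nat q"
  proof -
    have "int q dvd (int v - int y) \<longleftrightarrow> y = v" if "y \<le> Y" for y
      using that assms cong_less_modulus_unique_nat[of v y q]
      by (auto simp: cong_int_iff simp flip: cong_iff_dvd_diff)
    then show ?thesis by (intro arg_cong2[where f = "(/)"] sum.cong) auto
  qed
  also have "\<dots> = (if v \<le> Y then 1 else 0)"
    using q by simp
  finally show ?thesis .
qed

lemma interval_coeff_0: "interval_coeff q Y 0 = of_nat (Suc Y) / of_nat q"
  by (simp add: interval_coeff_def)

text \<open>The modulus is 2 sin (pi m / q), where m is the distance from \<open>h\<close> to the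
  nearest multiple of \<open>q\<close>; then pi m / q is at most pi / 2 and
  \<open>sin_ge_half\<close> applies.\<close>

lemma norm_one_minus_add_char:
  assumes "0 < h" "h < q"
  shows "2 / (real q * cmod (1 - add_char q (- int h))) \<le> interval_coeff_bound q h"
proof -
  define m where "m = min h (q - h)"
  have m: "m > 0" "2 * m \<le> q" "m < q" using assms by (auto simp: m_def)
  have "cmod (1 - add_char q (- int h)) = 2 * \<bar>sin (pi * real h / real q)\<bar>"
  proof -
    have "cmod (1 - add_char q (- int h)) = cmod (exp (\<i> * complex_of_real (- (2 * pi * real h / real q))) - 1)"
      unfolding add_char_def cis_conv_exp by (subst norm_minus_commute) simp
    also have "\<dots> = 2 * \<bar>sin (pi * real h / real q)\<bar>"
      by (subst dist_exp_i_1) simp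
    finally show ?thesis .
  qed
  also have "sin (pi * real h / real q) = sin (pi * real m / real q)"
  proof (cases "m = h")
    case False
    then have "m = q - h" by (auto simp: m_def)
    then have "pi * real m / real q = pi - pi * real h / real q"
      using assms by (simp add: of_nat_diff field_simps)
    then show ?thesis by simp
  qed simp
  also have "2 * \<bar>sin (pi * real m / real q)\<bar> \<ge> pi * real m / real q"
  proof -
    have "(pi * real m / real q) / 2 \<le> sin (pi * real m / real q)"
    proof (rule sin_ge_half)
      have "2 * real m \<le> real q" using m(2) by linarith
      then show "pi * real m / real q \<le> pi / 2"
        using m by (simp add: field_simps)
    qed simp
    then show ?thesis by simp
  qed
  finally have "cmod (1 - add_char q (- int h)) \<ge> pi * real m / real q" .
  moreover have "pi * real m / real q \<ge> 2 * real m / real q"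
    using pi_ge_two by (intro divide_right_mono mult_right_mono) auto
  ultimately have *: "real q * cmod (1 - add_char q (- int h)) \<ge> 2 * real m"
    using assms by (simp add: field_simps)
  have "2 / (real q * cmod (1 - add_char q (- int h))) \<le> 2 / (2 * real m)"
    using * m by (intro divide_left_mono mult_pos_pos) (auto intro: less_le_trans[of 0 "2 * real m"])
  also have "\<dots> \<le> interval_coeff_bound q h"
    using assms by (auto simp: interval_coeff_bound_def m_def min_def)
  finally show ?thesis .
qed

lemma norm_interval_coeff:
  assumes "Y < q" "h < q"
  shows "cmod (interval_coeff q Y h) \<le> interval_coeff_bound q h"
proof (cases "h = 0")
  case True
  then show ?thesis
    using assms by (simp add: interval_coeff_0 interval_coeff_bound_def norm_divide del: of_nat_Suc)
next
  case False
  then have ne: "add_char q (- int h) \<noteq> 1"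
    using assms not_dvd_small[of h q] by (simp add: add_char_eq_1_iff)
  have "(\<Sum>y\<le>Y. add_char q (- (int h * int y))) = (\<Sum>y<Suc Y. add_char q (- int h) ^ y)"
    by (simp add: add_char_power lessThan_Suc_atMost mult.commute)
  also have "\<dots> = (add_char q (- int h) ^ Suc Y - 1) / (add_char q (- int h) - 1)"
    using ne by (rule geometric_sum)
  also have "cmod \<dots> \<le> 2 / cmod (1 - add_char q (- int h))"
  proof -
    have "cmod (add_char q (- int h) ^ Suc Y - 1) \<le> 1 + 1"
      by (rule order.trans[OF norm_triangle_ineq4]) (simp add: norm_mult norm_power)
    then show ?thesis
      by (subst norm_minus_commute[of 1]) (simp add: norm_divide divide_right_mono)
  qed
  finally have "cmod (\<Sum>y\<le>Y. add_char q (- (int h * int y))) / real q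
      \<le> 2 / cmod (1 - add_char q (- int h)) / real q"
    by (rule divide_right_mono) simp
  then have "cmod (interval_coeff q Y h) \<le> 2 / cmod (1 - add_char q (- int h)) / real q"
    by (simp add: interval_coeff_def norm_divide)
  also have "\<dots> \<le> interval_coeff_bound q h"
    using norm_one_minus_add_char[of h q] False assms by (simp add: mult.commute)
  finally show ?thesis .
qed

lemma interval_coeff_bound_pos: "h < q \<Longrightarrow> interval_coeff_bound q h > 0"
  by (simp add: interval_coeff_bound_def add_pos_pos)

lemma interval_coeff_l1_nonneg: "interval_coeff_l1 q \<ge> 0"
  unfolding interval_coeff_l1_def by (intro sum_nonneg) (auto intro: less_imp_le interval_coeff_bound_pos)

lemma interval_coeff_l1_le:
  assumes "q > 1"
  shows "interval_coeff_l1 q \<le> 3 + 2 * ln (real q)"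
proof -
  have split: "{..<q} = insert 0 {1..q - 1}" using assms by auto
  have "interval_coeff_l1 q = 1 + (\<Sum>h=1..q - 1. 1 / real h + 1 / real (q - h))"
    unfolding interval_coeff_l1_def by (subst split) (simp add: interval_coeff_bound_def)
  also have "\<dots> = 1 + ((\<Sum>h=1..q - 1. 1 / real h) + (\<Sum>h=1..q - 1. 1 / real (q - h)))"
    by (simp add: sum.distrib)
  also have "(\<Sum>h=1..q - 1. 1 / real (q - h)) = (\<Sum>h=1..q - 1. 1 / real h)"
    by (rule sum.reindex_bij_witness[of _ "\<lambda>h. q - h" "\<lambda>h. q - h"]) auto
  also have "(\<Sum>h=1..q - 1. 1 / real h) = harm (q - 1)"
    by (simp add: harm_def inverse_eq_divide)
  also have "harm (q - 1) \<le> (1 :: real) + ln (real (q - 1))"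
  proof -
    have "1 \<le> q - 1" using assms by simp
    then show ?thesis
      using euler_mascheroni_sequence_decreasing[of 1 "q - 1"] by (simp add: harm_expand)
  qed
  also have "ln (real (q - 1)) \<le> ln (real q)"
    using assms by simp
  finally show ?thesis by simp
qed

section \<open>Bilinear forms and the removal of conditions linking the variables\<close>

text \<open>Uniformity in the coefficients lets them absorb any bounded factor that depends on one
  variable only, such as a character twist or a cut-off.\<close>

definition bilin_bound :: "(nat \<Rightarrow> nat \<Rightarrow> complex) \<Rightarrow> nat set \<Rightarrow> nat set \<Rightarrow> real \<Rightarrow> bool" where
  "bilin_bound \<phi> A B S \<longleftrightarrow> (\<forall>\<alpha> \<beta>. (\<forall>m. cmod (\<alpha> m) \<le> 1) \<longrightarrow> (\<forall>n. cmod (\<beta> n) \<le> 1) \<longrightarrow>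
     cmod (\<Sum>m\<in>A. \<Sum>n\<in>B. \<alpha> m * \<beta> n * \<phi> m n) \<le> S)"

lemma bilin_boundD:
  "bilin_bound \<phi> A B S \<Longrightarrow> (\<And>m. cmod (\<alpha> m) \<le> 1) \<Longrightarrow> (\<And>n. cmod (\<beta> n) \<le> 1) \<Longrightarrow>
     cmod (\<Sum>m\<in>A. \<Sum>n\<in>B. \<alpha> m * \<beta> n * \<phi> m n) \<le> S"
  unfolding bilin_bound_def by blast

text \<open>The indicator of u n \<le> Y m is expanded into frequencies \<open>h\<close>. Each term
  is a product of a factor in \<open>m\<close> and a unimodular factor in \<open>n\<close>; after
  division by the majorant the first has modulus at most 1 as well, so \<open>S\<close> bounds every
  frequency and the majorants sum to \<open>interval_coeff_l1 q\<close>.\<close>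

lemma bilin_bound_decouple:
  assumes b: "bilin_bound \<phi> A B S" and Y: "\<And>m. Y m < q" and u: "\<And>n. u n < q"
  shows "bilin_bound (\<lambda>m n. (if u n \<le> Y m then 1 else 0) * \<phi> m n) A B (interval_coeff_l1 q * S)"
  unfolding bilin_bound_def
proof (intro allI impI)
  fix \<alpha> \<beta> :: "nat \<Rightarrow> complex"
  assume \<alpha>: "\<forall>m. cmod (\<alpha> m) \<le> 1" and \<beta>: "\<forall>n. cmod (\<beta> n) \<le> 1"
  define a where "a h m = \<alpha> m * (interval_coeff q (Y m) h / of_real (interval_coeff_bound q h))" for h m
  define c where "c h n = \<beta> n * add_char q (int h * int (u n))" for h n
  have "(\<Sum>m\<in>A. \<Sum>n\<in>B. \<alpha> m * \<beta> n * ((if u n \<le> Y m then 1 else 0) * \<phi> m n))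
      = (\<Sum>m\<in>A. \<Sum>n\<in>B. \<Sum>h<q. of_real (interval_coeff_bound q h) * (a h m * c h n * \<phi> m n))"
  proof (intro sum.cong refl)
    fix m n
    have "\<alpha> m * \<beta> n * ((if u n \<le> Y m then 1 else 0) * \<phi> m n)
       = \<alpha> m * \<beta> n * ((\<Sum>h<q. interval_coeff q (Y m) h * add_char q (int h * int (u n))) * \<phi> m n)"
      using Y u by (simp add: sum_interval_coeff)
    also have "\<dots> = (\<Sum>h<q. of_real (interval_coeff_bound q h) * (a h m * c h n * \<phi> m n))"
      unfolding sum_distrib_left sum_distrib_right
    proof (intro sum.cong refl)
      fix h assume "h \<in> {..<q}"
      then have "interval_coeff_bound q h \<noteq> 0" using interval_coeff_bound_pos[of h q] by simp
      then show "\<alpha> m * \<beta> n * (interval_coeff q (Y m) h * add_char q (int h * int (u n)) * \<phi> m n)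
        = of_real (interval_coeff_bound q h) * (a h m * c h n * \<phi> m n)"
        by (simp add: a_def c_def)
    qed
    finally show "\<alpha> m * \<beta> n * ((if u n \<le> Y m then 1 else 0) * \<phi> m n)
       = (\<Sum>h<q. of_real (interval_coeff_bound q h) * (a h m * c h n * \<phi> m n))" .
  qed
  also have "\<dots> = (\<Sum>m\<in>A. \<Sum>h<q. \<Sum>n\<in>B. of_real (interval_coeff_bound q h) * (a h m * c h n * \<phi> m n))"
    by (intro sum.cong refl sum.swap)
  also have "\<dots> = (\<Sum>h<q. \<Sum>m\<in>A. \<Sum>n\<in>B. of_real (interval_coeff_bound q h) * (a h m * c h n * \<phi> m n))"
    by (rule sum.swap)
  also have "\<dots> = (\<Sum>h<q. of_real (interval_coeff_bound q h) * (\<Sum>m\<in>A. \<Sum>n\<in>B. a h m * c h n * \<phi> m n))"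
    by (simp add: sum_distrib_left)
  also have "cmod \<dots> \<le> (\<Sum>h<q. interval_coeff_bound q h * S)"
  proof (rule order.trans[OF norm_sum], rule sum_mono)
    fix h assume h: "h \<in> {..<q}"
    then have p: "interval_coeff_bound q h > 0" using interval_coeff_bound_pos by simp
    have "cmod (\<Sum>m\<in>A. \<Sum>n\<in>B. a h m * c h n * \<phi> m n) \<le> S"
    proof (rule bilin_boundD[OF b])
      fix m
      have "cmod (interval_coeff q (Y m) h) / interval_coeff_bound q h \<le> 1"
        using norm_interval_coeff[OF Y, of h m] h p by simp
      then show "cmod (a h m) \<le> 1"
        using \<alpha> p unfolding a_def norm_mult norm_divide norm_of_real
        by (intro mult_le_one) auto
    next
      fix n show "cmod (c h n) \<le> 1"
        using \<beta> by (simp add: c_def norm_mult)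
    qed
    then show "cmod (of_real (interval_coeff_bound q h) * (\<Sum>m\<in>A. \<Sum>n\<in>B. a h m * c h n * \<phi> m n)) \<le> interval_coeff_bound q h * S"
      using p by (simp add: norm_mult)
  qed
  also have "\<dots> = interval_coeff_l1 q * S"
    by (simp add: interval_coeff_l1_def sum_distrib_right)
  finally show "cmod (\<Sum>m\<in>A. \<Sum>n\<in>B. \<alpha> m * \<beta> n * ((if u n \<le> Y m then 1 else 0) * \<phi> m n))
     \<le> interval_coeff_l1 q * S" .
qed

lemma bilin_bound_swap:
  assumes "bilin_bound \<phi> A B S"
  shows "bilin_bound (\<lambda>n m. \<phi> m n) B A S"
  unfolding bilin_bound_def
proof (intro allI impI)
  fix \<alpha> \<beta> :: "nat \<Rightarrow> complex"
  assume "\<forall>m. cmod (\<alpha> m) \<le> 1" "\<forall>n. cmod (\<beta> n) \<le> 1"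
  then have "cmod (\<Sum>m\<in>A. \<Sum>n\<in>B. \<beta> m * \<alpha> n * \<phi> m n) \<le> S"
    by (intro bilin_boundD[OF assms]) auto
  then show "cmod (\<Sum>m\<in>B. \<Sum>n\<in>A. \<alpha> m * \<beta> n * \<phi> n m) \<le> S"
    by (subst sum.swap) (simp add: mult_ac)
qed

section \<open>Moments, additive energies and Hoelder's inequality\<close>

lemma power_mean_sum:
  fixes f :: "'a \<Rightarrow> real"
  assumes "finite P" "\<And>p. p \<in> P \<Longrightarrow> f p \<ge> 0" "k > 0"
  shows "(\<Sum>p\<in>P. f p) ^ k \<le> real (card P) ^ (k - 1) * (\<Sum>p\<in>P. f p ^ k)"
proof (cases "P = {}")
  case False
  define c where "c = real (card P)"
  have c: "c > 0" using False assms(1) by (simp add: c_def card_gt_0_iff)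
  have cv: "convex_on {0::real..} (\<lambda>x. x ^ k)"
  proof (cases "even k")
    case True
    then show ?thesis
      by (rule convex_on_subset[OF convex_power_even]) simp_all
  qed (rule convex_power_odd)
  have "(\<Sum>p\<in>P. (1 / c) *\<^sub>R f p) ^ k \<le> (\<Sum>p\<in>P. (1 / c) * f p ^ k)"
    by (rule convex_on_sum[OF assms(1) False cv])
      (use c assms(2) in \<open>auto simp: c_def\<close>)
  then have "((\<Sum>p\<in>P. f p) / c) ^ k \<le> (\<Sum>p\<in>P. f p ^ k) / c"
    by (simp add: sum_divide_distrib)
  then have "(\<Sum>p\<in>P. f p) ^ k \<le> c ^ k * ((\<Sum>p\<in>P. f p ^ k) / c)"
    using c by (simp add: power_divide divide_le_eq mult.commute)
  also have "\<dots> = c ^ (k - 1) * (\<Sum>p\<in>P. f p ^ k)"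
    using c assms(3) by (cases k) auto
  finally show ?thesis by (simp add: c_def)
qed (use assms(3) in \<open>simp add: power_0_left\<close>)

text \<open>The k-th power of the sum is itself a character sum, over k-tuples, to which
  \<open>parseval_card\<close> applies.\<close>

lemma moment_card:
  fixes u :: "'a \<Rightarrow> int"
  assumes "q > 0" "finite A"
  shows "(\<Sum>t<q. cmod (\<Sum>a\<in>A. add_char q (int t * u a)) ^ (2 * k))
    = real q * real (card {(g, g'). g \<in> {..<k} \<rightarrow>\<^sub>E A \<and> g' \<in> {..<k} \<rightarrow>\<^sub>E A \<and>
        [(\<Sum>i<k. u (g i)) = (\<Sum>i<k. u (g' i))] (mod int q)})"
proof -
  have *: "(\<Sum>a\<in>A. add_char q (int t * u a)) ^ k
      = (\<Sum>g\<in>{..<k} \<rightarrow>\<^sub>E A. add_char q (int t * (\<Sum>i<k. u (g i))))" for t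
  proof -
    have "(\<Sum>a\<in>A. add_char q (int t * u a)) ^ k = (\<Prod>i<k. \<Sum>a\<in>A. add_char q (int t * u a))"
      by simp
    also have "\<dots> = (\<Sum>g\<in>{..<k} \<rightarrow>\<^sub>E A. \<Prod>i<k. add_char q (int t * u (g i)))"
      using assms(2) by (intro prod_sum_PiE) auto
    finally show ?thesis
      by (simp add: add_char_sum sum_distrib_left)
  qed
  have "(\<Sum>t<q. cmod (\<Sum>a\<in>A. add_char q (int t * u a)) ^ (2 * k))
      = (\<Sum>t<q. (cmod (\<Sum>g\<in>{..<k} \<rightarrow>\<^sub>E A. add_char q (int t * (\<Sum>i<k. u (g i)))))\<^sup>2)"
    by (intro sum.cong refl, subst *[symmetric]) (simp add: norm_power power_mult[symmetric] mult.commute)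
  also have "\<dots> = real q * real (card {(g, g'). g \<in> {..<k} \<rightarrow>\<^sub>E A \<and> g' \<in> {..<k} \<rightarrow>\<^sub>E A \<and>
        [(\<Sum>i<k. u (g i)) = (\<Sum>i<k. u (g' i))] (mod int q)})"
    using assms by (intro parseval_card finite_PiE) auto
  finally show ?thesis .
qed

text \<open>The additive energy of the family \<open>u\<close> over \<open>B\<close>, written with
  differences because these are what opening a square in \<open>bilinear_hoelder\<close>
  produces.\<close>

definition diff_energy :: "nat \<Rightarrow> ('a \<Rightarrow> int) \<Rightarrow> 'a set \<Rightarrow> nat" where
  "diff_energy q u B = card {(p, p'). p \<in> B \<times> B \<and> p' \<in> B \<times> B \<and>
     [u (fst p) - u (snd p) = u (fst p') - u (snd p')] (mod int q)}"

lemma fourth_moment_diff: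
  fixes u :: "'a \<Rightarrow> int"
  assumes "q > 0" "finite B"
  shows "(\<Sum>t<q. cmod (\<Sum>a\<in>B. add_char q (int t * u a)) ^ 4) = real q * real (diff_energy q u B)"
proof -
  have *: "(\<Sum>a\<in>B. add_char q (int t * u a)) * cnj (\<Sum>a\<in>B. add_char q (int t * u a))
      = (\<Sum>p\<in>B \<times> B. add_char q (int t * (u (fst p) - u (snd p))))" for t
    by (simp add: sum_product sum.cartesian_product case_prod_unfold right_diff_distrib add_char_diff)
  have "cmod z ^ 4 = (cmod (z * cnj z))\<^sup>2" for z
    by (simp add: norm_mult power2_eq_square power4_eq_xxxx mult.assoc)
  then have "(\<Sum>t<q. cmod (\<Sum>a\<in>B. add_char q (int t * u a)) ^ 4)
      = (\<Sum>t<q. (cmod (\<Sum>p\<in>B \<times> B. add_char q (int t * (u (fst p) - u (snd p)))))\<^sup>2)"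
    by (simp only: *)
  also have "\<dots> = real q * real (diff_energy q u B)"
    unfolding diff_energy_def using assms by (intro parseval_card) auto
  finally show ?thesis .
qed

text \<open>The left side is that of \<open>fourth_moment_diff\<close>. Reading the fourth power as
  |z z|^2 instead of |z cnj z|^2 shows that counting with sums and with differences gives the same
  energy.\<close>

lemma fourth_moment_sum:
  fixes u :: "'a \<Rightarrow> int"
  assumes "q > 0" "finite B"
  shows "(\<Sum>t<q. cmod (\<Sum>a\<in>B. add_char q (int t * u a)) ^ 4)
    = real q * real (card {(p, p'). p \<in> B \<times> B \<and> p' \<in> B \<times> B \<and>
     [u (fst p) + u (snd p) = u (fst p') + u (snd p')] (mod int q)})"
proof -
  have *: "(\<Sum>a\<in>B. add_char q (int t * u a)) * (\<Sum>a\<in>B. add_char q (int t * u a))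
      = (\<Sum>p\<in>B \<times> B. add_char q (int t * (u (fst p) + u (snd p))))" for t
    by (simp add: sum_product sum.cartesian_product case_prod_unfold distrib_left add_char_add)
  have "cmod z ^ 4 = (cmod (z * z))\<^sup>2" for z
    by (simp add: norm_mult power2_eq_square power4_eq_xxxx mult.assoc)
  then have "(\<Sum>t<q. cmod (\<Sum>a\<in>B. add_char q (int t * u a)) ^ 4)
      = (\<Sum>t<q. (cmod (\<Sum>p\<in>B \<times> B. add_char q (int t * (u (fst p) + u (snd p)))))\<^sup>2)"
    by (simp only: *)
  also have "\<dots> = real q * real (card {(p, p'). p \<in> B \<times> B \<and> p' \<in> B \<times> B \<and>
     [u (fst p) + u (snd p) = u (fst p') + u (snd p')] (mod int q)})"
    using assms by (intro parseval_card) auto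
  finally show ?thesis .
qed

lemma sum_card_fibres_sq:
  fixes c :: "'a \<Rightarrow> nat"
  assumes "finite P" "\<And>p. p \<in> P \<Longrightarrow> c p < q"
  shows "(\<Sum>l<q. (card {p\<in>P. c p = l})\<^sup>2) = card {(p, p'). p \<in> P \<and> p' \<in> P \<and> c p = c p'}"
proof -
  have "{(p, p'). p \<in> P \<and> p' \<in> P \<and> c p = c p'} = (\<Union>l<q. {p\<in>P. c p = l} \<times> {p\<in>P. c p = l})"
    using assms(2) by auto
  also have "card \<dots> = (\<Sum>l<q. card ({p\<in>P. c p = l} \<times> {p\<in>P. c p = l}))"
    using assms(1) by (intro card_UN_disjoint) auto
  finally show ?thesis
    by (simp add: card_cartesian_product power2_eq_square)
qed

text \<open>Cauchy-Schwarz in \<open>m\<close> removes \<alpha>, and opening the square in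
  \<open>n\<close> leaves the sums \<open>T\<close> at the points h (v n - v n'). Hoelder's
  inequality raises these to the k-th power. Another Cauchy-Schwarz, over residues, separates how
  often a residue is hit, whose second moment is the energy of \<open>v\<close>, from the complete
  moment of \<open>T\<close>.\<close>

lemma bilinear_hoelder:
  fixes u :: "'a \<Rightarrow> int" and v :: "'b \<Rightarrow> int" and \<alpha> :: "'a \<Rightarrow> complex" and \<beta> :: "'b \<Rightarrow> complex"
  assumes q: "prime q" and h: "\<not> int q dvd h" and A: "finite A" and B: "finite B"
    and \<alpha>: "\<And>m. cmod (\<alpha> m) \<le> 1" and \<beta>: "\<And>n. cmod (\<beta> n) \<le> 1" and k: "k > 0"
  shows "cmod (\<Sum>m\<in>A. \<Sum>n\<in>B. \<alpha> m * \<beta> n * add_char q (h * u m * v n)) ^ (4 * k)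
    \<le> real (card A) ^ (2 * k) * real (card B) ^ (4 * k - 4) * real (diff_energy q v B)
      * (\<Sum>t<q. cmod (\<Sum>m\<in>A. add_char q (int t * u m)) ^ (2 * k))"
proof -
  have q0: "q > 0" using q prime_gt_0_nat by blast
  define S where "S = (\<Sum>m\<in>A. \<Sum>n\<in>B. \<alpha> m * \<beta> n * add_char q (h * u m * v n))"
  define G where "G m = (\<Sum>n\<in>B. \<beta> n * add_char q (h * u m * v n))" for m
  define T where "T x = (\<Sum>m\<in>A. add_char q (x * u m))" for x :: int
  define P where "P = B \<times> B"
  define w where "w p = h * (v (fst p) - v (snd p))" for p
  define c where "c p = nat (w p mod int q)" for p
  define r where "r l = card {p\<in>P. c p = l}" for l
  have P: "finite P" "card P = card B ^ 2"
    using B by (simp_all add: P_def card_cartesian_product power2_eq_square)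
  have c: "c p < q" "[int (c p) = w p] (mod int q)" for p
    using q0 by (auto simp: c_def cong_def nat_less_iff)
  have "cmod S \<le> (\<Sum>m\<in>A. cmod (G m))"
  proof -
    have "S = (\<Sum>m\<in>A. \<alpha> m * G m)"
      by (simp add: S_def G_def sum_distrib_left mult.assoc)
    also have "cmod \<dots> \<le> (\<Sum>m\<in>A. cmod (\<alpha> m) * cmod (G m))"
      by (rule order.trans[OF norm_sum]) (simp add: norm_mult)
    also have "\<dots> \<le> (\<Sum>m\<in>A. cmod (G m))"
      by (intro sum_mono mult_left_le_one_le) (auto simp: \<alpha>)
    finally show ?thesis .
  qed
  then have "cmod S ^ 2 \<le> (\<Sum>m\<in>A. cmod (G m)) ^ 2"
    by (rule power_mono) simp
  also have "\<dots> \<le> real (card A) * (\<Sum>m\<in>A. cmod (G m) ^ 2)"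
    using power_mean_sum[OF A, of "\<lambda>m. cmod (G m)" 2] by simp
  also have "(\<Sum>m\<in>A. cmod (G m) ^ 2) \<le> (\<Sum>p\<in>P. cmod (T (w p)))"
  proof -
    have "complex_of_real (\<Sum>m\<in>A. cmod (G m) ^ 2)
        = (\<Sum>m\<in>A. \<Sum>n\<in>B. \<Sum>n'\<in>B. \<beta> n * cnj (\<beta> n') * add_char q (h * (v n - v n') * u m))"
      by (simp add: complex_norm_square G_def sum_product add_char_diff right_diff_distrib
          left_diff_distrib mult_ac flip: of_real_power)
    also have "\<dots> = (\<Sum>m\<in>A. \<Sum>p\<in>P. \<beta> (fst p) * cnj (\<beta> (snd p)) * add_char q (w p * u m))"
      by (simp add: P_def w_def sum.cartesian_product case_prod_unfold)
    also have "\<dots> = (\<Sum>p\<in>P. \<beta> (fst p) * cnj (\<beta> (snd p)) * T (w p))"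
      by (subst sum.swap) (simp add: T_def sum_distrib_left)
    finally have "(\<Sum>m\<in>A. cmod (G m) ^ 2) = cmod (\<Sum>p\<in>P. \<beta> (fst p) * cnj (\<beta> (snd p)) * T (w p))"
      by (metis (no_types, lifting) abs_of_nonneg norm_of_real sum_nonneg zero_le_power2)
    also have "\<dots> \<le> (\<Sum>p\<in>P. cmod (\<beta> (fst p)) * cmod (\<beta> (snd p)) * cmod (T (w p)))"
      by (rule order.trans[OF norm_sum]) (simp add: norm_mult)
    also have "\<dots> \<le> (\<Sum>p\<in>P. cmod (T (w p)))"
      by (intro sum_mono mult_left_le_one_le) (auto simp: \<beta> intro!: mult_le_one)
    finally show ?thesis .
  qed
  finally have S2: "cmod S ^ 2 \<le> real (card A) * (\<Sum>p\<in>P. cmod (T (w p)))"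
    by (simp add: mult_left_mono)
  \<comment> \<open>\<open>T\<close> depends only on the residue of its argument, so the pairs are
    grouped by residue, with multiplicity \<open>r l\<close>.\<close>
  have TP: "(\<Sum>p\<in>P. cmod (T (w p)) ^ k) = (\<Sum>l<q. real (r l) * cmod (T (int l)) ^ k)"
  proof -
    have "cmod (T (w p)) = cmod (T (int (c p)))" for p
      unfolding T_def using c(2)[of p]
      by (intro arg_cong[where f = cmod] sum.cong refl add_char_cong[OF q0]) (meson cong_scalar_right cong_sym)
    then have "(\<Sum>p\<in>P. cmod (T (w p)) ^ k) = (\<Sum>p\<in>P. cmod (T (int (c p))) ^ k)"
      by simp
    also have "\<dots> = (\<Sum>l<q. \<Sum>p\<in>{p\<in>P. c p = l}. cmod (T (int (c p))) ^ k)"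
      by (rule sum.group[symmetric]) (use P c in auto)
    also have "\<dots> = (\<Sum>l<q. real (r l) * cmod (T (int l)) ^ k)"
      by (intro sum.cong refl) (simp add: r_def)
    finally show ?thesis .
  qed
  have r2: "(\<Sum>l<q. real (r l) ^ 2) = real (diff_energy q v B)"
  proof -
    have "c p = c p' \<longleftrightarrow>
       [v (fst p) - v (snd p) = v (fst p') - v (snd p')] (mod int q)" for p p'
    proof -
      have "c p = c p' \<longleftrightarrow> [w p = w p'] (mod int q)"
        using q0 by (simp add: c_def eq_nat_nat_iff) (simp only: Cong.cong_def)
      also have "\<dots> \<longleftrightarrow> [v (fst p) - v (snd p) = v (fst p') - v (snd p')] (mod int q)"
        unfolding w_def by (rule cong_mult_lcancel_prime[OF q h])
      finally show ?thesis .
    qed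
    then show ?thesis
      using sum_card_fibres_sq[OF P(1), of c q] c(1)
      by (simp add: r_def diff_energy_def P_def flip: of_nat_power of_nat_sum)
  qed
  have "cmod S ^ (4 * k) = ((cmod S ^ 2) ^ k) ^ 2"
    by (simp add: power_mult[symmetric] mult.commute)
  also have "\<dots> \<le> ((real (card A) * (\<Sum>p\<in>P. cmod (T (w p)))) ^ k) ^ 2"
    by (intro power_mono S2) auto
  also have "\<dots> = (real (card A) ^ k * (\<Sum>p\<in>P. cmod (T (w p))) ^ k) ^ 2"
    by (simp add: power_mult_distrib)
  also have "\<dots> \<le> (real (card A) ^ k * (real (card P) ^ (k - 1) * (\<Sum>p\<in>P. cmod (T (w p)) ^ k))) ^ 2"
    by (intro power_mono mult_left_mono power_mean_sum P k) (auto intro!: sum_nonneg mult_nonneg_nonneg zero_le_power)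
  also have "\<dots> = real (card A) ^ (2 * k) * real (card B) ^ (4 * k - 4)
      * (\<Sum>l<q. real (r l) * cmod (T (int l)) ^ k) ^ 2"
  proof -
    have "(real (card P) ^ (k - 1)) ^ 2 = real (card B) ^ (4 * k - 4)"
    proof -
      have e: "2 * (k - 1) * 2 = 4 * k - 4" by simp
      show ?thesis
        by (simp only: P(2) of_nat_power power_mult[symmetric] e)
    qed
    then show ?thesis
      by (simp add: TP power_mult_distrib power_mult[symmetric] mult.commute)
  qed
  also have "\<dots> \<le> real (card A) ^ (2 * k) * real (card B) ^ (4 * k - 4)
      * ((\<Sum>l<q. real (r l) ^ 2) * (\<Sum>l<q. (cmod (T (int l)) ^ k) ^ 2))"
    by (intro mult_left_mono Cauchy_Schwarz_ineq_sum) auto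
  also have "(\<Sum>l<q. (cmod (T (int l)) ^ k) ^ 2) = (\<Sum>t<q. cmod (\<Sum>m\<in>A. add_char q (int t * u m)) ^ (2 * k))"
    by (simp add: T_def power_mult[symmetric] mult.commute)
  finally show ?thesis
    by (simp add: S_def r2 mult.assoc)
qed

section \<open>Additive energies of inverses\<close>

lemma card_divisors_prime_power_mult:
  fixes p :: nat
  assumes "prime p" "m > 0"
  shows "card {d. d dvd p ^ a * m} \<le> (a + 1) * card {d. d dvd m}"
proof -
  have fin: "finite {d. d dvd m}" using assms(2) by simp
  have "{d. d dvd p ^ a * m} \<subseteq> (\<lambda>(i, e). p ^ i * e) ` ({..a} \<times> {d. d dvd m})"
  proof
    fix d assume "d \<in> {d. d dvd p ^ a * m}"
    then obtain b c where "d = b * c" "b dvd p ^ a" "c dvd m"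
      by (auto dest: division_decomp)
    moreover from this obtain i where "i \<le> a" "b = p ^ i"
      using assms(1) by (auto simp: divides_primepow_nat)
    ultimately show "d \<in> (\<lambda>(i, e). p ^ i * e) ` ({..a} \<times> {d. d dvd m})"
      by auto
  qed
  then have "card {d. d dvd p ^ a * m} \<le> card ((\<lambda>(i, e). p ^ i * e) ` ({..a} \<times> {d. d dvd m}))"
    using fin by (intro card_mono) auto
  also have "\<dots> \<le> card ({..a} \<times> {d. d dvd m})"
    using fin by (intro card_image_le) auto
  finally show ?thesis by (simp add: card_cartesian_product)
qed

text \<open>Stripping p^a from n divides the divisor count by at most a + 1. For primes from
  2^(1/\<epsilon>) on, p^(\<epsilon> a) is at least 2^a \<ge> a + 1 and nothing is lost. Each of the
  finitely many smaller primes costs one factor \<open>c\<close>, so \<open>c\<close> to the power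
  \<open>P0\<close> serves as the constant.\<close>

lemma divisor_bound:
  fixes \<epsilon> :: real
  assumes "\<epsilon> > 0"
  shows "\<exists>C\<ge>1. \<forall>n>0. real (card {d. d dvd n}) \<le> C * real n powr \<epsilon>"
proof -
  \<comment> \<open>Chosen so that 1 \<le> c \<epsilon> ln 2 and 1 \<le> c; then a + 1 \<le> c (1 +
    \<epsilon> a ln 2), which is at most c 2^(\<epsilon> a) by the linear lower bound for
    exp.\<close>
  define c where "c = max 1 (1 / (\<epsilon> * ln 2))"
  define P0 where "P0 = nat \<lceil>2 powr (1 / \<epsilon>)\<rceil>"
  define S where "S n = {p. p < P0 \<and> prime p \<and> p dvd n}" for n :: nat
  have c1: "c \<ge> 1" by (simp add: c_def)
  have finS: "finite (S n)" for n by (simp add: S_def)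
  have small: "real a + 1 \<le> c * real p powr (\<epsilon> * a)" if "p \<ge> 2" for a p :: nat
  proof -
    have "real a + 1 \<le> c * (1 + \<epsilon> * a * ln 2)"
    proof -
      have "real a \<le> c * (\<epsilon> * a * ln 2)"
      proof -
        have "1 \<le> c * (\<epsilon> * ln 2)"
          using assms by (auto simp: c_def max_def field_simps)
        then have "real a * 1 \<le> real a * (c * (\<epsilon> * ln 2))"
          by (intro mult_left_mono) auto
        then show ?thesis by (simp add: mult_ac)
      qed
      then show ?thesis using c1 by (simp add: algebra_simps)
    qed
    also have "\<dots> \<le> c * exp (\<epsilon> * a * ln 2)"
      using c1 by (intro mult_left_mono exp_ge_add_one_self) auto
    also have "\<dots> = c * 2 powr (\<epsilon> * a)" by (simp add: powr_def)
    also have "\<dots> \<le> c * real p powr (\<epsilon> * a)"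
      using that assms c1 by (intro mult_left_mono powr_mono2) auto
    finally show ?thesis .
  qed
  have large: "real a + 1 \<le> real p powr (\<epsilon> * a)" if "p \<ge> P0" "p \<ge> 2" for a p :: nat
  proof -
    have "2 powr (1 / \<epsilon>) \<le> real p" using that by (simp add: P0_def nat_le_iff ceiling_le_iff)
    then have "(2 powr (1 / \<epsilon>)) powr (\<epsilon> * a) \<le> real p powr (\<epsilon> * a)"
      using assms by (intro powr_mono2) auto
    then have "2 ^ a \<le> real p powr (\<epsilon> * a)"
      using assms by (simp add: powr_powr powr_realpow)
    moreover have "real a + 1 \<le> 2 ^ a"
    proof -
      have "a < 2 ^ a" by (rule less_exp)
      then have "Suc a \<le> 2 ^ a" by (simp only: Suc_le_eq)
      then have "real (Suc a) \<le> real (2 ^ a)" by (simp only: of_nat_le_iff)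
      then show ?thesis by simp
    qed
    ultimately show ?thesis by simp
  qed
  have main: "real (card {d. d dvd n}) \<le> c ^ card (S n) * real n powr \<epsilon>" if "n > 0" for n :: nat
    using that
  proof (induction n rule: less_induct)
    case (less n)
    show ?case
    proof (cases "n = 1")
      case True
      then show ?thesis using c1 by simp
    next
      case False
      then obtain p where p: "prime p" "p dvd n"
        by (metis prime_factor_nat)
      obtain m where m: "n = p ^ multiplicity p n * m" "\<not> p dvd m"
        using multiplicity_decompose'[of n p] not_prime_unit[of p] p less.prems
        by (metis gr_implies_not0)
      define a where "a = multiplicity p n"
      have a: "a > 0" using p less.prems by (simp add: a_def prime_multiplicity_gt_zero_iff)
      have n: "n = p ^ a * m" using m by (simp add: a_def)
      have m0: "m > 0" using m less.prems by (cases "m = 0") auto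
      have p2: "p \<ge> 2" using p prime_ge_2_nat by blast
      have "p ^ a > 1" using p2 a by (intro one_less_power) auto
      then have "m < n" using n m0 by simp
      then have IH: "real (card {d. d dvd m}) \<le> c ^ card (S m) * real m powr \<epsilon>"
        using less.IH m0 by blast
      have pa: "real n powr \<epsilon> = real p powr (\<epsilon> * a) * real m powr \<epsilon>"
        using p2 m0 n by (simp add: powr_mult powr_powr mult.commute flip: powr_realpow)
      have sub: "S m \<subseteq> S n" using n by (auto simp: S_def)
      have key: "(real a + 1) * c ^ card (S m) \<le> c ^ card (S n) * real p powr (\<epsilon> * a)"
      proof (cases "p < P0")
        case True
        then have "p \<in> S n" "p \<notin> S m" using p m by (auto simp: S_def)
        then have "card (S m) < card (S n)"
          using sub finS by (intro psubset_card_mono) auto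
        then have "c ^ Suc (card (S m)) \<le> c ^ card (S n)"
          using c1 by (intro power_increasing) auto
        then have "c * c ^ card (S m) * real p powr (\<epsilon> * a) \<le> c ^ card (S n) * real p powr (\<epsilon> * a)"
          by (intro mult_right_mono) auto
        moreover have "(real a + 1) * c ^ card (S m) \<le> c * real p powr (\<epsilon> * a) * c ^ card (S m)"
          using small[OF p2, of a] c1 by (intro mult_right_mono) auto
        ultimately show ?thesis by (simp add: mult_ac)
      next
        case False
        have "c ^ card (S m) \<le> c ^ card (S n)"
          using c1 sub finS by (intro power_increasing card_mono) auto
        then show ?thesis
          using large[of p a] p2 False c1
          by (subst mult.commute, intro mult_mono) auto
      qed
      have "real (card {d. d dvd n}) \<le> real ((a + 1) * card {d. d dvd m})"
        using card_divisors_prime_power_mult[OF p(1) m0, of a] n by (simp only: of_nat_le_iff)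
      also have "\<dots> = (real a + 1) * real (card {d. d dvd m})" by (simp add: distrib_right)
      also have "\<dots> \<le> (real a + 1) * (c ^ card (S m) * real m powr \<epsilon>)"
        using IH by (intro mult_left_mono) auto
      also have "\<dots> \<le> c ^ card (S n) * real p powr (\<epsilon> * a) * real m powr \<epsilon>"
        using mult_right_mono[OF key, of "real m powr \<epsilon>"] by (simp add: mult_ac)
      also have "\<dots> = c ^ card (S n) * real n powr \<epsilon>" by (simp add: pa mult_ac)
      finally show ?thesis .
    qed
  qed
  have "c ^ card (S n) \<le> c ^ P0" for n
    using c1 card_mono[of "{..<P0}" "S n"] by (intro power_increasing) (auto simp: S_def)
  then have "real (card {d. d dvd n}) \<le> c ^ P0 * real n powr \<epsilon>" if "n > 0" for n
    using main[OF that] by (meson mult_right_mono order.trans powr_ge_zero)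
  moreover have "c ^ P0 \<ge> 1" using c1 by simp
  ultimately show ?thesis by blast
qed

lemma int_divisor_bound:
  fixes w :: int
  assumes "w \<noteq> 0"
  shows "finite {d. d dvd w}" "card {d. d dvd w} \<le> 2 * card {d. d dvd nat \<bar>w\<bar>}"
proof -
  let ?D = "{d. d dvd nat \<bar>w\<bar>}"
  have fin: "finite ?D" using assms by (intro finite_divisors_nat) simp
  have sub: "{d. d dvd w} \<subseteq> int ` ?D \<union> (\<lambda>d. - int d) ` ?D"
  proof
    fix d assume "d \<in> {d. d dvd w}"
    then have "nat \<bar>d\<bar> dvd nat \<bar>w\<bar>" by (simp add: nat_abs_dvd_iff)
    moreover have "d = int (nat \<bar>d\<bar>) \<or> d = - int (nat \<bar>d\<bar>)" by linarith
    ultimately show "d \<in> int ` ?D \<union> (\<lambda>d. - int d) ` ?D" by blast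
  qed
  show "finite {d. d dvd w}" using fin by (intro finite_subset[OF sub]) auto
  have "card {d. d dvd w} \<le> card (int ` ?D \<union> (\<lambda>d. - int d) ` ?D)"
    using fin by (intro card_mono[OF _ sub]) auto
  also have "\<dots> \<le> card (int ` ?D) + card ((\<lambda>d. - int d) ` ?D)" by (rule card_Un_le)
  also have "\<dots> \<le> card ?D + card ?D" using fin by (intro add_mono card_image_le) auto
  finally show "card {d. d dvd w} \<le> 2 * card ?D" by simp
qed

text \<open>Multiplying \<open>c (x + y) = x y\<close> by a Dirichlet denominator \<open>t\<close> of \<open>c / q\<close>, with
  \<open>u = t c - j q\<close> small, turns the congruence into few equations
  \<open>(t x - u) (t y - u) = t q z + u\<^sup>2\<close> over the integers.\<close>

lemma inverse_sum_count:
  fixes q N :: nat and l :: int and C \<epsilon> :: real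
  assumes q: "prime q" and N: "0 < N" "N < q" and l: "\<not> int q dvd l"
    and C: "C \<ge> 1" "\<And>n. n > 0 \<Longrightarrow> real (card {d. d dvd n}) \<le> C * real n powr \<epsilon>" and \<epsilon>: "\<epsilon> > 0"
  shows "real (card {p. p \<in> {1..N} \<times> {1..N} \<and>
       [modinv q (int (fst p)) + modinv q (int (snd p)) = l] (mod int q)})
     \<le> 20 * C * real q powr (4 * \<epsilon>) * (1 + real N powr (3/2) * real q powr (-1/2))"
proof -
  define Q where "Q = {p. p \<in> {1..N} \<times> {1..N} \<and>
       [modinv q (int (fst p)) + modinv q (int (snd p)) = l] (mod int q)}"
  have q2: "q \<ge> 2" using q prime_ge_2_nat by blast
  \<comment> \<open>The Dirichlet height that balances the two parts of \<open>v\<close> below: t x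
    y is at most s N^2 and u (x + y) is about q N / s, and both equal q N / s for this
    \<open>s\<close>.\<close>
  define s where "s = sqrt (real q / real N)"
  have s1: "s \<ge> 1" using N by (simp add: s_def)
  have sq: "s ^ 2 = real q / real N" by (simp add: s_def)
  define T where "T = nat \<lfloor>s\<rfloor>"
  have T0: "T > 0" and Ts: "real T \<le> s" using s1 by (auto simp: T_def le_nat_iff)
  have T2: "s \<le> 2 * real T" 
  proof -
    have "1 \<le> \<lfloor>s\<rfloor>" using s1 by (simp add: le_floor_iff)
    then have "1 \<le> real T" "real T = real_of_int \<lfloor>s\<rfloor>" by (simp_all add: T_def)
    then show ?thesis by linarith
  qed
  have s_le: "s \<le> sqrt (real q)" unfolding s_def using N by (simp add: divide_le_eq)
  have sqrtq: "sqrt (real q) < real q"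
    using q2 by (intro real_less_lsqrt) (auto simp: power2_eq_square)
  have Tq: "T < q" using Ts s_le sqrtq by linarith
  have TN: "real T * real N \<le> real q"
  proof -
    have "real T * real N \<le> s * s * real N" using Ts s1 N
      by (intro mult_right_mono) (auto intro: order.trans[OF Ts])
    also have "\<dots> = real q" using sq N by (simp add: power2_eq_square)
    finally show ?thesis .
  qed
  define c where "c = modinv q l"
  have c: "[l * c = 1] (mod int q)" unfolding c_def by (rule modinv_right[OF q l])
  have cq: "\<not> int q dvd c" unfolding c_def by (rule modinv_not_dvd[OF q l])
  obtain j t where t: "0 < t" "t \<le> int T" "\<bar>of_int t * (real_of_int c / real q) - of_int j\<bar> < 1 / real T"
    using Dirichlet_approx[OF T0, of "real_of_int c / real q"] by blast
  define u where "u = t * c - int q * j"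
  have u_less: "\<bar>real_of_int u\<bar> < real q / real T"
  proof -
    have "real_of_int u = real q * (of_int t * (real_of_int c / real q) - of_int j)"
      using q2 by (simp add: u_def field_simps)
    then have "\<bar>real_of_int u\<bar> = real q * \<bar>of_int t * (real_of_int c / real q) - of_int j\<bar>"
      by (simp add: abs_mult)
    also have "\<dots> < real q * (1 / real T)" using t(3) q2 by (intro mult_strict_left_mono) auto
    finally show ?thesis by simp
  qed
  have u_le: "\<bar>real_of_int u\<bar> \<le> real q"
  proof -
    have "real q / real T \<le> real q / 1" using T0 by (intro divide_left_mono) auto
    then show ?thesis using u_less by simp
  qed
  have tq: "\<not> int q dvd t" using t Tq by (auto dest: zdvd_imp_le)
  \<comment> \<open>\<open>u\<close> is congruent to t c, and \<open>q\<close> divides neither t,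
    which is at most T < q, nor c. This is what later keeps the integer to be factored
    nonzero.\<close>
  have uq: "\<not> int q dvd u"
  proof
    assume "int q dvd u"
    then have "int q dvd t * c" by (simp add: u_def dvd_diff_left_iff)
    then show False using prime_int_q[OF q] tq cq by (auto simp: prime_dvd_mult_iff)
  qed
  define X where "X = real N powr (3/2) * real q powr (-1/2)"
  have X: "X = real N / s"
  proof -
    have "s = real q powr (1/2) / real N powr (1/2)"
      unfolding s_def by (simp add: powr_half_sqrt real_sqrt_divide)
    then have "real N / s = real N * real N powr (1/2) / real q powr (1/2)"
      by (simp only: divide_divide_eq_right)
    also have "\<dots> = real N powr 1 * real N powr (1/2) / real q powr (1/2)"
      using N by simp
    also have "real N powr 1 * real N powr (1/2) = real N powr (3/2)"
      by (subst powr_add[symmetric]) simp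
    also have "real N powr (3/2) / real q powr (1/2) = X"
      unfolding X_def by (simp add: powr_minus_divide)
    finally show ?thesis by simp
  qed
  \<comment> \<open>Modulo \<open>q\<close> this is t (x y - c (x + y)), hence 0; its quotient
    \<open>z\<close> by \<open>q\<close> takes only about 1 + X values.\<close>
  define v where "v p = t * int (fst p) * int (snd p) - u * (int (fst p) + int (snd p))"
    for p :: "nat \<times> nat"
  define z where "z p = v p div int q" for p
  define R where "R = \<lfloor>5 * X\<rfloor>"
  have X0: "X \<ge> 0" by (simp add: X_def)
  have finQ: "finite Q" by (rule finite_subset[of _ "{1..N} \<times> {1..N}"]) (auto simp: Q_def)
  have v: "v p = int q * z p" if "p \<in> Q" for p
  proof -
    obtain x y where p: "p = (x, y)" by (cases p)
    have xy: "1 \<le> x" "x \<le> N" "1 \<le> y" "y \<le> N"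
      and cong: "[modinv q (int x) + modinv q (int y) = l] (mod int q)"
      using that by (auto simp: Q_def p)
    have nx: "[int x * modinv q (int x) = 1] (mod int q)" "[int y * modinv q (int y) = 1] (mod int q)"
      using xy N not_dvd_small[of x q] not_dvd_small[of y q] modinv_right[OF q] by auto
    have "[int x * int y * (modinv q (int x) + modinv q (int y)) = int x * int y * l] (mod int q)"
      using cong by (rule cong_scalar_left)
    moreover have "[(int x * modinv q (int x)) * int y + (int y * modinv q (int y)) * int x
        = 1 * int y + 1 * int x] (mod int q)"
      using nx by (intro cong_add cong_mult cong_refl)
    ultimately have "[int y + int x = int x * int y * l] (mod int q)"
      by (simp add: algebra_simps) (meson cong_sym cong_trans)
    then have "[(int y + int x) * c = int x * int y * l * c] (mod int q)"
      by (rule cong_scalar_right)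
    moreover have "[int x * int y * (l * c) = int x * int y * 1] (mod int q)"
      using c by (rule cong_scalar_left)
    ultimately have "[(int y + int x) * c = int x * int y] (mod int q)"
      by (metis cong_trans mult.assoc mult.right_neutral)
    then have "int q dvd t * ((int y + int x) * c - int x * int y)"
      by (simp add: cong_iff_dvd_diff)
    then have "int q dvd int q * (j * (int y + int x)) - t * ((int y + int x) * c - int x * int y)"
      by (meson dvd_diff dvd_triv_left)
    moreover have "\<dots> = v p" by (simp add: v_def p u_def algebra_simps)
    ultimately show ?thesis by (simp add: z_def)
  qed
  have z_range: "z p \<in> {- R..R}" if "p \<in> Q" for p
  proof -
    obtain x y where p: "p = (x, y)" by (cases p)
    have xy: "x \<le> N" "y \<le> N" using that by (auto simp: Q_def p)
    have "real q * \<bar>real_of_int (z p)\<bar> = \<bar>real_of_int (v p)\<bar>"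
      using v[OF that] by (simp add: abs_mult)
    also have "\<dots> \<le> real_of_int t * real x * real y + \<bar>real_of_int u\<bar> * (real x + real y)"
      unfolding v_def p using t
      by (simp, intro order.trans[OF abs_triangle_ineq4]) (simp add: abs_mult)
    also have "\<dots> \<le> s * real N * real N + real q / real T * (real N + real N)"
    proof (rule add_mono)
      have ts: "real_of_int t \<le> s" using t(2) Ts by linarith
      have "real x * real y \<le> real N * real N"
        using xy by (intro mult_mono) auto
      then have "real_of_int t * (real x * real y) \<le> s * (real N * real N)"
        using s1 by (intro mult_mono[OF ts]) auto
      then show "real_of_int t * real x * real y \<le> s * real N * real N"
        by (simp only: mult.assoc)
      show "\<bar>real_of_int u\<bar> * (real x + real y) \<le> real q / real T * (real N + real N)"
        using u_less xy by (intro mult_mono) auto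
    qed
    also have "real q / real T \<le> 2 * real q / s"
      using mult_right_mono[OF T2, of "real q"] T0 s1 by (simp add: field_simps)
    finally have *: "real q * \<bar>real_of_int (z p)\<bar> \<le> s * real N * real N + 2 * real q / s * (real N + real N)"
      by (simp add: mult_right_mono)
    have "s * real N * real N = real q * X"
      using sq s1 N by (simp add: X field_simps power2_eq_square)
    moreover have "2 * real q / s * (real N + real N) = 4 * (real q * X)"
      by (simp add: X)
    ultimately have "real q * \<bar>real_of_int (z p)\<bar> \<le> real q * (5 * X)"
      using * by (simp add: mult_ac)
    then have "\<bar>real_of_int (z p)\<bar> \<le> 5 * X" using q2 by simp
    then have "real_of_int (z p) \<le> 5 * X" "real_of_int (- z p) \<le> 5 * X" by linarith+
    then have "z p \<le> R" "- z p \<le> R" unfolding R_def by (simp_all only: le_floor_iff)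
    then show ?thesis by auto
  qed
  \<comment> \<open>For fixed \<open>z\<close> the divisor t x - u of the fixed integer
    \<open>w\<close> determines the pair. Both factors are at most 2 q in modulus, so |w| \<le> 4
    q^2 \<le> q^4, which explains the exponent 4 \<epsilon>.\<close>
  have fibre: "real (card {p\<in>Q. z p = k}) \<le> 2 * C * real q powr (4 * \<epsilon>)" for k
  proof (cases "{p\<in>Q. z p = k} = {}")
    case True
    then show ?thesis using C(1) by (simp only: card.empty) simp
  next
    case False
    define w where "w = t * int q * k + u ^ 2"
    have w0: "w \<noteq> 0"
    proof
      assume "w = 0"
      then have "int q dvd t * int q * k + u ^ 2" by (simp add: w_def)
      moreover have "int q dvd t * int q * k" by simp
      ultimately have "int q dvd u ^ 2" by (simp only: dvd_add_right_iff)
      then show False using uq prime_int_q[OF q] prime_dvd_power by blast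
    qed
    have fac: "(t * int (fst p) - u) * (t * int (snd p) - u) = w" if "p \<in> {p\<in>Q. z p = k}" for p
    proof -
      have "v p = int q * k" using that v by auto
      then have "t * v p = t * (int q * k)" by simp
      then show ?thesis unfolding v_def w_def by (simp add: algebra_simps power2_eq_square)
    qed
    have "card {p\<in>Q. z p = k} \<le> card {d. d dvd w}"
    proof (rule card_inj_on_le)
      show "inj_on (\<lambda>p. t * int (fst p) - u) {p\<in>Q. z p = k}"
      proof (rule inj_onI)
        fix p p' assume p: "p \<in> {p\<in>Q. z p = k}" "p' \<in> {p\<in>Q. z p = k}"
          and eq: "t * int (fst p) - u = t * int (fst p') - u"
        from eq t have "fst p = fst p'" by simp
        moreover have "t * int (fst p) - u \<noteq> 0" using fac[OF p(1)] w0 by auto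
        then have "t * int (snd p) - u = t * int (snd p') - u"
          using fac[OF p(1)] fac[OF p(2)] eq by (metis mult_left_cancel)
        then have "snd p = snd p'" using t by simp
        ultimately show "p = p'" by (simp add: prod_eq_iff)
      qed
      show "(\<lambda>p. t * int (fst p) - u) ` {p\<in>Q. z p = k} \<subseteq> {d. d dvd w}"
        using fac by (metis (no_types, lifting) dvd_triv_left image_subsetI mem_Collect_eq)
      show "finite {d. d dvd w}" using w0 by (rule int_divisor_bound)
    qed
    also have "\<dots> \<le> 2 * card {d. d dvd nat \<bar>w\<bar>}" using w0 by (rule int_divisor_bound)
    finally have "real (card {p\<in>Q. z p = k}) \<le> 2 * real (card {d. d dvd nat \<bar>w\<bar>})"
      by linarith
    also have "\<dots> \<le> 2 * (C * real (nat \<bar>w\<bar>) powr \<epsilon>)"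
      using C(2)[of "nat \<bar>w\<bar>"] w0 by simp
    also have "real (nat \<bar>w\<bar>) powr \<epsilon> \<le> (real q ^ 4) powr \<epsilon>"
    proof (rule powr_mono2)
      from False obtain p where p: "p \<in> {p\<in>Q. z p = k}" by blast
      then have le: "1 \<le> fst p" "fst p \<le> N" "1 \<le> snd p" "snd p \<le> N" by (auto simp: Q_def)
      have b: "\<bar>real_of_int (t * int x - u)\<bar> \<le> 2 * real q" if "x \<le> N" for x
      proof -
        have "real_of_int t \<le> real T" using t(2) by linarith
        then have "real_of_int t * real x \<le> real T * real N"
          using that by (intro mult_mono) auto
        then have 1: "real_of_int t * real x \<le> real q" using TN by linarith
        have 2: "0 \<le> real_of_int t * real x" using t by simp
        have "real_of_int (t * int x - u) = real_of_int t * real x - real_of_int u" by simp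
        then show ?thesis using 1 2 u_le by linarith
      qed
      have "real (nat \<bar>w\<bar>) = \<bar>real_of_int w\<bar>" by simp
      also have "\<dots> = \<bar>real_of_int (t * int (fst p) - u)\<bar> * \<bar>real_of_int (t * int (snd p) - u)\<bar>"
        by (simp only: fac[OF p, symmetric] of_int_mult abs_mult)
      also have "\<dots> \<le> (2 * real q) * (2 * real q)"
        by (rule mult_mono[OF b[OF le(2)] b[OF le(4)]]) simp_all
      also have "\<dots> = real (2 * q) * real (2 * q)" by simp
      also have "\<dots> \<le> real (q * q) * real (q * q)"
      proof -
        have "2 * q \<le> q * q" using q2 by (rule mult_le_mono1)
        then have *: "real (2 * q) \<le> real (q * q)" by (simp only: of_nat_le_iff)
        show ?thesis by (rule mult_mono[OF * * of_nat_0_le_iff of_nat_0_le_iff])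
      qed
      finally show "real (nat \<bar>w\<bar>) \<le> real q ^ 4"
        by (simp only: of_nat_mult power4_eq_xxxx mult.assoc)
    qed (use \<epsilon> in auto)
    also have "(real q ^ 4) powr \<epsilon> = real q powr (4 * \<epsilon>)"
    proof -
      have "real q ^ 4 = real q powr 4" using q2 by (simp add: powr_numeral)
      then show ?thesis by (simp only: powr_powr)
    qed
    finally show ?thesis using C(1) by (simp add: mult_ac)
  qed
  have "real (card Q) = (\<Sum>k\<in>{-R..R}. real (card {p\<in>Q. z p = k}))"
  proof -
    have "card Q = (\<Sum>k\<in>{-R..R}. card {p\<in>Q. z p = k})"
      using sum.group[OF finQ, of "{-R..R}" z "\<lambda>_. 1::nat"] z_range by (simp add: image_subset_iff)
    then show ?thesis by simp
  qed
  also have "\<dots> \<le> (\<Sum>k\<in>{-R..R}. 2 * C * real q powr (4 * \<epsilon>))"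
    by (intro sum_mono fibre)
  also have "\<dots> = (2 * real_of_int R + 1) * (2 * C * real q powr (4 * \<epsilon>))"
    using X0 by (simp add: R_def)
  also have "\<dots> \<le> (10 * (1 + X)) * (2 * C * real q powr (4 * \<epsilon>))"
  proof (intro mult_right_mono)
    have "real_of_int R \<le> 5 * X" by (simp add: R_def)
    then show "2 * real_of_int R + 1 \<le> 10 * (1 + X)" using X0 by argo
  qed (use C(1) in auto)
  also have "\<dots> = 20 * C * real q powr (4 * \<epsilon>) * (1 + X)"
    by (simp add: algebra_simps)
  finally show ?thesis by (simp only: Q_def X_def)
qed

text \<open>Covers the residue 0, which \<open>inverse_sum_count\<close> excludes: x determines the
  inverse of y, hence y.\<close>

lemma inverse_sum_count_trivial:
  assumes q: "prime q" and N: "N < q"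
  shows "card {p. p \<in> {1..N} \<times> {1..N} \<and>
       [modinv q (int (fst p)) + modinv q (int (snd p)) = l] (mod int q)} \<le> N"
proof -
  let ?Q = "{p. p \<in> {1..N} \<times> {1..N} \<and>
       [modinv q (int (fst p)) + modinv q (int (snd p)) = l] (mod int q)}"
  have "card ?Q \<le> card {1..N}"
  proof (rule card_inj_on_le)
    show "inj_on fst ?Q"
    proof (rule inj_onI)
      fix p p' assume p: "p \<in> ?Q" "p' \<in> ?Q" and eq: "fst p = fst p'"
      have "[modinv q (int (fst p)) + modinv q (int (snd p))
          = modinv q (int (fst p)) + modinv q (int (snd p'))] (mod int q)"
        using p eq by (auto intro: cong_trans cong_sym)
      then have "[modinv q (int (snd p)) = modinv q (int (snd p'))] (mod int q)"
        by (simp only: cong_add_lcancel)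
      moreover have "\<not> int q dvd int (snd p)" "\<not> int q dvd int (snd p')"
        using p N not_dvd_small[of "snd p" q] not_dvd_small[of "snd p'" q] by auto
      ultimately have "[int (snd p) = int (snd p')] (mod int q)"
        using modinv_inj[OF q] by blast
      then have "snd p = snd p'"
        using p N cong_less_modulus_unique_nat[of "snd p" "snd p'" q] by (auto simp: cong_int_iff)
      with eq show "p = p'" by (simp add: prod_eq_iff)
    qed
  qed auto
  then show ?thesis by simp
qed

text \<open>The energy is turned from differences into sums, where \<open>inverse_sum_count\<close>
  bounds the fibres over nonzero residues. At most N pairs have sum 0 and each of their fibres has
  at most N elements; these N^2 solutions raise the constant from 20 to 21.\<close>

lemma inverse_energy_bound:
  fixes q N :: nat and C \<epsilon> :: real
  assumes q: "prime q" and N: "0 < N" "N < q"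
    and C: "C \<ge> 1" "\<And>n. n > 0 \<Longrightarrow> real (card {d. d dvd n}) \<le> C * real n powr \<epsilon>" and \<epsilon>: "\<epsilon> > 0"
  shows "real (diff_energy q (\<lambda>n. modinv q (int n)) {1..N})
     \<le> 21 * C * real q powr (4 * \<epsilon>) * (1 + real N powr (3/2) * real q powr (-1/2)) * real N ^ 2"
proof -
  define B where "B = {1..N}"
  define w where "w p = modinv q (int (fst p)) + modinv q (int (snd p))" for p :: "nat \<times> nat"
  define I where "I = C * real q powr (4 * \<epsilon>) * (1 + real N powr (3/2) * real q powr (-1/2))"
  define F where "F l = {p. p \<in> B \<times> B \<and> [w p = l] (mod int q)}" for l
  have q1: "q \<ge> 1" using N by simp
  have finB: "finite (B \<times> B)" by (simp add: B_def)
  have finF: "finite (F l)" for l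
    by (rule finite_subset[OF _ finB]) (auto simp: F_def)
  have I1: "I \<ge> 1"
  proof -
    have "real q powr (4 * \<epsilon>) \<ge> 1" using q1 \<epsilon> by (intro ge_one_powr_ge_zero) auto
    then have "1 * 1 * 1 \<le> C * real q powr (4 * \<epsilon>) * (1 + real N powr (3/2) * real q powr (-1/2))"
      using C(1) by (intro mult_mono) auto
    then show ?thesis by (simp add: I_def)
  qed
  \<comment> \<open>Both counts are read off from the same fourth moment.\<close>
  have "real q * real (diff_energy q (\<lambda>n. modinv q (int n)) B)
      = real q * real (card {(p, p'). p \<in> B \<times> B \<and> p' \<in> B \<times> B \<and> [w p = w p'] (mod int q)})"
    unfolding w_def using q1
    by (subst fourth_moment_diff[symmetric], simp, simp add: B_def, subst fourth_moment_sum)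
      (simp_all add: B_def)
  then have "diff_energy q (\<lambda>n. modinv q (int n)) B
      = card {(p, p'). p \<in> B \<times> B \<and> p' \<in> B \<times> B \<and> [w p = w p'] (mod int q)}"
    using q1 by simp
  also have "{(p, p'). p \<in> B \<times> B \<and> p' \<in> B \<times> B \<and> [w p = w p'] (mod int q)} = (SIGMA p:B \<times> B. F (w p))"
    unfolding F_def using cong_sym by (auto intro: cong_sym)
  also have "card \<dots> = (\<Sum>p\<in>B \<times> B. card (F (w p)))"
    using finB finF by (subst card_SigmaI) auto
  finally have "real (diff_energy q (\<lambda>n. modinv q (int n)) B) = (\<Sum>p\<in>B \<times> B. real (card (F (w p))))"
    by simp
  also have "\<dots> \<le> (\<Sum>p\<in>B \<times> B. 20 * I + (if p \<in> F 0 then real N else 0))"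
  proof (rule sum_mono)
    fix p assume p: "p \<in> B \<times> B"
    show "real (card (F (w p))) \<le> 20 * I + (if p \<in> F 0 then real N else 0)"
    proof (cases "p \<in> F 0")
      case True
      have "card (F (w p)) \<le> N"
        unfolding F_def w_def B_def by (rule inverse_sum_count_trivial[OF q N(2)])
      then have "real (card (F (w p))) \<le> real N" by simp
      then show ?thesis using True I1 by simp
    next
      case False
      then have "\<not> int q dvd w p" using p by (simp add: F_def cong_0_iff)
      then have "real (card (F (w p))) \<le> 20 * I"
        using inverse_sum_count[OF q N _ C \<epsilon>, of "w p"] unfolding F_def B_def
        by (simp add: I_def w_def mult_ac)
      then show ?thesis using False by simp
    qed
  qed
  also have "\<dots> = real N ^ 2 * (20 * I) + real (card (F 0)) * real N"
  proof -
    have "(\<Sum>p\<in>B \<times> B. if p \<in> F 0 then real N else 0) = (\<Sum>p\<in>F 0. real N)"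
      by (rule sum.mono_neutral_cong_right) (use finB in \<open>auto simp: F_def\<close>)
    then show ?thesis
      by (simp add: sum.distrib card_cartesian_product B_def power2_eq_square)
  qed
  also have "\<dots> \<le> real N ^ 2 * (20 * I) + real N ^ 2 * I"
  proof -
    have "card (F 0) \<le> N"
      unfolding F_def w_def B_def by (rule inverse_sum_count_trivial[OF q N(2)])
    then have "real (card (F 0)) * real N \<le> real N * real N" by (simp add: mult_right_mono)
    also have "\<dots> \<le> real N ^ 2 * I"
      using I1 mult_left_mono[OF I1, of "real N ^ 2"] by (simp add: power2_eq_square)
    finally show ?thesis by linarith
  qed
  also have "\<dots> = 21 * I * real N ^ 2" by simp
  finally show ?thesis by (simp only: B_def I_def mult.assoc)
qed

section \<open>Sums of k inverses and powerful numbers\<close>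

text \<open>A prime occurs in \<open>squarefree_part n\<close> when its multiplicity in n is odd;
  this multiplicity, being at least 2, then leaves at least one factor for
  \<open>square_part n\<close>.\<close>

lemma powerful_decompose:
  fixes n :: nat
  assumes n: "n > 0" and pow: "\<And>p. prime p \<Longrightarrow> p dvd n \<Longrightarrow> p\<^sup>2 dvd n"
  shows "squarefree_part n dvd square_part n"
proof (rule multiplicity_le_imp_dvd)
  show "squarefree_part n \<noteq> 0" using n by simp
  fix p :: nat assume p: "prime p"
  have "multiplicity p n mod 2 \<le> multiplicity p n div 2"
  proof (cases "p dvd n")
    case True
    then have "multiplicity p n \<ge> 2"
      using pow[OF p True] n p by (intro multiplicity_geI) (auto simp: not_prime_unit)
    then show ?thesis by linarith
  qed (simp add: not_dvd_imp_multiplicity_0)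
  then show "multiplicity p (squarefree_part n) \<le> multiplicity p (square_part n)"
    using p by (simp add: prime_multiplicity_squarefree_part prime_multiplicity_square_part)
qed

text \<open>A powerful number is a^2 b with b dividing a, by \<open>powerful_decompose\<close>. Here
  a \<le> R, so the count is at most the sum of the divisor numbers up to R.\<close>

lemma card_powerful_le:
  fixes R :: nat and C \<epsilon> :: real
  assumes C: "C \<ge> 1" "\<And>n. n > 0 \<Longrightarrow> real (card {d. d dvd n}) \<le> C * real n powr \<epsilon>" and \<epsilon>: "\<epsilon> > 0"
  shows "real (card {n. 0 < n \<and> n \<le> R\<^sup>2 \<and> (\<forall>p. prime p \<longrightarrow> p dvd n \<longrightarrow> p\<^sup>2 dvd n)})
     \<le> C * real R * real R powr \<epsilon>"
proof -
  let ?P = "{n. 0 < n \<and> n \<le> R\<^sup>2 \<and> (\<forall>p. prime p \<longrightarrow> p dvd n \<longrightarrow> p\<^sup>2 dvd n)}"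
  have "card ?P \<le> card (SIGMA a:{1..R}. {b. b dvd a})"
  proof (rule card_inj_on_le)
    show "inj_on (\<lambda>n. (square_part n, squarefree_part n)) ?P"
      by (rule inj_onI) (metis (no_types, lifting) Pair_inject squarefree_decompose)
    show "(\<lambda>n. (square_part n, squarefree_part n)) ` ?P \<subseteq> (SIGMA a:{1..R}. {b. b dvd a})"
    proof (rule image_subsetI)
      fix n assume n: "n \<in> ?P"
      have "square_part n ^ 2 \<le> n"
        using n by (intro dvd_imp_le) auto
      also have "n \<le> R\<^sup>2" using n by simp
      finally have "square_part n \<le> R" by (simp add: power2_nat_le_eq_le)
      moreover have "square_part n > 0" using n by (intro Nat.gr0I) simp
      moreover have "squarefree_part n dvd square_part n"
        using n by (intro powerful_decompose) auto
      ultimately show "(square_part n, squarefree_part n) \<in> (SIGMA a:{1..R}. {b. b dvd a})"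
        by simp
    qed
    show "finite (SIGMA a:{1..R}. {b. b dvd a})"
      by (intro finite_SigmaI) (auto intro!: finite_divisors_nat)
  qed
  also have "\<dots> = (\<Sum>a\<in>{1..R}. card {b. b dvd a})"
    by (subst card_SigmaI) (auto intro!: finite_divisors_nat)
  finally have "real (card ?P) \<le> (\<Sum>a\<in>{1..R}. real (card {b. b dvd a}))"
    by (simp flip: of_nat_sum)
  also have "\<dots> \<le> (\<Sum>a\<in>{1..R}. C * real R powr \<epsilon>)"
  proof (rule sum_mono)
    fix a assume a: "a \<in> {1..R}"
    have "real (card {b. b dvd a}) \<le> C * real a powr \<epsilon>" using C(2)[of a] a by simp
    also have "\<dots> \<le> C * real R powr \<epsilon>"
      using a \<epsilon> C(1) by (intro mult_left_mono powr_mono2) auto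
    finally show "real (card {b. b dvd a}) \<le> C * real R powr \<epsilon>" .
  qed
  finally show ?thesis by (simp add: mult_ac)
qed

text \<open>The hypothesis is the equation sum e_i / a_i = 0 cleared of denominators. If p divides
  a_i, it divides all terms but the i-th, hence also that one, so p divides the product of the
  remaining a_j and a second factor p appears.\<close>

lemma unit_fraction_sum_powerful:
  fixes a :: "'a \<Rightarrow> nat" and e :: "'a \<Rightarrow> int"
  assumes I: "finite I" and e: "\<And>i. i \<in> I \<Longrightarrow> \<bar>e i\<bar> = 1"
    and sum: "(\<Sum>i\<in>I. e i * (\<Prod>j\<in>I - {i}. int (a j))) = 0"
    and p: "prime p" "p dvd (\<Prod>i\<in>I. a i)"
  shows "p\<^sup>2 dvd (\<Prod>i\<in>I. a i)"
proof -
  obtain i where i: "i \<in> I" "p dvd a i"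
    using p I prime_dvd_prod_iff by blast
  have pp: "prime (int p)" using p by simp
  have "int p dvd (\<Sum>k\<in>I - {i}. e k * (\<Prod>j\<in>I - {k}. int (a j)))"
  proof (rule dvd_sum)
    fix k assume k: "k \<in> I - {i}"
    have "int (a i) dvd (\<Prod>j\<in>I - {k}. int (a j))"
      using I i k by (intro dvd_prodI) auto
    then show "int p dvd e k * (\<Prod>j\<in>I - {k}. int (a j))"
      using i by (meson dvd_mult dvd_trans int_dvd_int_iff)
  qed
  moreover have "e i * (\<Prod>j\<in>I - {i}. int (a j)) + (\<Sum>k\<in>I - {i}. e k * (\<Prod>j\<in>I - {k}. int (a j))) = 0"
    using sum by (simp only: sum.remove[OF I i(1), of "\<lambda>k. e k * (\<Prod>j\<in>I - {k}. int (a j))"])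
  ultimately have "int p dvd e i * (\<Prod>j\<in>I - {i}. int (a j))"
    by (metis (no_types) dvd_0_right dvd_add_left_iff)
  moreover have "\<not> int p dvd e i"
    using e[OF i(1)] p(1) by (metis abs_dvd_iff dvd_abs_iff int_dvd_int_iff not_prime_unit of_nat_1)
  ultimately have "int p dvd (\<Prod>j\<in>I - {i}. int (a j))"
    using pp by (simp add: prime_dvd_mult_iff)
  then have "p dvd (\<Prod>j\<in>I - {i}. a j)"
    by (simp flip: of_nat_prod add: int_dvd_int_iff)
  then have "p * p dvd a i * (\<Prod>j\<in>I - {i}. a j)"
    using i(2) by (intro mult_dvd_mono)
  then show ?thesis
    using prod.remove[OF I i(1), of a] by (simp add: power2_eq_square)
qed

text \<open>Used twice: in \<open>inverse_moment_bound\<close> the cleared sum is so small that it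
  vanishes, in \<open>shifted_inverse_sum_roots\<close> it is the value of a polynomial.\<close>

lemma clear_inverses:
  fixes x e :: "'a \<Rightarrow> int"
  assumes q: "prime q" and I: "finite I" and x: "\<And>i. i \<in> I \<Longrightarrow> \<not> int q dvd x i"
    and sum: "int q dvd (\<Sum>i\<in>I. e i * modinv q (x i))"
  shows "int q dvd (\<Sum>i\<in>I. e i * (\<Prod>j\<in>I - {i}. x j))"
proof -
  have "[(\<Prod>j\<in>I. x j) * (\<Sum>i\<in>I. e i * modinv q (x i)) = (\<Sum>i\<in>I. e i * (\<Prod>j\<in>I - {i}. x j))] (mod int q)"
    unfolding sum_distrib_left
  proof (rule cong_sum)
    fix i assume i: "i \<in> I"
    have "(\<Prod>j\<in>I. x j) * (e i * modinv q (x i)) = (e i * (\<Prod>j\<in>I - {i}. x j)) * (x i * modinv q (x i))"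
      by (subst prod.remove[OF I i]) (simp add: mult_ac)
    moreover have "[(e i * (\<Prod>j\<in>I - {i}. x j)) * (x i * modinv q (x i)) = (e i * (\<Prod>j\<in>I - {i}. x j)) * 1] (mod int q)"
      using modinv_right[OF q x[OF i]] by (rule cong_scalar_left)
    ultimately show "[(\<Prod>j\<in>I. x j) * (e i * modinv q (x i)) = e i * (\<Prod>j\<in>I - {i}. x j)] (mod int q)"
      by (simp only: mult_1_right)
  qed
  then show ?thesis
    using sum by (metis cong_dvd_iff dvd_mult)
qed

text \<open>Clearing denominators gives 2 k terms of size at most M^(2k-1), so by
  \<open>small\<close> a sum divisible by \<open>q\<close> is 0. There are about M^k powerful
  numbers up to M^(2k), and each splits into 2 k divisors in few ways: up to small powers of
  \<open>q\<close> the count is no larger than that of the diagonal solutions.\<close>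

lemma inverse_moment_bound:
  fixes q M k :: nat and C \<epsilon> :: real
  assumes q: "prime q" and k: "0 < k" and M: "0 < M" and small: "2 * k * M ^ (2 * k - 1) < q"
    and C: "C \<ge> 1" "\<And>n. n > 0 \<Longrightarrow> real (card {d. d dvd n}) \<le> C * real n powr \<epsilon>" and \<epsilon>: "\<epsilon> > 0"
  shows "real (card {(g, g'). g \<in> {..<k} \<rightarrow>\<^sub>E {1..M} \<and> g' \<in> {..<k} \<rightarrow>\<^sub>E {1..M} \<and>
        [(\<Sum>i<k. modinv q (int (g i))) = (\<Sum>i<k. modinv q (int (g' i)))] (mod int q)})
     \<le> C ^ (2 * k + 1) * (real q powr (2 * \<epsilon>)) ^ (2 * k + 1) * real M ^ k"
proof -
  define G where "G = {(g, g'). g \<in> {..<k} \<rightarrow>\<^sub>E {1..M} \<and> g' \<in> {..<k} \<rightarrow>\<^sub>E {1..M} \<and>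
        [(\<Sum>i<k. modinv q (int (g i))) = (\<Sum>i<k. modinv q (int (g' i)))] (mod int q)}"
  define D where "D = (\<lambda>(g, g'). (\<Prod>i<k. g i) * (\<Prod>i<k. g' i :: nat))"
  define R where "R = M ^ k"
  define Pw where "Pw = {n. 0 < n \<and> n \<le> R\<^sup>2 \<and> (\<forall>p. prime p \<longrightarrow> p dvd n \<longrightarrow> p\<^sup>2 dvd n)}"
  have Mq: "M < q"
  proof -
    have "M ^ 1 \<le> M ^ (2 * k - 1)" using M k by (intro power_increasing) auto
    also have "\<dots> \<le> 2 * k * M ^ (2 * k - 1)" using k by simp
    finally show ?thesis using small by simp
  qed
  have M2k: "real M ^ (2 * k) \<le> real q * real M"
  proof -
    have "M ^ (2 * k - 1) * 1 \<le> M ^ (2 * k - 1) * (2 * k)"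
      using k by (intro mult_le_mono2) simp
    also have "\<dots> = 2 * k * M ^ (2 * k - 1)" by (rule mult.commute)
    finally have "M ^ (2 * k - 1) \<le> q" using small by linarith
    then have "M ^ (2 * k - 1) * M \<le> q * M" by (rule mult_le_mono1)
    moreover have "M ^ (2 * k - 1) * M = M ^ (2 * k)"
      using k by (simp flip: power_Suc2)
    ultimately have "M ^ (2 * k) \<le> q * M" by (simp only:)
    then have "real (M ^ (2 * k)) \<le> real (q * M)" by (simp only: of_nat_le_iff)
    then show ?thesis by simp
  qed
  have Dpos: "D p > 0" if "p \<in> G" for p
    using that by (auto simp: G_def D_def PiE_iff Suc_le_eq intro!: prod_pos)
  have DPw: "D p \<in> Pw" if "p \<in> G" for p
  proof -
    obtain g g' where p: "p = (g, g')" by (cases p)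
    have g: "\<And>i. i < k \<Longrightarrow> 1 \<le> g i \<and> g i \<le> M" "\<And>i. i < k \<Longrightarrow> 1 \<le> g' i \<and> g' i \<le> M"
      and cong: "[(\<Sum>i<k. modinv q (int (g i))) = (\<Sum>i<k. modinv q (int (g' i)))] (mod int q)"
      using that by (auto simp: G_def p PiE_iff)
    \<comment> \<open>Both sides of the congruence become one family of 2 k variables, with sign 1
      on the left half and -1 on the right half.\<close>
    define I :: "(nat + nat) set" where "I = {..<k} <+> {..<k}"
    define a where "a = case_sum g g'"
    define e where "e = (case_sum (\<lambda>_. 1) (\<lambda>_. -1) :: nat + nat \<Rightarrow> int)"
    have I: "finite I" "card I = 2 * k" by (auto simp: I_def card_Plus)
    have e1: "\<bar>e i\<bar> = 1" for i by (cases i) (auto simp: e_def)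
    have a1: "1 \<le> a i" "a i \<le> M" if "i \<in> I" for i
      using that g by (auto simp: I_def a_def)
    have prodI: "(\<Prod>i\<in>I. a i) = D p"
      by (simp add: I_def D_def a_def p prod.Plus)
    have "(\<Sum>i\<in>I. e i * modinv q (int (a i))) = (\<Sum>i<k. modinv q (int (g i))) - (\<Sum>i<k. modinv q (int (g' i)))"
      by (simp add: I_def e_def a_def sum.Plus sum_negf)
    then have "int q dvd (\<Sum>i\<in>I. e i * modinv q (int (a i)))"
      using cong by (simp add: cong_iff_dvd_diff)
    moreover have "\<not> int q dvd int (a i)" if "i \<in> I" for i
      using a1[OF that] Mq by (intro not_dvd_small) auto
    ultimately have dvd: "int q dvd (\<Sum>i\<in>I. e i * (\<Prod>j\<in>I - {i}. int (a j)))"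
      using clear_inverses[OF q I(1), of "\<lambda>i. int (a i)" e] by blast
    have "\<bar>\<Sum>i\<in>I. e i * (\<Prod>j\<in>I - {i}. int (a j))\<bar> \<le> (\<Sum>i\<in>I. int M ^ (2 * k - 1))"
    proof (rule order.trans[OF sum_abs], rule sum_mono)
      fix i assume i: "i \<in> I"
      have "\<bar>e i * (\<Prod>j\<in>I - {i}. int (a j))\<bar> = (\<Prod>j\<in>I - {i}. int (a j))"
        by (simp add: abs_mult e1 prod_nonneg abs_prod)
      also have "\<dots> \<le> (\<Prod>j\<in>I - {i}. int M)"
        using a1 by (intro prod_mono) auto
      also have "\<dots> = int M ^ (2 * k - 1)"
        using I i by simp
      finally show "\<bar>e i * (\<Prod>j\<in>I - {i}. int (a j))\<bar> \<le> int M ^ (2 * k - 1)" .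
    qed
    also have "\<dots> = int (2 * k * M ^ (2 * k - 1))" by (simp add: I)
    also have "\<dots> < int q" using small by (simp only: of_nat_less_iff)
    finally have zero: "(\<Sum>i\<in>I. e i * (\<Prod>j\<in>I - {i}. int (a j))) = 0"
      using dvd by (meson dvd_imp_le_int not_le abs_of_nat order.strict_trans2 zdvd_not_zless linorder_not_less dvd_abs_iff zero_less_abs_iff)
    have "D p \<le> R\<^sup>2"
    proof -
      have "(\<Prod>i\<in>I. a i) \<le> (\<Prod>i\<in>I. M)" using a1 by (intro prod_mono) auto
      also have "\<dots> = R\<^sup>2" by (simp add: I R_def power_mult[symmetric] mult.commute)
      finally show ?thesis by (simp add: prodI)
    qed
    moreover have "p'\<^sup>2 dvd D p" if "prime p'" "p' dvd D p" for p'
      using unit_fraction_sum_powerful[OF I(1) e1 zero that(1)] that(2) by (simp add: prodI)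
    ultimately show ?thesis using Dpos[OF that] by (simp add: Pw_def)
  qed
  have finG: "finite G"
    by (rule finite_subset[of _ "({..<k} \<rightarrow>\<^sub>E {1..M}) \<times> ({..<k} \<rightarrow>\<^sub>E {1..M})"])
      (auto simp: G_def intro!: finite_PiE)
  have finPw: "finite Pw" by (rule finite_subset[of _ "{..R\<^sup>2}"]) (auto simp: Pw_def)
  have fibre: "real (card {p\<in>G. D p = n}) \<le> (C * real (R\<^sup>2) powr \<epsilon>) ^ (2 * k)" if n: "n \<in> Pw" for n
  proof -
    have n0: "n > 0" "n \<le> R\<^sup>2" using n by (auto simp: Pw_def)
    have fin: "finite {d. d dvd n}" using n0 by (intro finite_divisors_nat)
    have "{p\<in>G. D p = n} \<subseteq> ({..<k} \<rightarrow>\<^sub>E {d. d dvd n}) \<times> ({..<k} \<rightarrow>\<^sub>E {d. d dvd n})"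
    proof
      fix p assume p: "p \<in> {p\<in>G. D p = n}"
      obtain g g' where pg: "p = (g, g')" by (cases p)
      have "g i dvd (\<Prod>i<k. g i)" "g' i dvd (\<Prod>i<k. g' i)" if "i < k" for i
        using that by (auto intro!: dvd_prodI)
      then have "g i dvd n" "g' i dvd n" if "i < k" for i
        using p that by (auto simp: D_def pg)
      then show "p \<in> ({..<k} \<rightarrow>\<^sub>E {d. d dvd n}) \<times> ({..<k} \<rightarrow>\<^sub>E {d. d dvd n})"
        using p by (auto simp: pg G_def PiE_iff)
    qed
    then have "card {p\<in>G. D p = n} \<le> card (({..<k} \<rightarrow>\<^sub>E {d. d dvd n}) \<times> ({..<k} \<rightarrow>\<^sub>E {d. d dvd n}))"
      using fin by (intro card_mono) (auto intro!: finite_PiE)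
    also have "\<dots> = card {d. d dvd n} ^ (2 * k)"
      by (simp add: card_cartesian_product card_PiE power_add[symmetric] mult_2)
    finally have "real (card {p\<in>G. D p = n}) \<le> real (card {d. d dvd n}) ^ (2 * k)"
      by (simp flip: of_nat_power)
    also have "\<dots> \<le> (C * real n powr \<epsilon>) ^ (2 * k)"
      using C(2)[OF n0(1)] by (intro power_mono) auto
    also have "\<dots> \<le> (C * real (R\<^sup>2) powr \<epsilon>) ^ (2 * k)"
    proof (intro power_mono mult_left_mono powr_mono2)
      show "real n \<le> real (R\<^sup>2)" using n0(2) by (simp only: of_nat_le_iff)
    qed (use C(1) \<epsilon> in auto)
    finally show ?thesis .
  qed
  have "card G = (\<Sum>n\<in>Pw. card {p\<in>G. D p = n})"
    using sum.group[OF finG finPw, of D "\<lambda>_. 1::nat"] DPw by (simp add: image_subset_iff)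
  then have "real (card G) = (\<Sum>n\<in>Pw. real (card {p\<in>G. D p = n}))" by simp
  also have "\<dots> \<le> (\<Sum>n\<in>Pw. (C * real (R\<^sup>2) powr \<epsilon>) ^ (2 * k))"
    by (intro sum_mono fibre)
  also have "\<dots> = real (card Pw) * (C * real (R\<^sup>2) powr \<epsilon>) ^ (2 * k)" by simp
  also have "\<dots> \<le> (C * real R * real R powr \<epsilon>) * (C * real (R\<^sup>2) powr \<epsilon>) ^ (2 * k)"
    unfolding Pw_def using C(1) by (intro mult_right_mono card_powerful_le C \<epsilon>) auto
  also have "\<dots> \<le> (C * real R * real (R\<^sup>2) powr \<epsilon>) * (C * real (R\<^sup>2) powr \<epsilon>) ^ (2 * k)"
  proof (intro mult_right_mono mult_left_mono powr_mono2)
    have "R \<le> R\<^sup>2" by (simp add: power2_eq_square)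
    then show "real R \<le> real (R\<^sup>2)" by (simp only: of_nat_le_iff)
  qed (use C(1) \<epsilon> in auto)
  also have "\<dots> = C ^ (2 * k + 1) * (real (R\<^sup>2) powr \<epsilon>) ^ (2 * k + 1) * real R"
    by (simp add: power_mult_distrib mult_ac)
  also have "\<dots> \<le> C ^ (2 * k + 1) * (real q powr (2 * \<epsilon>)) ^ (2 * k + 1) * real R"
  proof (intro mult_right_mono mult_left_mono power_mono)
    have "real (R\<^sup>2) \<le> real q powr 2"
    proof -
      have "real (R\<^sup>2) = real M ^ (2 * k)"
        by (simp add: R_def power_mult[symmetric] mult.commute)
      also have "\<dots> \<le> real q * real q"
        using M2k Mq mult_left_mono[of "real M" "real q" "real q"] by linarith
      finally show ?thesis using q prime_gt_0_nat by (simp add: powr_numeral power2_eq_square)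
    qed
    then have "real (R\<^sup>2) powr \<epsilon> \<le> (real q powr 2) powr \<epsilon>"
      using \<epsilon> by (intro powr_mono2) auto
    then show "real (R\<^sup>2) powr \<epsilon> \<le> real q powr (2 * \<epsilon>)" by (simp only: powr_powr)
  qed (use C(1) in auto)
  finally show ?thesis by (simp add: R_def G_def del: power_Suc)
qed

section \<open>Bilinear Kloosterman sums\<close>

text \<open>\<open>inverse_energy_bound\<close> on a logarithmic scale: the first exponent is the
  diagonal size, and the second takes over when N exceeds q^(1/3).\<close>

lemma inverse_energy_powr:
  fixes \<epsilon> :: real
  assumes "\<epsilon> > 0"
  shows "\<exists>A\<ge>1. \<forall>q N. prime q \<longrightarrow> 0 < N \<longrightarrow> N < q \<longrightarrow>
    real (diff_energy q (\<lambda>n. modinv q (int n)) {1..N})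
      \<le> A * real q powr (\<epsilon> + max (2 * log q N) (7/2 * log q N - 1/2))"
proof -
  obtain C where C: "C \<ge> 1" "\<And>n. n > 0 \<Longrightarrow> real (card {d. d dvd n}) \<le> C * real n powr (\<epsilon> / 4)"
    using divisor_bound[of "\<epsilon> / 4"] assms by auto
  show ?thesis
  proof (intro exI[of _ "42 * C"] conjI allI impI)
    show "1 \<le> 42 * C" using C(1) by simp
    fix q N :: nat assume q: "prime q" and N: "0 < N" "N < q"
    define \<nu> where "\<nu> = log q N"
    define e where "e = max (2 * \<nu>) (7/2 * \<nu> - 1/2)"
    have q1: "real q > 1" using N by simp
    have N\<nu>: "real N = real q powr \<nu>" using N q1 by (simp add: \<nu>_def)
    have "real (diff_energy q (\<lambda>n. modinv q (int n)) {1..N})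
       \<le> 21 * C * real q powr \<epsilon> * (1 + real N powr (3/2) * real q powr (-1/2)) * real N ^ 2"
      using inverse_energy_bound[OF q N C] assms by simp
    also have "\<dots> = 21 * C * real q powr \<epsilon> * (real N ^ 2 + real N powr (3/2) * real q powr (-1/2) * real N ^ 2)"
      by (simp add: algebra_simps)
    also have "real N ^ 2 = real q powr (2 * \<nu>)"
      using q1 by (simp add: N\<nu> powr_power mult.commute)
    also have "real N powr (3/2) * real q powr (-1/2) * real q powr (2 * \<nu>) = real q powr (7/2 * \<nu> - 1/2)"
      unfolding N\<nu> powr_powr powr_add[symmetric] by (rule arg_cong[where f = "\<lambda>x. real q powr x"]) simp
    also have "real q powr (2 * \<nu>) + real q powr (7/2 * \<nu> - 1/2) \<le> real q powr e + real q powr e"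
      using q1 by (intro add_mono powr_mono) (auto simp: e_def)
    also have "21 * C * real q powr \<epsilon> * (real q powr e + real q powr e) = 42 * C * real q powr (\<epsilon> + e)"
      by (simp add: powr_add)
    finally show "real (diff_energy q (\<lambda>n. modinv q (int n)) {1..N})
      \<le> 42 * C * real q powr (\<epsilon> + max (2 * log q N) (7/2 * log q N - 1/2))"
      using C(1) by (simp add: mult_left_mono \<nu>_def e_def)
  qed
qed

definition inverse_moment :: "nat \<Rightarrow> nat \<Rightarrow> nat \<Rightarrow> real" where
  "inverse_moment q M k = (\<Sum>t<q. cmod (\<Sum>m\<in>{1..M}. add_char q (int t * modinv q (int m))) ^ (2 * k))"

lemma inverse_moment_powr:
  fixes \<epsilon> :: real and K :: nat
  assumes \<epsilon>: "\<epsilon> > 0"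
  shows "\<exists>A\<ge>1. \<forall>q M k. prime q \<longrightarrow> 0 < M \<longrightarrow> 0 < k \<longrightarrow> k \<le> K \<longrightarrow> 2 * k * M ^ (2 * k - 1) < q \<longrightarrow>
    inverse_moment q M k
      \<le> A * real q powr (1 + \<epsilon> + k * log q M)"
proof -
  \<comment> \<open>\<open>inverse_moment_bound\<close> with \<epsilon>' loses q^(2 \<epsilon>') to
    the power 2 k + 1, which is then at most q^\<epsilon> for every k \<le> K.\<close>
  define \<epsilon>' where "\<epsilon>' = \<epsilon> / (2 * (2 * real K + 1))"
  have \<epsilon>': "\<epsilon>' > 0" using \<epsilon> by (simp add: \<epsilon>'_def)
  obtain C where C: "C \<ge> 1" "\<And>n. n > 0 \<Longrightarrow> real (card {d. d dvd n}) \<le> C * real n powr \<epsilon>'"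
    using divisor_bound[of \<epsilon>'] \<epsilon>' by auto
  show ?thesis
  proof (intro exI[of _ "C ^ (2 * K + 1)"] conjI allI impI)
    show "1 \<le> C ^ (2 * K + 1)" using C(1) by (rule one_le_power)
    fix q M k :: nat
    assume q: "prime q" and M: "0 < M" and k: "0 < k" "k \<le> K" and small: "2 * k * M ^ (2 * k - 1) < q"
    define \<mu> where "\<mu> = log q M"
    have q2: "q \<ge> 2" using q prime_ge_2_nat by blast
    have q1: "real q > 1" using q2 by simp
    have M\<mu>: "real M = real q powr \<mu>" using M q1 by (simp add: \<mu>_def)
    have "inverse_moment q M k
       \<le> real q * (C ^ (2 * k + 1) * (real q powr (2 * \<epsilon>')) ^ (2 * k + 1) * real M ^ k)"
    proof (unfold inverse_moment_def, subst moment_card)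
      show "0 < q" using q2 by simp
    qed (rule finite_atLeastAtMost, rule mult_left_mono[OF inverse_moment_bound[OF q k(1) M small C \<epsilon>'] of_nat_0_le_iff])
    also have "\<dots> \<le> real q * (C ^ (2 * K + 1) * real q powr \<epsilon> * real q powr (k * \<mu>))"
    proof (intro mult_left_mono mult_mono)
      show "C ^ (2 * k + 1) \<le> C ^ (2 * K + 1)" using C(1) k by (intro power_increasing) auto
      have "(real q powr (2 * \<epsilon>')) ^ (2 * k + 1) = real q powr (2 * \<epsilon>' * (2 * real k + 1))"
        using q1 by (simp add: powr_power algebra_simps del: power_Suc)
      also have "\<dots> \<le> real q powr (2 * \<epsilon>' * (2 * real K + 1))"
        using q1 k \<epsilon>' by (intro powr_mono) auto
      also have "2 * \<epsilon>' * (2 * real K + 1) = \<epsilon>"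
      proof -
        have "2 * (\<epsilon> / (2 * c)) * c = \<epsilon>" if "c > 0" for c :: real
          using that by simp
        from this[of "2 * real K + 1"] show ?thesis
          by (simp only: \<epsilon>'_def)
      qed
      finally show "(real q powr (2 * \<epsilon>')) ^ (2 * k + 1) \<le> real q powr \<epsilon>" .
      show "real M ^ k \<le> real q powr (k * \<mu>)"
        using q1 by (simp add: M\<mu> powr_power mult.commute)
    qed (use C(1) in auto)
    also have "\<dots> = C ^ (2 * K + 1) * real q powr (1 + \<epsilon> + k * \<mu>)"
      using q1 by (simp add: powr_add)
    finally show "inverse_moment q M k
      \<le> C ^ (2 * K + 1) * real q powr (1 + \<epsilon> + k * log q M)"
      by (simp add: \<mu>_def)
  qed
qed

text \<open>Takes the n-th root of a saving, with a resulting exponent that is the same for all n up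
  to \<open>L\<close>; in the applications n is a multiple of the Hoelder exponent, which may
  vary.\<close>

lemma root_bound:
  fixes x y Q q \<kappa> :: real
  assumes "x ^ n \<le> Q * (y ^ n * q powr - \<kappa>)" "0 < n" "n \<le> L" "Q \<ge> 1" "q \<ge> 1" "y \<ge> 0" "\<kappa> \<ge> 0"
  shows "x \<le> Q * y * q powr - (\<kappa> / L)"
proof -
  obtain m where m: "n = Suc m" using assms(2) by (cases n) auto
  have L: "real L > 0" using assms(2,3) by simp
  have "x ^ n \<le> Q * (y ^ n * q powr - \<kappa>)" by fact
  also have "\<dots> \<le> Q ^ n * (y ^ n * q powr (- (\<kappa> / L) * n))"
  proof (intro mult_mono mult_left_mono powr_mono)
    show "Q \<le> Q ^ n" using assms(2,4) by (simp add: self_le_power)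
    have "\<kappa> * real n \<le> \<kappa> * real L" using assms(3,7) by (intro mult_left_mono) auto
    then show "- \<kappa> \<le> - (\<kappa> / L) * n" using L by (simp add: field_simps)
  qed (use assms in auto)
  also have "\<dots> = (Q * y * q powr - (\<kappa> / L)) ^ n"
    using assms(5) by (simp add: power_mult_distrib powr_power mult.commute)
  finally have "x ^ Suc m \<le> (Q * y * q powr - (\<kappa> / L)) ^ Suc m" by (simp only: m)
  then show ?thesis by (rule power_le_imp_le_base) (use assms in auto)
qed

definition kloosterman_kernel :: "nat \<Rightarrow> int \<Rightarrow> nat \<Rightarrow> nat \<Rightarrow> complex" where
  "kloosterman_kernel q h m n = add_char q (h * modinv q (int m) * modinv q (int n))"

text \<open>Writing \<open>M\<close> and \<open>N\<close> as powers of \<open>q\<close> with exponents \<open>\<mu> \<le> \<nu>\<close>, Hoelder's inequality with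
  \<open>k = 2\<close> suffices unless \<open>\<mu> < 1/4\<close> and \<open>\<nu> > 1/3\<close>. In that case take the largest \<open>k\<close> for which
  \<open>inverse_moment_bound\<close> applies to \<open>M\<close>: then \<open>k \<mu>\<close> is at least about \<open>(1 - \<mu>) / 2\<close>, and the
  saving in the \<open>4 k\<close>-th power is about \<open>(\<nu> - \<mu>) / 2\<close>.\<close>

lemma type_II_ordered:
  fixes \<eta> \<theta> :: real
  assumes \<eta>: "\<eta> > 0" and \<theta>: "\<theta> > 0"
  shows "\<exists>\<delta>>0. \<exists>Q\<ge>1. \<forall>q h M N. prime q \<longrightarrow> q > 2 \<longrightarrow> \<not> int q dvd h \<longrightarrow> M \<le> N \<longrightarrow> N < q \<longrightarrow>
     real q powr \<theta> \<le> real M \<longrightarrow> real q powr (1/2 + \<eta>) \<le> real M * real N \<longrightarrow>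
     bilin_bound (kloosterman_kernel q h) {1..M} {1..N} (Q * (real M * real N) * real q powr - \<delta>)"
proof -
  \<comment> \<open>An upper bound for every usable k: the size condition forces \<mu> (2 k - 1) <
    1, hence k < 1 / \<theta>.\<close>
  define K where "K = nat \<lceil>1 / \<theta>\<rceil> + 1"
  have K: "1 / \<theta> \<le> real K" by (simp add: K_def) linarith
  \<comment> \<open>1/24 is half of 1/3 - 1/4, the gap between \<nu> and \<mu> in the case where a
    long moment is used; \<eta> is what the case k = 2 can afford.\<close>
  define \<kappa> where "\<kappa> = min \<eta> (1/24)"
  define \<epsilon> where "\<epsilon> = \<kappa> / 4"
  have \<kappa>: "\<kappa> > 0" using \<eta> by (simp add: \<kappa>_def)
  have \<epsilon>: "\<epsilon> > 0" using \<kappa> by (simp add: \<epsilon>_def)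
  obtain A where A: "A \<ge> 1" "\<And>q N. prime q \<Longrightarrow> 0 < N \<Longrightarrow> N < q \<Longrightarrow>
    real (diff_energy q (\<lambda>n. modinv q (int n)) {1..N})
      \<le> A * real q powr (\<epsilon> + max (2 * log q N) (7/2 * log q N - 1/2))"
    using inverse_energy_powr[OF \<epsilon>] by auto
  obtain B where B: "B \<ge> 1" "\<And>q M k. prime q \<Longrightarrow> 0 < M \<Longrightarrow> 0 < k \<Longrightarrow> k \<le> K \<Longrightarrow> 2 * k * M ^ (2 * k - 1) < q \<Longrightarrow>
    inverse_moment q M k
      \<le> B * real q powr (1 + \<epsilon> + k * log q M)"
    using inverse_moment_powr[OF \<epsilon>, of K] by auto
  define c0 where "c0 = 2 * (real K + 1)"
  have c0: "c0 \<ge> 1" by (simp add: c0_def)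
  define Q where "Q = max (A * A) (A * B * c0 powr (1/2))"
  define L where "L = 4 * (K + 1)"
  define \<delta> where "\<delta> = \<kappa> / 2 / L"
  have Q1: "Q \<ge> 1"
  proof -
    have "1 * 1 \<le> A * A" using A(1) by (intro mult_mono) auto
    then show ?thesis by (simp add: Q_def)
  qed
  have \<delta>: "\<delta> > 0" using \<kappa> by (simp add: \<delta>_def L_def)
  show ?thesis
  proof (rule exI[of _ \<delta>], rule conjI[OF \<delta>], rule exI[of _ Q], rule conjI[OF Q1], intro allI impI)
    fix q :: nat and h :: int and M N :: nat
    assume q: "prime q" "q > 2" and h: "\<not> int q dvd h" and MN: "M \<le> N" "N < q"
      and M\<theta>: "real q powr \<theta> \<le> real M" and prod: "real q powr (1/2 + \<eta>) \<le> real M * real N"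
    define \<mu> where "\<mu> = log q M"
    define \<nu> where "\<nu> = log q N"
    have q1: "real q > 1" using q by simp
    have "real q powr \<theta> > 0" using q1 by simp
    then have M0: "M > 0" using M\<theta> by (cases M) auto
    then have N0: "N > 0" using MN by simp
    have M\<mu>: "real M = real q powr \<mu>" using M0 q1 by (simp add: \<mu>_def)
    have N\<nu>: "real N = real q powr \<nu>" using N0 q1 by (simp add: \<nu>_def)
    have le: "\<theta> \<le> \<mu>" "\<mu> \<le> \<nu>" "\<nu> \<le> 1" "1/2 + \<eta> \<le> \<mu> + \<nu>"
    proof -
      show "\<theta> \<le> \<mu>" using M\<theta> q1 unfolding M\<mu> by (simp only: powr_le_cancel_iff)
      have "real M \<le> real N" using MN by simp
      then show "\<mu> \<le> \<nu>" using q1 unfolding M\<mu> N\<nu> by (simp only: powr_le_cancel_iff)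
      have "real N \<le> real q powr 1" using MN q1 by simp
      then show "\<nu> \<le> 1" using q1 unfolding N\<nu> by (simp only: powr_le_cancel_iff)
      show "1/2 + \<eta> \<le> \<mu> + \<nu>"
        using prod q1 unfolding M\<mu> N\<nu> powr_add[symmetric] by (simp only: powr_le_cancel_iff)
    qed
    define fM where "fM = max (2 * \<mu>) (7/2 * \<mu> - 1/2)"
    define fN where "fN = max (2 * \<nu>) (7/2 * \<nu> - 1/2)"
    have EN: "real (diff_energy q (\<lambda>n. modinv q (int n)) {1..N}) \<le> A * real q powr (\<epsilon> + fN)"
      using A(2)[OF q(1) N0 MN(2)] by (simp add: \<nu>_def fN_def)
    have EM: "real (diff_energy q (\<lambda>n. modinv q (int n)) {1..M}) \<le> A * real q powr (\<epsilon> + fM)"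
      using A(2)[OF q(1) M0, of] MN by (simp add: \<mu>_def fM_def)
    show "bilin_bound (kloosterman_kernel q h) {1..M} {1..N} (Q * (real M * real N) * real q powr - \<delta>)"
      unfolding bilin_bound_def
    proof (intro allI impI)
      fix \<alpha> \<beta> :: "nat \<Rightarrow> complex"
      assume \<alpha>: "\<forall>m. cmod (\<alpha> m) \<le> 1" and \<beta>: "\<forall>n. cmod (\<beta> n) \<le> 1"
      define S where "S = cmod (\<Sum>m\<in>{1..M}. \<Sum>n\<in>{1..N}. \<alpha> m * \<beta> n * kloosterman_kernel q h m n)"
      have hoelder: "S ^ (4 * k) \<le> real M ^ (2 * k) * real N ^ (4 * k - 4)
          * real (diff_energy q (\<lambda>n. modinv q (int n)) {1..N})
          * inverse_moment q M k" if "k > 0" for k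
        unfolding S_def kloosterman_kernel_def
        using bilinear_hoelder[OF q(1) h, of "{1..M}" "{1..N}" \<alpha> \<beta> k "\<lambda>m. modinv q (int m)" "\<lambda>n. modinv q (int n)"]
          \<alpha> \<beta> that by (simp add: inverse_moment_def)
      have "\<exists>k. 0 < k \<and> 4 * k \<le> L \<and> S ^ (4 * k) \<le> Q * ((real M * real N) ^ (4 * k) * real q powr - (\<kappa> / 2))"
      proof (cases "\<mu> \<ge> 1/4 \<or> \<nu> \<le> 1/3")
        case True
        have "inverse_moment q M 2
          = real q * real (diff_energy q (\<lambda>n. modinv q (int n)) {1..M})"
          using fourth_moment_diff[of q "{1..M}" "\<lambda>n. modinv q (int n)"] q
          by (simp add: inverse_moment_def)
        also have "\<dots> \<le> real q * (A * real q powr (\<epsilon> + fM))"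
          using EM by (rule mult_left_mono) simp
        finally have W: "inverse_moment q M 2
          \<le> real q * (A * real q powr (\<epsilon> + fM))" .
        have "S ^ (4 * 2) \<le> real M ^ (2 * 2) * real N ^ (4 * 2 - 4)
          * real (diff_energy q (\<lambda>n. modinv q (int n)) {1..N})
          * inverse_moment q M 2"
          by (rule hoelder) simp
        also have "\<dots> \<le> real M ^ (2 * 2) * real N ^ (4 * 2 - 4) * (A * real q powr (\<epsilon> + fN))
            * (real q * (A * real q powr (\<epsilon> + fM)))"
          using A(1) by (intro mult_mono mult_left_mono EN W) (auto simp: inverse_moment_def intro!: sum_nonneg)
        also have "\<dots> = (A * A) * (real q powr (4 * \<mu>) * real q powr (4 * \<nu>) * real q powr (\<epsilon> + fN)
            * (real q powr 1 * real q powr (\<epsilon> + fM)))"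
          using q1 by (simp add: M\<mu> N\<nu> powr_power mult_ac)
        also have "\<dots> = (A * A) * real q powr (4 * \<mu> + 4 * \<nu> + (\<epsilon> + fN) + (1 + (\<epsilon> + fM)))"
          by (simp only: powr_add)
        also have "\<dots> \<le> Q * real q powr (8 * \<mu> + 8 * \<nu> - \<kappa> / 2)"
        proof (intro mult_mono powr_mono)
          have k1: "\<kappa> \<le> \<eta>" "\<kappa> \<le> 1/24" by (auto simp: \<kappa>_def)
          \<comment> \<open>This amounts to fM + fN + 1 + \<kappa> \<le> 4 (\<mu> + \<nu>). If \<nu>
            \<le> 1/3 both energies are diagonal and \<mu> + \<nu> \<ge> 1/2 + \<eta> suffices. If
            \<mu> \<ge> 1/4 and \<nu> > 1/3, the sizes of \<mu> and \<nu> alone leave room for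
            \<kappa>.\<close>
          show "4 * \<mu> + 4 * \<nu> + (\<epsilon> + fN) + (1 + (\<epsilon> + fM)) \<le> 8 * \<mu> + 8 * \<nu> - \<kappa> / 2"
            using True le k1 \<eta> \<theta> unfolding fN_def fM_def \<epsilon>_def max_def
            by (elim disjE) (simp_all split: if_splits; linarith)+
          show "A * A \<le> Q" by (simp add: Q_def)
        qed (use q1 Q1 in auto)
        also have "\<dots> = Q * ((real M * real N) ^ (4 * 2) * real q powr - (\<kappa> / 2))"
          using q1 by (simp add: M\<mu> N\<nu> powr_power power_mult_distrib algebra_simps flip: powr_add)
        finally show ?thesis by (intro exI[of _ 2]) (auto simp: L_def K_def)
      next
        case False
        define P where "P k \<longleftrightarrow> 0 < k \<and> 2 * k * M ^ (2 * k - 1) < q" for k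
        have M1: "real M > 1"
          using M\<theta> \<theta> q1 gr_one_powr[of "real q" \<theta>] by linarith
        have bound: "k \<le> K" if "P k" for k
        proof -
          have "M ^ (2 * k - 1) \<le> 2 * k * M ^ (2 * k - 1)" using that by (simp add: P_def)
          also have "\<dots> < q" using that by (simp add: P_def)
          finally have "real (M ^ (2 * k - 1)) < real q" by (simp only: of_nat_less_iff)
          then have "real q powr (\<mu> * real (2 * k - 1)) < real q powr 1"
            using q1 by (simp add: M\<mu> powr_power mult.commute)
          then have "\<mu> * real (2 * k - 1) < 1" using q1 by (simp only: powr_less_cancel_iff)
          moreover have "\<theta> * real k \<le> \<mu> * real (2 * k - 1)"
            using le \<theta> that by (intro mult_mono) (auto simp: P_def)
          ultimately have "real k < 1 / \<theta>" using \<theta> by (simp add: field_simps)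
          then show ?thesis using K by linarith
        qed
        have P1: "P 1"
        proof -
          have "real M < real q powr (1/4)" using False q1 by (simp add: M\<mu>)
          moreover have "2 * real q powr (1/4) \<le> real q"
          proof -
            \<comment> \<open>The case q = 3 decides: 2 \<le> q^(3/4) means 2^4 \<le> q^3.\<close>
            have "(2::real) ^ 4 \<le> 3 ^ 3" by simp
            also have "\<dots> \<le> real q ^ 3" using q by (intro power_mono) auto
            finally have "(2::real) powr 4 \<le> real q powr 3" using q1 by (simp add: powr_numeral)
            then have "(2 powr 4) powr (1/4) \<le> (real q powr 3) powr (1/4)" by (intro powr_mono2) auto
            then have "2 \<le> real q powr (3/4)" by (simp add: powr_powr del: powr_numeral)
            then have "2 * real q powr (1/4) \<le> real q powr (3/4) * real q powr (1/4)"
              by (intro mult_right_mono) auto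
            also have "\<dots> = real q" using q1 by (simp flip: powr_add)
            finally show ?thesis .
          qed
          ultimately have "2 * real M < real q" by linarith
          then show ?thesis by (simp add: P_def)
        qed
        define k where "k = (GREATEST k. P k)"
        have Pk: "P k" unfolding k_def using P1 bound by (rule GreatestI_nat)
        have "\<not> P (Suc k)"
        proof
          assume "P (Suc k)"
          then have "Suc k \<le> k" unfolding k_def using bound by (rule Greatest_le_nat)
          then show False by simp
        qed
        \<comment> \<open>Maximality of k means that \<open>q\<close> is at most a constant times
          M^(2k+1).\<close>
        then have "q \<le> 2 * Suc k * M ^ (2 * Suc k - 1)" by (simp add: P_def)
        also have "2 * Suc k - 1 = 2 * k + 1" by simp
        finally have "real q \<le> real (2 * Suc k * M ^ (2 * k + 1))" by (simp only: of_nat_le_iff)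
        also have "\<dots> \<le> c0 * real M ^ (2 * k + 1)"
        proof -
          have "real (2 * Suc k) \<le> c0" using bound[OF Pk] by (simp add: c0_def)
          then have "real (2 * Suc k) * real M ^ (2 * k + 1) \<le> c0 * real M ^ (2 * k + 1)"
            by (rule mult_right_mono) simp
          then show ?thesis by (simp only: of_nat_mult of_nat_power)
        qed
        also have "real M ^ (2 * k + 1) = real q powr (\<mu> * (2 * real k + 1))"
          using q1 by (simp add: M\<mu> powr_power algebra_simps del: power_Suc)
        finally have "real q powr (1/2) \<le> (c0 * real q powr (\<mu> * (2 * real k + 1))) powr (1/2)"
          by (intro powr_mono2) auto
        also have "\<dots> = c0 powr (1/2) * real q powr (\<mu> * real k + \<mu> / 2)"
          using c0 by (simp add: powr_mult powr_powr algebra_simps add_divide_distrib)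
        finally have Mk: "real q powr (1/2) \<le> c0 powr (1/2) * real q powr (\<mu> * real k + \<mu> / 2)" .
        have k0: "k > 0" "k \<le> K" using Pk bound by (auto simp: P_def)
        have W: "inverse_moment q M k
          \<le> B * real q powr (1 + \<epsilon> + k * \<mu>)"
          using B(2)[OF q(1) M0 k0] Pk by (simp add: P_def \<mu>_def)
        have "S ^ (4 * k) \<le> real M ^ (2 * k) * real N ^ (4 * k - 4)
          * real (diff_energy q (\<lambda>n. modinv q (int n)) {1..N})
          * inverse_moment q M k"
          by (rule hoelder[OF k0(1)])
        also have "\<dots> \<le> real M ^ (2 * k) * real N ^ (4 * k - 4) * (A * real q powr (\<epsilon> + fN))
            * (B * real q powr (1 + \<epsilon> + k * \<mu>))"
          using A(1) by (intro mult_mono mult_left_mono EN W) (auto simp: inverse_moment_def intro!: sum_nonneg)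
        also have "\<dots> = (A * B) * (real q powr (2 * k * \<mu>) * real q powr ((4 * real k - 4) * \<nu>)
            * real q powr (\<epsilon> + fN) * real q powr (1 + \<epsilon> + k * \<mu>))"
          using q1 k0(1) by (simp add: M\<mu> N\<nu> powr_power of_nat_diff mult_ac)
        \<comment> \<open>Half of the factor q in the moment is split off and traded, by
          \<open>Mk\<close>, for q^(\<mu> k + \<mu> / 2). The terms in k \<mu> then add up to 4 k
          \<mu>, k cancels from the comparison, and the saving is (\<nu> - \<mu>) / 2 less the
          epsilons.\<close>
        also have "\<dots> = (A * B) * (real q powr (1/2) *
            real q powr (2 * k * \<mu> + (4 * real k - 4) * \<nu> + (\<epsilon> + fN) + (1/2 + \<epsilon> + k * \<mu>)))"
          unfolding powr_add[symmetric] by (simp add: algebra_simps)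
        also have "\<dots> \<le> (A * B) * ((c0 powr (1/2) * real q powr (\<mu> * real k + \<mu> / 2)) *
            real q powr (2 * k * \<mu> + (4 * real k - 4) * \<nu> + (\<epsilon> + fN) + (1/2 + \<epsilon> + k * \<mu>)))"
          using A(1) B(1) Mk by (intro mult_left_mono mult_right_mono) auto
        also have "\<dots> = (A * B * c0 powr (1/2)) * real q powr ((\<mu> * real k + \<mu> / 2) +
            (2 * k * \<mu> + (4 * real k - 4) * \<nu> + (\<epsilon> + fN) + (1/2 + \<epsilon> + k * \<mu>)))"
          by (simp only: powr_add mult_ac)
        also have "\<dots> \<le> Q * real q powr (4 * k * \<mu> + 4 * k * \<nu> - \<kappa> / 2)"
        proof (intro mult_mono powr_mono)
          have k1: "\<kappa> \<le> 1/24" by (auto simp: \<kappa>_def)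
          have "\<mu> / 2 - 4 * \<nu> + 2 * \<epsilon> + fN + 1/2 \<le> - \<kappa> / 2"
            using False le k1 unfolding fN_def \<epsilon>_def max_def
            by (simp split: if_splits; linarith)
          then show "(\<mu> * real k + \<mu> / 2) +
            (2 * k * \<mu> + (4 * real k - 4) * \<nu> + (\<epsilon> + fN) + (1/2 + \<epsilon> + k * \<mu>))
            \<le> 4 * k * \<mu> + 4 * k * \<nu> - \<kappa> / 2"
            by (simp add: algebra_simps)
          show "A * B * c0 powr (1/2) \<le> Q" by (simp add: Q_def)
        qed (use q1 Q1 in auto)
        also have "\<dots> = Q * ((real M * real N) ^ (4 * k) * real q powr - (\<kappa> / 2))"
          using q1 by (simp add: M\<mu> N\<nu> powr_power power_mult_distrib algebra_simps flip: powr_add)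
        finally show ?thesis using k0 by (intro exI[of _ k]) (auto simp: L_def)
      qed
      then obtain k where k: "0 < k" "4 * k \<le> L"
        "S ^ (4 * k) \<le> Q * ((real M * real N) ^ (4 * k) * real q powr - (\<kappa> / 2))" by blast
      have "S \<le> Q * (real M * real N) * real q powr - (\<kappa> / 2 / L)"
        by (rule root_bound[OF k(3) _ k(2)]) (use k Q1 q1 \<kappa> in auto)
      then show "cmod (\<Sum>m\<in>{1..M}. \<Sum>n\<in>{1..N}. \<alpha> m * \<beta> n * kloosterman_kernel q h m n)
          \<le> Q * (real M * real N) * real q powr - \<delta>"
        by (simp add: S_def \<delta>_def)
    qed
  qed
qed

text \<open>The kernel is symmetric, so the restriction M \<le> N disappears after an exchange of
  variables.\<close>

lemma type_II_bound:
  fixes \<eta> \<theta> :: real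
  assumes \<eta>: "\<eta> > 0" and \<theta>: "\<theta> > 0"
  shows "\<exists>\<delta>>0. \<exists>Q\<ge>1. \<forall>q h M N. prime q \<longrightarrow> q > 2 \<longrightarrow> \<not> int q dvd h \<longrightarrow> M < q \<longrightarrow> N < q \<longrightarrow>
     real q powr \<theta> \<le> real M \<longrightarrow> real q powr \<theta> \<le> real N \<longrightarrow>
     real q powr (1/2 + \<eta>) \<le> real M * real N \<longrightarrow>
     bilin_bound (kloosterman_kernel q h) {1..M} {1..N} (Q * (real M * real N) * real q powr - \<delta>)"
proof -
  obtain \<delta> Q where "\<delta> > 0" "Q \<ge> 1" and *: "\<And>q h M N. prime q \<Longrightarrow> q > 2 \<Longrightarrow> \<not> int q dvd h \<Longrightarrow> M \<le> N \<Longrightarrow> N < q \<Longrightarrow>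
     real q powr \<theta> \<le> real M \<Longrightarrow> real q powr (1/2 + \<eta>) \<le> real M * real N \<Longrightarrow>
     bilin_bound (kloosterman_kernel q h) {1..M} {1..N} (Q * (real M * real N) * real q powr - \<delta>)"
    using type_II_ordered[OF assms] by blast
  have sym: "(\<lambda>n m. kloosterman_kernel q h m n) = kloosterman_kernel q h" for q h
    by (auto simp: kloosterman_kernel_def mult_ac fun_eq_iff)
  show ?thesis
  proof (rule exI[of _ \<delta>], rule conjI[OF \<open>\<delta> > 0\<close>], rule exI[of _ Q], rule conjI[OF \<open>Q \<ge> 1\<close>], intro allI impI)
    fix q :: nat and h :: int and M N :: nat
    assume a: "prime q" "q > 2" "\<not> int q dvd h" "M < q" "N < q"
      "real q powr \<theta> \<le> real M" "real q powr \<theta> \<le> real N"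
      "real q powr (1/2 + \<eta>) \<le> real M * real N"
    show "bilin_bound (kloosterman_kernel q h) {1..M} {1..N} (Q * (real M * real N) * real q powr - \<delta>)"
    proof (cases "M \<le> N")
      case True
      then show ?thesis using a by (intro *) auto
    next
      case False
      then have "bilin_bound (kloosterman_kernel q h) {1..N} {1..M} (Q * (real N * real M) * real q powr - \<delta>)"
        using a by (intro *) (auto simp: mult.commute)
      then show ?thesis
        using bilin_bound_swap[of "kloosterman_kernel q h"] by (simp add: sym mult.commute)
    qed
  qed
qed

section \<open>Incomplete Kloosterman sums\<close>

text \<open>Lagrange's theorem stated for integer polynomials; the hypothesis says that
  \<open>f\<close> does not vanish identically modulo \<open>q\<close>. A root \<open>a\<close> is
  split off by synthetic division, whose remainder is divisible by \<open>q\<close>, so the quotient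
  again does not vanish modulo \<open>q\<close>.\<close>

lemma card_roots_mod_prime:
  fixes f :: "int poly"
  assumes q: "prime q" and f: "\<not> [:int q:] dvd f"
  shows "card {s. s < q \<and> int q dvd poly f (int s)} \<le> degree f"
  using f
proof (induction "degree f" arbitrary: f rule: less_induct)
  case less
  let ?R = "\<lambda>f. {s. s < q \<and> int q dvd poly f (int s)}"
  show ?case
  proof (cases "?R f = {}")
    case True
    then show ?thesis by (simp only: card.empty le0)
  next
    case False
    then obtain a where a: "a < q" "int q dvd poly f (int a)" by auto
    define g where "g = synthetic_div f (int a)"
    have fg: "f = [:- int a, 1:] * g + [:poly f (int a):]"
      using synthetic_div_correct'[of "int a" f] by (simp add: g_def)
    have g: "\<not> [:int q:] dvd g"
    proof
      assume "[:int q:] dvd g"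
      moreover have "[:int q:] dvd [:poly f (int a):]" using a(2) by simp
      ultimately have "[:int q:] dvd [:- int a, 1:] * g + [:poly f (int a):]"
        by (intro dvd_add dvd_mult)
      then show False using less.prems fg by simp
    qed
    have deg: "degree f \<noteq> 0"
    proof
      assume "degree f = 0"
      then obtain c where "f = [:c:]" by (rule degree_eq_zeroE)
      then show False using less.prems a(2) by simp
    qed
    have dg: "degree g = degree f - 1" by (simp add: g_def degree_synthetic_div)
    have "?R f \<subseteq> insert a (?R g)"
    proof
      fix s assume s: "s \<in> ?R f"
      have "poly f (int s) = (int s - int a) * poly g (int s) + poly f (int a)"
        by (subst fg) (simp add: algebra_simps)
      then have "int q dvd (int s - int a) * poly g (int s)"
        using s a(2) by (simp add: dvd_add_left_iff)
      then consider "int q dvd int s - int a" | "int q dvd poly g (int s)"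
        using prime_int_q[OF q] by (auto simp: prime_dvd_mult_iff)
      then show "s \<in> insert a (?R g)"
      proof cases
        case 1
        then have "[s = a] (mod q)" by (simp add: cong_iff_dvd_diff flip: cong_int_iff)
        then have "s = a" using s a(1) cong_less_modulus_unique_nat by auto
        then show ?thesis by simp
      qed (use s in auto)
    qed
    then have "card (?R f) \<le> card (insert a (?R g))" by (intro card_mono) auto
    also have "\<dots> \<le> Suc (card (?R g))" by (rule card_insert_le_m1) auto
    also have "card (?R g) \<le> degree g" using less.hyps[of g] g dg deg by simp
    finally show ?thesis using dg deg by simp
  qed
qed

text \<open>Clearing denominators turns the sum into a polynomial \<open>F\<close> in s. At -a_(i0)
  only the term of i0 survives, a product of differences that are nonzero modulo \<open>q\<close>;
  hence \<open>F\<close> has at most \<open>card I\<close> roots. The other \<open>card I\<close>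
  accounts for the s at which some s + a_j is divisible by \<open>q\<close>, where denominators
  cannot be cleared.\<close>

lemma shifted_inverse_sum_roots:
  fixes a :: "'a \<Rightarrow> nat" and e :: "'a \<Rightarrow> int"
  assumes q: "prime q" and I: "finite I" and e: "\<And>i. i \<in> I \<Longrightarrow> \<bar>e i\<bar> = 1"
    and a: "\<And>i. i \<in> I \<Longrightarrow> a i < q"
    and i0: "i0 \<in> I" "\<And>j. j \<in> I \<Longrightarrow> j \<noteq> i0 \<Longrightarrow> a j \<noteq> a i0"
  shows "card {s. s < q \<and> int q dvd (\<Sum>i\<in>I. e i * modinv q (int s + int (a i)))} \<le> 2 * card I"
proof -
  let ?R = "{s. s < q \<and> int q dvd (\<Sum>i\<in>I. e i * modinv q (int s + int (a i)))}"
  define F where "F = (\<Sum>i\<in>I. [:e i:] * (\<Prod>j\<in>I - {i}. [:int (a j), 1:]))"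
  have poly_F: "poly F x = (\<Sum>i\<in>I. e i * (\<Prod>j\<in>I - {i}. (x + int (a j))))" for x
    by (simp add: F_def poly_sum poly_prod add.commute)
  have deg: "degree F \<le> card I"
    unfolding F_def
  proof (rule degree_sum_le[OF I])
    fix i assume i: "i \<in> I"
    have "degree ([:e i:] * (\<Prod>j\<in>I - {i}. [:int (a j), 1:])) \<le> degree (\<Prod>j\<in>I - {i}. [:int (a j), 1:])"
      using degree_smult_le[of "e i"] by simp
    also have "\<dots> \<le> (\<Sum>j\<in>I - {i}. degree [:int (a j), 1:])"
      using I by (intro degree_prod_sum_le[unfolded o_def]) auto
    also have "\<dots> \<le> card I" using I by (simp add: card_Diff_subset_Int)
    finally show "degree ([:e i:] * (\<Prod>j\<in>I - {i}. [:int (a j), 1:])) \<le> card I" .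
  qed
  have F: "\<not> [:int q:] dvd F"
  proof
    assume "[:int q:] dvd F"
    then obtain G where "F = [:int q:] * G" by (auto simp: dvd_def)
    then have dvd: "int q dvd poly F (- int (a i0))" by simp
    have "poly F (- int (a i0)) = e i0 * (\<Prod>j\<in>I - {i0}. (- int (a i0) + int (a j)))
        + (\<Sum>i\<in>I - {i0}. e i * (\<Prod>j\<in>I - {i}. (- int (a i0) + int (a j))))"
      unfolding poly_F by (rule sum.remove[OF I i0(1)])
    also have "(\<Sum>i\<in>I - {i0}. e i * (\<Prod>j\<in>I - {i}. (- int (a i0) + int (a j)))) = 0"
      using I i0(1) by (intro sum.neutral ballI) (auto intro!: prod_zero bexI[of _ i0])
    finally have "int q dvd e i0 * (\<Prod>j\<in>I - {i0}. (- int (a i0) + int (a j)))"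
      using dvd by simp
    moreover have "\<not> int q dvd e i0"
      using e[OF i0(1)] q by (metis abs_dvd_iff dvd_abs_iff int_dvd_int_iff not_prime_unit of_nat_1)
    ultimately have "int q dvd (\<Prod>j\<in>I - {i0}. (- int (a i0) + int (a j)))"
      using prime_int_q[OF q] by (simp add: prime_dvd_mult_iff)
    then obtain j where j: "j \<in> I - {i0}" "int q dvd - int (a i0) + int (a j)"
      using prime_int_q[OF q] I by (auto simp: prime_dvd_prod_iff)
    then have "[a j = a i0] (mod q)" by (simp add: cong_iff_dvd_diff flip: cong_int_iff)
    then have "a j = a i0" using a j i0(1) cong_less_modulus_unique_nat by auto
    then show False using i0(2) j by auto
  qed
  have "?R \<subseteq> {s. s < q \<and> int q dvd poly F (int s)} \<union> (\<Union>j\<in>I. {s. s < q \<and> int q dvd int s + int (a j)})"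
  proof
    fix s assume s: "s \<in> ?R"
    show "s \<in> {s. s < q \<and> int q dvd poly F (int s)} \<union> (\<Union>j\<in>I. {s. s < q \<and> int q dvd int s + int (a j)})"
    proof (cases "\<exists>j\<in>I. int q dvd int s + int (a j)")
      case False
      then have "int q dvd (\<Sum>i\<in>I. e i * (\<Prod>j\<in>I - {i}. int s + int (a j)))"
        using s by (intro clear_inverses[OF q I]) auto
      then show ?thesis using s by (simp add: poly_F)
    qed (use s in auto)
  qed
  then have "card ?R \<le> card ({s. s < q \<and> int q dvd poly F (int s)} \<union> (\<Union>j\<in>I. {s. s < q \<and> int q dvd int s + int (a j)}))"
    using I by (intro card_mono) auto
  also have "\<dots> \<le> card {s. s < q \<and> int q dvd poly F (int s)} + card (\<Union>j\<in>I. {s. s < q \<and> int q dvd int s + int (a j)})"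
    by (rule card_Un_le)
  also have "card {s. s < q \<and> int q dvd poly F (int s)} \<le> card I"
    using card_roots_mod_prime[OF q F] deg by simp
  also have "card (\<Union>j\<in>I. {s. s < q \<and> int q dvd int s + int (a j)}) \<le> (\<Sum>j\<in>I. card {s. s < q \<and> int q dvd int s + int (a j)})"
    by (rule card_UN_le[OF I])
  also have "\<dots> \<le> (\<Sum>j\<in>I. 1)"
  proof (rule sum_mono)
    fix j
    show "card {s. s < q \<and> int q dvd int s + int (a j)} \<le> 1"
    proof (rule card_le_Suc0_iff_eq[THEN iffD2, unfolded One_nat_def[symmetric]])
      show "\<forall>s\<in>{s. s < q \<and> int q dvd int s + int (a j)}. \<forall>s'\<in>{s. s < q \<and> int q dvd int s + int (a j)}. s = s'"
      proof (intro ballI)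
        fix s s' assume s: "s \<in> {s. s < q \<and> int q dvd int s + int (a j)}" "s' \<in> {s. s < q \<and> int q dvd int s + int (a j)}"
        then have "int q dvd (int s + int (a j)) - (int s' + int (a j))" by (intro dvd_diff) auto
        then have "[s = s'] (mod q)" by (simp add: cong_iff_dvd_diff flip: cong_int_iff)
        then show "s = s'" using s cong_less_modulus_unique_nat by auto
      qed
    qed auto
  qed
  finally show ?thesis by simp
qed

text \<open>The values are listed by an r-tuple \<open>c\<close>, padded if there are fewer than r,
  and each of the 2 r coordinates is replaced by an index into it: V^r choices of \<open>c\<close>
  and r^(2r) of indices.\<close>

lemma card_few_values_le:
  fixes r V :: nat
  assumes r: "r > 0"
  shows "card {(g, g'). g \<in> {..<r} \<rightarrow>\<^sub>E {1..V} \<and> g' \<in> {..<r} \<rightarrow>\<^sub>E {1..V} \<and>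
      card (g ` {..<r} \<union> g' ` {..<r}) \<le> r} \<le> r ^ (2 * r) * V ^ r"
proof -
  let ?P = "{(g, g'). g \<in> {..<r} \<rightarrow>\<^sub>E {1..V} \<and> g' \<in> {..<r} \<rightarrow>\<^sub>E {1..V} \<and>
      card (g ` {..<r} \<union> g' ` {..<r}) \<le> r}"
  let ?X = "({..<r} \<rightarrow>\<^sub>E {1..V}) \<times> ({..<r} \<rightarrow>\<^sub>E {..<r}) \<times> ({..<r} \<rightarrow>\<^sub>E {..<r})"
  let ?f = "\<lambda>(c, b, b'). (restrict (c \<circ> b) {..<r}, restrict (c \<circ> b') {..<r}) :: (nat \<Rightarrow> nat) \<times> (nat \<Rightarrow> nat)"
  have "?P \<subseteq> ?f ` ?X"
  proof
    fix p assume p: "p \<in> ?P"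
    obtain g g' where pg: "p = (g, g')" by (cases p)
    define U where "U = g ` {..<r} \<union> g' ` {..<r}"
    have g: "g \<in> {..<r} \<rightarrow>\<^sub>E {1..V}" "g' \<in> {..<r} \<rightarrow>\<^sub>E {1..V}" and cU: "card U \<le> r"
      using p by (auto simp: pg U_def)
    have U: "finite U" "U \<subseteq> {1..V}" "U \<noteq> {}" using g r by (auto simp: U_def)
    obtain c0 where c0: "bij_betw c0 {..<card U} U"
      using ex_bij_betw_nat_finite[OF U(1)] by (auto simp: atLeast0LessThan)
    obtain u where u: "u \<in> U" using U(3) by auto
    define c where "c = (\<lambda>i\<in>{..<r}. if i < card U then c0 i else u)"
    have surj: "U \<subseteq> c ` {..<r}"
    proof
      fix x assume "x \<in> U"
      then have "x \<in> c0 ` {..<card U}" using c0 by (simp add: bij_betw_def)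
      then obtain i where "i < card U" "c0 i = x" by (metis imageE lessThan_iff)
      then show "x \<in> c ` {..<r}" using cU by (intro image_eqI[of _ _ i]) (auto simp: c_def)
    qed
    have cV: "c \<in> {..<r} \<rightarrow>\<^sub>E {1..V}"
    proof -
      have "c0 i \<in> U" if "i < card U" for i using c0 that by (auto simp: bij_betw_def)
      then show ?thesis using U(2) u by (auto simp: c_def)
    qed
    define b where "b = (\<lambda>i\<in>{..<r}. SOME j. j < r \<and> c j = g i)"
    define b' where "b' = (\<lambda>i\<in>{..<r}. SOME j. j < r \<and> c j = g' i)"
    have b: "b i < r \<and> c (b i) = g i" if "i < r" for i
    proof -
      have "g i \<in> c ` {..<r}" using surj that by (auto simp: U_def)
      then have "\<exists>j. j < r \<and> c j = g i" by auto
      from someI_ex[OF this] show ?thesis using that by (simp add: b_def)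
    qed
    have b': "b' i < r \<and> c (b' i) = g' i" if "i < r" for i
    proof -
      have "g' i \<in> c ` {..<r}" using surj that by (auto simp: U_def)
      then have "\<exists>j. j < r \<and> c j = g' i" by auto
      from someI_ex[OF this] show ?thesis using that by (simp add: b'_def)
    qed
    have "restrict (c \<circ> b) {..<r} = g" "restrict (c \<circ> b') {..<r} = g'"
      using b b' g by (auto simp: fun_eq_iff PiE_def extensional_def restrict_def)
    then have "p = ?f (c, b, b')" by (simp add: pg)
    moreover have "(c, b, b') \<in> ?X" using cV b b' by (auto simp: b_def b'_def)
    ultimately show "p \<in> ?f ` ?X" by blast
  qed
  then have "card ?P \<le> card (?f ` ?X)"
    by (intro card_mono finite_imageI finite_cartesian_product finite_PiE) auto
  also have "\<dots> \<le> card ?X"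
    by (intro card_image_le finite_cartesian_product finite_PiE) auto
  also have "\<dots> = r ^ (2 * r) * V ^ r"
  proof -
    have "r ^ (2 * r) = r ^ r * r ^ r" by (simp add: mult_2 power_add)
    then show ?thesis by (simp add: card_cartesian_product card_PiE mult_ac)
  qed
  finally show ?thesis .
qed

lemma real_card_filter:
  "finite A \<Longrightarrow> real (card {x \<in> A. Q x}) = (\<Sum>x\<in>A. if Q x then 1 else 0)"
  by (simp flip: sum.inter_filter)

lemma shifted_moment_bound:
  fixes q V r :: nat
  assumes q: "prime q" and V: "V < q" and r: "r > 0"
  shows "(\<Sum>s<q. \<Sum>t<q. cmod (\<Sum>v\<in>{1..V}. add_char q (int t * modinv q (int s + int v))) ^ (2 * r))
    \<le> real q * (real r ^ (2 * r) * real V ^ r * real q + 4 * real r * real V ^ (2 * r))"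
proof -
  have q0: "q > 0" using V by simp
  define Z where "Z s g g' \<longleftrightarrow>
    [(\<Sum>i<r. modinv q (int s + int (g i))) = (\<Sum>i<r. modinv q (int s + int (g' i)))] (mod int q)"
    for s and g g' :: "nat \<Rightarrow> nat"
  define P where "P = ({..<r} \<rightarrow>\<^sub>E {1..V}) \<times> ({..<r} \<rightarrow>\<^sub>E {1..V})"
  define P0 where "P0 = {(g, g'). g \<in> {..<r} \<rightarrow>\<^sub>E {1..V} \<and> g' \<in> {..<r} \<rightarrow>\<^sub>E {1..V} \<and>
      card (g ` {..<r} \<union> g' ` {..<r}) \<le> r}"
  have finP: "finite P" by (auto simp: P_def intro!: finite_cartesian_product finite_PiE)
  have P0P: "P0 \<subseteq> P" by (auto simp: P0_def P_def)
  have "(\<Sum>s<q. \<Sum>t<q. cmod (\<Sum>v\<in>{1..V}. add_char q (int t * modinv q (int s + int v))) ^ (2 * r))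
      = (\<Sum>s<q. real q * real (card {p \<in> P. Z s (fst p) (snd p)}))"
  proof (rule sum.cong[OF refl])
    fix s
    have "{p \<in> P. Z s (fst p) (snd p)} = {(g, g'). g \<in> {..<r} \<rightarrow>\<^sub>E {1..V} \<and> g' \<in> {..<r} \<rightarrow>\<^sub>E {1..V} \<and> Z s g g'}"
      unfolding P_def case_prod_unfold by (rule Collect_cong) (simp only: mem_Times_iff conj_assoc)
    then show "(\<Sum>t<q. cmod (\<Sum>v\<in>{1..V}. add_char q (int t * modinv q (int s + int v))) ^ (2 * r))
      = real q * real (card {p \<in> P. Z s (fst p) (snd p)})"
      using moment_card[OF q0, of "{1..V}" "\<lambda>v. modinv q (int s + int v)" r]
      by (simp add: Z_def)
  qed
  also have "\<dots> = real q * (\<Sum>s<q. real (card {p \<in> P. Z s (fst p) (snd p)}))"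
    by (simp add: sum_distrib_left)
  also have "(\<Sum>s<q. real (card {p \<in> P. Z s (fst p) (snd p)})) = (\<Sum>p\<in>P. real (card {s. s < q \<and> Z s (fst p) (snd p)}))"
  proof -
    have "(\<Sum>s<q. real (card {p \<in> P. Z s (fst p) (snd p)}))
        = (\<Sum>s<q. \<Sum>p\<in>P. if Z s (fst p) (snd p) then 1 else 0)"
      by (intro sum.cong refl real_card_filter finP)
    also have "\<dots> = (\<Sum>p\<in>P. \<Sum>s<q. if Z s (fst p) (snd p) then 1 else 0)" by (rule sum.swap)
    also have "\<dots> = (\<Sum>p\<in>P. real (card {s \<in> {..<q}. Z s (fst p) (snd p)}))"
      by (intro sum.cong refl real_card_filter[symmetric] finite_lessThan)
    also have "\<dots> = (\<Sum>p\<in>P. real (card {s. s < q \<and> Z s (fst p) (snd p)}))"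
      by (simp only: lessThan_iff)
    finally show ?thesis .
  qed
  also have "\<dots> \<le> (\<Sum>p\<in>P. 4 * real r + (if p \<in> P0 then real q else 0))"
  proof (rule sum_mono)
    fix p assume p: "p \<in> P"
    obtain g g' where pg: "p = (g, g')" by (cases p)
    show "real (card {s. s < q \<and> Z s (fst p) (snd p)}) \<le> 4 * real r + (if p \<in> P0 then real q else 0)"
    proof (cases "p \<in> P0")
      case True
      have "card {s. s < q \<and> Z s (fst p) (snd p)} \<le> card {..<q}" by (intro card_mono) auto
      then show ?thesis using True by simp
    next
      case False
      define I :: "(nat + nat) set" where "I = {..<r} <+> {..<r}"
      define a where "a = case_sum g g'"
      define e where "e = (case_sum (\<lambda>_. 1) (\<lambda>_. -1) :: nat + nat \<Rightarrow> int)"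
      have I: "finite I" "card I = 2 * r" by (auto simp: I_def card_Plus)
      have aI: "a ` I = g ` {..<r} \<union> g' ` {..<r}"
        by (simp add: a_def I_def Plus_def image_Un image_image)
      have aV: "a i < q" if "i \<in> I" for i
      proof -
        have "a i \<le> V" using that p by (auto simp: I_def a_def pg P_def PiE_iff)
        then show ?thesis using V by simp
      qed
      have "card (a ` I) > r" using False p unfolding aI by (auto simp: P0_def P_def pg)
      \<comment> \<open>If every value were taken at least twice, 2 r entries would have at most r
        values.\<close>
      have "\<exists>i0\<in>I. \<forall>j\<in>I. j \<noteq> i0 \<longrightarrow> a j \<noteq> a i0"
      proof (rule ccontr)
        assume "\<not> (\<exists>i0\<in>I. \<forall>j\<in>I. j \<noteq> i0 \<longrightarrow> a j \<noteq> a i0)"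
        then have *: "\<exists>j\<in>I. j \<noteq> i \<and> a j = a i" if "i \<in> I" for i using that by blast
        have "2 \<le> card {i\<in>I. a i = x}" if x: "x \<in> a ` I" for x
        proof -
          obtain i where i: "i \<in> I" "x = a i" using x by auto
          obtain j where j: "j \<in> I" "j \<noteq> i" "a j = a i" using *[OF i(1)] by auto
          have "card {i, j} \<le> card {i\<in>I. a i = x}" using i j I by (intro card_mono) auto
          then show ?thesis using j by simp
        qed
        then have "(\<Sum>x\<in>a ` I. 2) \<le> (\<Sum>x\<in>a ` I. card {i\<in>I. a i = x})" by (rule sum_mono)
        also have "\<dots> = card I"
          using sum.group[OF I(1), of "a ` I" a "\<lambda>_. 1::nat"] I by simp
        finally show False using \<open>card (a ` I) > r\<close> I by simp
      qed
      then obtain i0 where i0: "i0 \<in> I" "\<And>j. j \<in> I \<Longrightarrow> j \<noteq> i0 \<Longrightarrow> a j \<noteq> a i0" by blast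
      have "Z s g g' \<longleftrightarrow> int q dvd (\<Sum>i\<in>I. e i * modinv q (int s + int (a i)))" for s
        by (simp add: Z_def cong_iff_dvd_diff I_def sum.Plus e_def a_def sum_negf)
      then have "card {s. s < q \<and> Z s (fst p) (snd p)} \<le> 2 * card I"
        using shifted_inverse_sum_roots[OF q I(1), of e a i0] i0 aV
        by (auto simp: pg e_def split: sum.splits)
      then have "real (card {s. s < q \<and> Z s (fst p) (snd p)}) \<le> real (4 * r)"
        unfolding I by (simp only: of_nat_le_iff)
      then show ?thesis using False by simp
    qed
  qed
  also have "\<dots> = real V ^ (2 * r) * (4 * real r) + real (card P0) * real q"
  proof -
    have "(\<Sum>p\<in>P. if p \<in> P0 then real q else 0) = (\<Sum>p\<in>P0. real q)"
      by (rule sum.mono_neutral_cong_right) (use finP P0P in auto)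
    then show ?thesis
      by (simp add: sum.distrib P_def card_cartesian_product card_PiE mult_2 power_add)
  qed
  also have "\<dots> \<le> real V ^ (2 * r) * (4 * real r) + (real r ^ (2 * r) * real V ^ r) * real q"
  proof -
    have "card P0 \<le> r ^ (2 * r) * V ^ r" unfolding P0_def by (rule card_few_values_le[OF r])
    then have "real (card P0) \<le> real (r ^ (2 * r) * V ^ r)" by (simp only: of_nat_le_iff)
    then show ?thesis by (simp add: mult_right_mono)
  qed
  also have "\<dots> = real r ^ (2 * r) * real V ^ r * real q + 4 * real r * real V ^ (2 * r)" by simp
  finally show ?thesis by (simp add: mult_left_mono)
qed

section \<open>Averaging over shifts\<close>

lemma sum_shift_bound:
  fixes f :: "nat \<Rightarrow> complex"
  assumes "\<And>n. cmod (f n) \<le> 1"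
  shows "cmod ((\<Sum>n\<in>{1..Y}. f n) - (\<Sum>n\<in>{1..Y}. f (n + w))) \<le> 2 * real w"
proof (induction w)
  case (Suc w)
  have "(\<Sum>n\<in>{1..Y}. f (n + w)) - (\<Sum>n\<in>{1..Y}. f (n + Suc w)) = f (1 + w) - f (Y + 1 + w)"
    by (induction Y) (simp_all add: algebra_simps)
  moreover have "cmod (f (1 + w) - f (Y + 1 + w)) \<le> 1 + 1"
    by (rule order.trans[OF norm_triangle_ineq4 add_mono]) (rule assms)+
  ultimately have "cmod ((\<Sum>n\<in>{1..Y}. f (n + w)) - (\<Sum>n\<in>{1..Y}. f (n + Suc w))) \<le> 2" by simp
  then show ?case
    using Suc norm_triangle_ineq[of "(\<Sum>n\<in>{1..Y}. f n) - (\<Sum>n\<in>{1..Y}. f (n + w))"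
      "(\<Sum>n\<in>{1..Y}. f (n + w)) - (\<Sum>n\<in>{1..Y}. f (n + Suc w))"] by simp
qed simp

text \<open>The shift \<open>n + u v\<close> equals \<open>u (n / u + v)\<close>, so the inverse sum becomes a sum over
  \<open>v\<close> whose two parameters \<open>n / u\<close> and \<open>h / u\<close> determine \<open>(n, u)\<close>; hence it is bounded by the
  complete moment over both parameters.\<close>

lemma incomplete_kloosterman_shift:
  fixes q Y U V r :: nat and h :: int
  assumes q: "prime q" and h: "\<not> int q dvd h" and Y: "Y < q" and U: "U < q" and V: "V < q" and r: "r > 0"
  shows "\<exists>Z\<ge>0. cmod (\<Sum>n\<in>{1..Y}. add_char q (h * modinv q (int n))) * (real U * real V)
      \<le> Z + 2 * (real U * real V) ^ 2 \<and>
    Z ^ (2 * r) \<le> (real Y * real U) ^ (2 * r - 1) *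
      (real q * (real r ^ (2 * r) * real V ^ r * real q + 4 * real r * real V ^ (2 * r)))"
proof -
  have q0: "q > 0" using V by simp
  define K where "K n = add_char q (h * modinv q (int n))" for n
  define S where "S = (\<Sum>n\<in>{1..Y}. K n)"
  define \<Psi> where "\<Psi> = (\<lambda>(s, t). cmod (\<Sum>v\<in>{1..V}. add_char q (int t * modinv q (int s + int v))))"
  define P where "P = {1..Y} \<times> {1..U}"
  define st where "st = (\<lambda>(n, u). (nat ((int n * modinv q (int u)) mod int q), nat ((h * modinv q (int u)) mod int q)))"
  define Z where "Z = (\<Sum>p\<in>P. \<Psi> (st p))"
  have finP: "finite P" by (simp add: P_def)
  have K1: "cmod (K n) \<le> 1" for n by (simp add: K_def)
  have st: "int (fst (st (n, u))) = (int n * modinv q (int u)) mod int q"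
    "int (snd (st (n, u))) = (h * modinv q (int u)) mod int q" for n u
    using q0 by (simp_all add: st_def)
  have st_less: "fst (st p) < q" "snd (st p) < q" for p
    using q0 by (auto simp: st_def case_prod_unfold nat_less_iff)
  have unit: "\<not> int q dvd int u" if "u \<in> {1..U}" for u
    using that U by (intro not_dvd_small) auto
  have \<Psi>: "cmod (\<Sum>v\<in>{1..V}. K (n + u * v)) = \<Psi> (st (n, u))" if "u \<in> {1..U}" for n u
  proof -
    have "K (n + u * v) = add_char q (int (snd (st (n, u))) * modinv q (int (fst (st (n, u))) + int v))" for v
    proof -
      define m where "m = modinv q (int u)"
      have um: "[int u * m = 1] (mod int q)"
        unfolding m_def by (rule modinv_right[OF q unit[OF that]])
      have "[int n * (int u * m) + int u * int v = int n * 1 + int u * int v] (mod int q)"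
        by (intro cong_add cong_scalar_left um cong_refl)
      then have "[int (n + u * v) = int u * (int n * m + int v)] (mod int q)"
        by (simp add: algebra_simps cong_sym_eq)
      moreover have "[int u * (int n * m + int v) = int u * (int (fst (st (n, u))) + int v)] (mod int q)"
        unfolding st m_def by (intro cong_scalar_left cong_add cong_refl) (simp add: Cong.cong_def)
      ultimately have "[modinv q (int (n + u * v)) = modinv q (int u * (int (fst (st (n, u))) + int v))] (mod int q)"
        by (intro modinv_cong) (rule cong_trans)
      then have f1: "[h * modinv q (int (n + u * v)) = h * (m * modinv q (int (fst (st (n, u))) + int v))] (mod int q)"
        unfolding modinv_mult m_def by (rule cong_scalar_left)
      have f2: "[h * m * modinv q (int (fst (st (n, u))) + int v)
          = int (snd (st (n, u))) * modinv q (int (fst (st (n, u))) + int v)] (mod int q)"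
        unfolding st(2) m_def by (intro cong_scalar_right) (simp add: Cong.cong_def)
      have "[h * modinv q (int (n + u * v))
          = int (snd (st (n, u))) * modinv q (int (fst (st (n, u))) + int v)] (mod int q)"
        by (rule cong_trans[OF f1 f2[unfolded mult.assoc[of h m]]])
      then show ?thesis unfolding K_def by (rule add_char_cong[OF q0])
    qed
    then show ?thesis by (simp add: \<Psi>_def case_prod_unfold)
  qed
  have inj: "inj_on st P"
  proof (rule inj_onI)
    fix p p' assume p: "p \<in> P" "p' \<in> P" and eq: "st p = st p'"
    obtain n u n' u' where pq: "p = (n, u)" "p' = (n', u')" by (cases p, cases p')
    have u: "u \<in> {1..U}" "u' \<in> {1..U}" and n: "n \<in> {1..Y}" "n' \<in> {1..Y}"
      using p by (auto simp: P_def pq)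
    have "[h * modinv q (int u) = h * modinv q (int u')] (mod int q)"
      using eq st(2)[of n u] st(2)[of n' u'] by (simp add: pq Cong.cong_def)
    then have "[modinv q (int u) = modinv q (int u')] (mod int q)"
      using cong_mult_lcancel_prime[OF q h] by blast
    then have "[int u = int u'] (mod int q)"
      by (rule modinv_inj[OF q unit[OF u(1)] unit[OF u(2)]])
    then have uu: "u = u'"
      using u U cong_less_modulus_unique_nat[of u u' q] by (auto simp: cong_int_iff)
    have "[int n * modinv q (int u) = int n' * modinv q (int u)] (mod int q)"
      using eq st(1)[of n u] st(1)[of n' u'] by (simp add: pq uu Cong.cong_def)
    then have "[int n = int n'] (mod int q)"
      using cong_mult_lcancel_prime[OF q modinv_not_dvd[OF q unit[OF u(1)]]]
      by (simp add: mult.commute)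
    then have "n = n'"
      using n Y cong_less_modulus_unique_nat[of n n' q] by (auto simp: cong_int_iff)
    then show "p = p'" by (simp add: pq uu)
  qed
  have \<Psi>0: "\<Psi> x \<ge> 0" for x by (simp add: \<Psi>_def case_prod_unfold)
  have "Z \<ge> 0" unfolding Z_def by (intro sum_nonneg \<Psi>0)
  moreover have "cmod S * (real U * real V) \<le> Z + 2 * (real U * real V) ^ 2"
  proof -
    \<comment> \<open>\<open>S\<close> is averaged over U V shifts; each shifted sum differs from
      \<open>S\<close> by at most 2 U V, which is the origin of the quadratic term.\<close>
    have "of_nat (U * V) * S = (\<Sum>u\<in>{1..U}. \<Sum>v\<in>{1..V}. S)" by simp
    also have "\<dots> = (\<Sum>u\<in>{1..U}. \<Sum>v\<in>{1..V}. \<Sum>n\<in>{1..Y}. K (n + u * v))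
        + (\<Sum>u\<in>{1..U}. \<Sum>v\<in>{1..V}. S - (\<Sum>n\<in>{1..Y}. K (n + u * v)))"
      by (simp add: sum_subtractf)
    finally have *: "of_nat (U * V) * S = (\<Sum>u\<in>{1..U}. \<Sum>v\<in>{1..V}. \<Sum>n\<in>{1..Y}. K (n + u * v))
        + (\<Sum>u\<in>{1..U}. \<Sum>v\<in>{1..V}. S - (\<Sum>n\<in>{1..Y}. K (n + u * v)))" .
    have 1: "cmod (\<Sum>u\<in>{1..U}. \<Sum>v\<in>{1..V}. \<Sum>n\<in>{1..Y}. K (n + u * v)) \<le> Z"
    proof -
      have "(\<Sum>u\<in>{1..U}. \<Sum>v\<in>{1..V}. \<Sum>n\<in>{1..Y}. K (n + u * v))
          = (\<Sum>u\<in>{1..U}. \<Sum>n\<in>{1..Y}. \<Sum>v\<in>{1..V}. K (n + u * v))"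
        by (intro sum.cong refl sum.swap)
      also have "\<dots> = (\<Sum>n\<in>{1..Y}. \<Sum>u\<in>{1..U}. \<Sum>v\<in>{1..V}. K (n + u * v))" by (rule sum.swap)
      also have "\<dots> = (\<Sum>p\<in>P. \<Sum>v\<in>{1..V}. K (fst p + snd p * v))"
        unfolding P_def by (rule trans[OF sum.cartesian_product]) (simp only: case_prod_unfold)
      also have "cmod \<dots> \<le> (\<Sum>p\<in>P. cmod (\<Sum>v\<in>{1..V}. K (fst p + snd p * v)))"
        by (rule norm_sum)
      also have "\<dots> = Z"
        unfolding Z_def
      proof (intro sum.cong refl)
        fix p assume "p \<in> P"
        then show "cmod (\<Sum>v\<in>{1..V}. K (fst p + snd p * v)) = \<Psi> (st p)"
          using \<Psi>[of "snd p" "fst p"] by (simp add: P_def mem_Times_iff)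
      qed
      finally show ?thesis .
    qed
    have 2: "cmod (\<Sum>u\<in>{1..U}. \<Sum>v\<in>{1..V}. S - (\<Sum>n\<in>{1..Y}. K (n + u * v))) \<le> 2 * (real U * real V) ^ 2"
    proof -
      have "cmod (\<Sum>u\<in>{1..U}. \<Sum>v\<in>{1..V}. S - (\<Sum>n\<in>{1..Y}. K (n + u * v)))
          \<le> (\<Sum>u\<in>{1..U}. \<Sum>v\<in>{1..V}. 2 * (real U * real V))"
      proof (rule order.trans[OF norm_sum], rule sum_mono, rule order.trans[OF norm_sum], rule sum_mono)
        fix u v assume uv: "u \<in> {1..U}" "v \<in> {1..V}"
        have "cmod (S - (\<Sum>n\<in>{1..Y}. K (n + u * v))) \<le> 2 * real (u * v)"
          unfolding S_def by (rule sum_shift_bound[OF K1])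
        also have "real (u * v) \<le> real (U * V)"
          using uv by (intro of_nat_mono mult_mono) auto
        finally show "cmod (S - (\<Sum>n\<in>{1..Y}. K (n + u * v))) \<le> 2 * (real U * real V)" by simp
      qed
      then show ?thesis by (simp add: power2_eq_square mult_ac)
    qed
    have "real U * real V * cmod S = cmod (of_nat (U * V) * S)"
      by (simp add: norm_mult)
    also have "\<dots> \<le> Z + 2 * (real U * real V) ^ 2"
      unfolding * by (rule order.trans[OF norm_triangle_ineq add_mono[OF 1 2]])
    finally show ?thesis by (simp add: mult.commute)
  qed
  moreover have "Z ^ (2 * r) \<le> (real Y * real U) ^ (2 * r - 1) *
      (real q * (real r ^ (2 * r) * real V ^ r * real q + 4 * real r * real V ^ (2 * r)))"
  proof -
    have "Z ^ (2 * r) \<le> real (card P) ^ (2 * r - 1) * (\<Sum>p\<in>P. \<Psi> (st p) ^ (2 * r))"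
      unfolding Z_def using r by (intro power_mean_sum finP \<Psi>0) auto
    also have "(\<Sum>p\<in>P. \<Psi> (st p) ^ (2 * r)) = (\<Sum>x\<in>st ` P. \<Psi> x ^ (2 * r))"
      by (simp add: sum.reindex[OF inj])
    also have "\<dots> \<le> (\<Sum>x\<in>{..<q} \<times> {..<q}. \<Psi> x ^ (2 * r))"
    proof (rule sum_mono2)
      show "st ` P \<subseteq> {..<q} \<times> {..<q}"
        by (rule image_subsetI) (simp only: mem_Times_iff lessThan_iff st_less simp_thms)
    qed (simp_all add: \<Psi>0)
    also have "\<dots> \<le> real q * (real r ^ (2 * r) * real V ^ r * real q + 4 * real r * real V ^ (2 * r))"
      using shifted_moment_bound[OF q V r] by (simp add: \<Psi>_def sum.cartesian_product case_prod_unfold)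
    finally show ?thesis by (simp add: mult_left_mono P_def card_cartesian_product)
  qed
  ultimately show ?thesis unfolding S_def K_def by blast
qed

text \<open>\<open>U\<close> is about q^(1/2) and \<open>V\<close> about q^(1/r). Since V^r \<ge> q,
  the contribution of tuples with few values is absorbed into a constant times V^(2r). Since Y U
  \<ge> q^(1+\<eta>), one factor Y U of the trivial bound exceeds \<open>q\<close> by
  q^\<eta>.\<close>

lemma incomplete_kloosterman_bound:
  fixes \<eta> :: real
  assumes \<eta>: "\<eta> > 0"
  shows "\<exists>\<delta>>0. \<exists>Q\<ge>1. \<forall>q h Y. prime q \<longrightarrow> q > 2 \<longrightarrow> \<not> int q dvd h \<longrightarrow> Y < q \<longrightarrow>
     real q powr (1/2 + \<eta>) \<le> real Y \<longrightarrow>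
     cmod (\<Sum>n\<in>{1..Y}. add_char q (h * modinv q (int n))) \<le> Q * real Y * real q powr - \<delta>"
proof -
  \<comment> \<open>With 1 / r \<le> \<eta> / 2 the shift length U V is at most 4 q^(1/2 +
    \<eta>/2), which stays below Y by a power of \<open>q\<close>.\<close>
  define r where "r = nat \<lceil>2 / \<eta>\<rceil> + 2"
  have r0: "r > 0" "real r \<ge> 2" by (simp_all add: r_def)
  have "2 / \<eta> \<le> real r" by (simp add: r_def) linarith
  then have r\<eta>: "1 / real r \<le> \<eta> / 2" using \<eta> r0 by (simp add: field_simps)
  define c where "c = real r ^ (2 * r) + 4 * real r"
  have c1: "c \<ge> 1" 
    unfolding c_def using r0 zero_le_power[of "real r" "2 * r", OF of_nat_0_le_iff] by linarith
  define \<delta> where "\<delta> = \<eta> / real (2 * r)"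
  have \<delta>: "\<delta> > 0" using \<eta> r0 by (simp add: \<delta>_def)
  have Q1: "c + 8 \<ge> 1" using c1 by simp
  show ?thesis
  proof (rule exI[of _ \<delta>], rule conjI[OF \<delta>], rule exI[of _ "c + 8"], rule conjI[OF Q1], intro allI impI)
    fix q :: nat and h :: int and Y :: nat
    assume q: "prime q" "q > 2" and h: "\<not> int q dvd h" and Y: "Y < q" "real q powr (1/2 + \<eta>) \<le> real Y"
    have q1: "real q > 1" using q by simp
    have sqrt_q: "real q powr (1/2) + 1 < real q"
    proof -
      have "real q \<ge> 3" using q by simp
      moreover have "sqrt (real q) \<ge> 1.7"
        using \<open>real q \<ge> 3\<close> by (intro real_le_rsqrt) (simp add: power2_eq_square)
      then have "1.7 * sqrt (real q) \<le> sqrt (real q) * sqrt (real q)"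
        by (intro mult_right_mono) auto
      then have "1.7 * sqrt (real q) \<le> real q" by simp
      ultimately show ?thesis using \<open>sqrt (real q) \<ge> 1.7\<close> by (simp add: powr_half_sqrt)
    qed
    have ceil: "\<exists>W. x \<le> real W \<and> real W \<le> 2 * x \<and> W < q" if "1 \<le> x" "x \<le> real q powr (1/2)" for x
    proof (intro exI[of _ "nat \<lceil>x\<rceil>"] conjI)
      show "x \<le> real (nat \<lceil>x\<rceil>)" by (rule real_nat_ceiling_ge)
      have *: "real (nat \<lceil>x\<rceil>) < x + 1" using that by linarith
      then show "real (nat \<lceil>x\<rceil>) \<le> 2 * x" using that by linarith
      have "real (nat \<lceil>x\<rceil>) < real q" using * that sqrt_q by linarith
      then show "nat \<lceil>x\<rceil> < q" by simp
    qed
    have "1 \<le> real q powr (1/2)" "1 \<le> real q powr (1 / real r)"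
      using q1 by (auto intro!: ge_one_powr_ge_zero)
    moreover have "real q powr (1 / real r) \<le> real q powr (1/2)"
      using q1 r0 by (intro powr_mono) (auto simp: field_simps)
    ultimately obtain U V where U: "real q powr (1/2) \<le> real U" "real U \<le> 2 * real q powr (1/2)" "U < q"
      and V: "real q powr (1 / real r) \<le> real V" "real V \<le> 2 * real q powr (1 / real r)" "V < q"
      using ceil[of "real q powr (1/2)"] ceil[of "real q powr (1 / real r)"] by auto
    define S where "S = cmod (\<Sum>n\<in>{1..Y}. add_char q (h * modinv q (int n)))"
    obtain Z where Z: "Z \<ge> 0" "S * (real U * real V) \<le> Z + 2 * (real U * real V) ^ 2"
      "Z ^ (2 * r) \<le> (real Y * real U) ^ (2 * r - 1) *
        (real q * (real r ^ (2 * r) * real V ^ r * real q + 4 * real r * real V ^ (2 * r)))"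
      using incomplete_kloosterman_shift[OF q(1) h Y(1) U(3) V(3) r0(1)] unfolding S_def by blast
    have pos: "real U > 0" "real V > 0" "real Y > 0"
    proof -
      have "0 < real q powr x" for x using q1 by simp
      then show "real U > 0" "real V > 0" "real Y > 0"
        by (meson U(1) V(1) Y(2) less_le_trans)+
    qed
    have Vr: "real q \<le> real V ^ r"
    proof -
      have "real q = (real q powr (1 / real r)) ^ r" using q1 r0 by (simp add: powr_power)
      also have "\<dots> \<le> real V ^ r" using V(1) by (intro power_mono) auto
      finally show ?thesis .
    qed
    have YU: "real q powr (1 + \<eta>) \<le> real Y * real U"
    proof -
      have "real q powr (1 + \<eta>) = real q powr (1/2 + \<eta>) * real q powr (1/2)"
        by (simp flip: powr_add)
      also have "\<dots> \<le> real Y * real U" using Y U by (intro mult_mono) auto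
      finally show ?thesis .
    qed
    have "Z ^ (2 * r) \<le> (real Y * real U) ^ (2 * r - 1) *
        (real q * (real r ^ (2 * r) * real V ^ r * real q + 4 * real r * real V ^ (2 * r)))" by fact
    also have "\<dots> \<le> (real Y * real U) ^ (2 * r - 1) * (real q * (c * real V ^ (2 * r)))"
    proof (intro mult_left_mono)
      have "real r ^ (2 * r) * real V ^ r * real q \<le> real r ^ (2 * r) * real V ^ r * real V ^ r"
        by (intro mult_left_mono Vr) auto
      also have "\<dots> = real r ^ (2 * r) * real V ^ (2 * r)" by (simp add: mult_2 power_add)
      finally show "real r ^ (2 * r) * real V ^ r * real q + 4 * real r * real V ^ (2 * r) \<le> c * real V ^ (2 * r)"
        by (simp add: c_def distrib_right)
    qed auto
    \<comment> \<open>Here the factor q becomes at most Y U q^(-\<eta>): it completes the power of Y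
      U and yields the saving, of which the 2 r-th root keeps \<eta> / (2 r).\<close>
    also have "real q = real q powr (1 + \<eta>) * real q powr - \<eta>"
      using q1 by (simp flip: powr_add)
    also have "(real Y * real U) ^ (2 * r - 1) * (real q powr (1 + \<eta>) * real q powr - \<eta> * (c * real V ^ (2 * r)))
        \<le> (real Y * real U) ^ (2 * r - 1) * (real Y * real U * real q powr - \<eta> * (c * real V ^ (2 * r)))"
      using c1 by (intro mult_left_mono mult_right_mono YU) auto
    also have "\<dots> = c * ((real Y * real U * real V) ^ (2 * r) * real q powr - \<eta>)"
    proof -
      have "(real Y * real U) ^ (2 * r) = (real Y * real U) ^ (2 * r - 1) * (real Y * real U)"
        using r0 by (simp flip: power_Suc2)
      then show ?thesis by (simp only: power_mult_distrib[of "real Y * real U"]) (simp only: mult_ac)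
    qed
    finally have "Z \<le> c * (real Y * real U * real V) * real q powr - (\<eta> / real (2 * r))"
      by (rule root_bound) (use r0 c1 q1 \<eta> in auto)
    then have ZZ: "Z \<le> c * real Y * real q powr - \<delta> * (real U * real V)"
      by (simp add: \<delta>_def mult_ac)
    have UV: "real U * real V \<le> 4 * (real Y * real q powr - \<delta>)"
    proof -
      have "real U * real V \<le> (2 * real q powr (1/2)) * (2 * real q powr (1 / real r))"
        using U V by (intro mult_mono) auto
      also have "\<dots> = 4 * real q powr (1/2 + 1 / real r)" by (simp add: powr_add)
      also have "\<dots> \<le> 4 * real q powr ((1/2 + \<eta>) + - \<delta>)"
      proof -
        have "\<delta> \<le> \<eta> / 2" using \<eta> r0 by (simp add: \<delta>_def field_simps)
        then show ?thesis using q1 r\<eta> by (intro mult_left_mono powr_mono) auto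
      qed
      also have "\<dots> = 4 * (real q powr (1/2 + \<eta>) * real q powr - \<delta>)" by (simp only: powr_add)
      also have "\<dots> \<le> 4 * (real Y * real q powr - \<delta>)"
        using Y by (intro mult_left_mono mult_right_mono) auto
      finally show ?thesis .
    qed
    have "S * (real U * real V) \<le> (c * real Y * real q powr - \<delta> + 2 * (real U * real V)) * (real U * real V)"
      using Z(2) ZZ by (simp add: distrib_right power2_eq_square)
    then have "S \<le> c * real Y * real q powr - \<delta> + 2 * (real U * real V)"
      using pos by (simp only: mult_le_cancel_right_pos mult_pos_pos)
    also have "\<dots> \<le> c * real Y * real q powr - \<delta> + 8 * (real Y * real q powr - \<delta>)"
      using UV by simp
    also have "\<dots> = (c + 8) * real Y * real q powr - \<delta>" by (simp add: distrib_right)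
    finally show "cmod (\<Sum>n\<in>{1..Y}. add_char q (h * modinv q (int n))) \<le> (c + 8) * real Y * real q powr - \<delta>"
      by (simp add: S_def)
  qed
qed

section \<open>Kloosterman sums over primes\<close>

text \<open>Junk value: \<open>lpf 1\<close> is unspecified.\<close>

definition lpf :: "nat \<Rightarrow> nat" where
  "lpf n = (LEAST p. prime p \<and> p dvd n)"

lemma lpf:
  assumes "n \<noteq> 1"
  shows "prime (lpf n)" "lpf n dvd n"
proof -
  obtain p where "prime p \<and> p dvd n" using prime_factor_nat[OF assms] by blast
  then have "prime (lpf n) \<and> lpf n dvd n" unfolding lpf_def by (rule LeastI)
  then show "prime (lpf n)" "lpf n dvd n" by auto
qed

lemma lpf_le: "prime p \<Longrightarrow> p dvd n \<Longrightarrow> lpf n \<le> p"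
  unfolding lpf_def by (rule Least_le) simp

section \<open>The truncated Legendre sieve\<close>

definition sqfree_smooth :: "nat \<Rightarrow> nat \<Rightarrow> bool" where
  "sqfree_smooth z d \<longleftrightarrow> squarefree d \<and> (\<forall>p. prime p \<longrightarrow> p dvd d \<longrightarrow> p \<le> z)"

text \<open>Agrees with the Moebius function on squarefree numbers only; elsewhere it is 1 or -1
  instead of 0, so the weights built from it carry the condition
  \<open>sqfree_smooth\<close>.\<close>

definition mu :: "nat \<Rightarrow> int" where
  "mu d = (-1) ^ card (prime_factors d)"

lemma mu_mult_prime:
  assumes "prime a" "\<not> a dvd e" "e > 0"
  shows "mu (a * e) = - mu e"
proof -
  have "prime_factors (a * e) = insert a (prime_factors e)"
    using assms by (auto simp: prime_factors_product prime_prime_factors)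
  moreover have "a \<notin> prime_factors e" using assms by auto
  ultimately show ?thesis by (simp add: mu_def)
qed

text \<open>Legendre's sum over squarefree z-smooth divisors, stopped early: take the primes of a
  divisor in decreasing order and stop as soon as their product d exceeds D. Then d / lpf d \<le> D,
  and summing over all continuations by primes below lpf d leaves the condition that the cofactor
  \<open>l\<close> has no such prime.\<close>

definition sieve_weight :: "nat \<Rightarrow> nat \<Rightarrow> nat \<Rightarrow> nat \<Rightarrow> int" where
  "sieve_weight z D d l = (if sqfree_smooth z d then mu d * (of_bool (d \<le> D) +
     of_bool (D < d \<and> d \<le> D * lpf d \<and> (\<forall>p. prime p \<longrightarrow> p dvd l \<longrightarrow> lpf d \<le> p))) else 0)"

text \<open>If the least prime factor \<open>a\<close> of \<open>n\<close> is at most \<open>z\<close>, the divisors \<open>e\<close> and \<open>a e\<close> with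
  \<open>a\<close> not dividing \<open>e\<close> cancel: both carry the total weight \<open>e \<le> D\<close>.\<close>

lemma sieve_identity:
  assumes n: "n > 0" and D: "D > 0"
  shows "(\<Sum>d\<in>{d. d dvd n}. sieve_weight z D d (n div d))
    = (if \<exists>p. prime p \<and> p dvd n \<and> p \<le> z then 0 else 1)"
proof (cases "\<exists>p. prime p \<and> p dvd n \<and> p \<le> z")
  case False
  have fin: "finite {d. d dvd n}" using n by (intro finite_divisors_nat)
  have w: "sieve_weight z D d (n div d) = (if d = 1 then 1 else 0)" if "d dvd n" for d
  proof (cases "d = 1")
    case True
    then show ?thesis using D by (simp add: sieve_weight_def sqfree_smooth_def mu_def)
  next
    case ne: False
    then obtain p where "prime p" "p dvd d" using prime_factor_nat by blast
    then have "\<not> sqfree_smooth z d" using False that by (auto simp: sqfree_smooth_def intro: dvd_trans)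
    then show ?thesis using ne by (simp add: sieve_weight_def)
  qed
  have "(\<Sum>d\<in>{d. d dvd n}. sieve_weight z D d (n div d)) = (\<Sum>d\<in>{d. d dvd n}. if d = 1 then 1 else 0)"
    by (intro sum.cong refl w) simp
  also have "\<dots> = 1" using fin by simp
  finally show ?thesis using False by simp
next
  case True
  define a where "a = lpf n"
  have n1: "n \<noteq> 1" using True by (auto simp: not_prime_1) 
  have a: "prime a" "a dvd n" "a \<le> z"
    using lpf[OF n1] True lpf_le by (auto simp: a_def intro: order.trans)
  have a_le: "a \<le> p" if "prime p" "p dvd n" for p using that by (simp add: a_def lpf_le)
  have a2: "a \<ge> 2" using a(1) by (rule prime_ge_2_nat)
  have lpf_a: "lpf d = a" if "d dvd n" "a dvd d" for d
  proof -
    have "d \<noteq> 1" using that a(1) not_prime_1 by auto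
    then show ?thesis using lpf[of d] lpf_le[OF a(1) that(2)] a_le[of "lpf d"] that by (meson dvd_trans le_antisym)
  qed
  \<comment> \<open>For d > D the condition on the cofactor means that \<open>a\<close> divides d:
    otherwise \<open>a\<close> divides the cofactor, which forces lpf d \<le> a and so lpf d = a,
    although lpf d divides d.\<close>
  have wt: "sieve_weight z D d (n div d) = (if sqfree_smooth z d then mu d * (of_bool (d \<le> D) +
     of_bool (D < d \<and> d \<le> D * a \<and> a dvd d)) else 0)" if d: "d dvd n" for d
  proof -
    have "(D < d \<and> d \<le> D * lpf d \<and> (\<forall>p. prime p \<longrightarrow> p dvd n div d \<longrightarrow> lpf d \<le> p))
      \<longleftrightarrow> (D < d \<and> d \<le> D * a \<and> a dvd d)"
    proof (cases "a dvd d")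
      case True
      have "a \<le> p" if "prime p" "p dvd n div d" for p
        using that d a_le by (metis dvd_div_mult_self dvd_mult2)
      then show ?thesis using True lpf_a[OF d True] by auto
    next
      case False
      have "\<not> (D < d \<and> (\<forall>p. prime p \<longrightarrow> p dvd n div d \<longrightarrow> lpf d \<le> p))"
      proof
        assume *: "D < d \<and> (\<forall>p. prime p \<longrightarrow> p dvd n div d \<longrightarrow> lpf d \<le> p)"
        have "a dvd d * (n div d)" using a(2) d by simp
        then have "a dvd n div d" using False a(1) by (simp add: prime_dvd_mult_iff)
        then have 1: "lpf d \<le> a" using * a(1) by blast
        have "d \<noteq> 1" using * D by simp
        then have "prime (lpf d)" "lpf d dvd d" using lpf by auto
        moreover from this have "a \<le> lpf d" using a_le d by (meson dvd_trans)
        ultimately show False using False 1 by simp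
      qed
      then show ?thesis using False by blast
    qed
    then show ?thesis by (simp only: sieve_weight_def)
  qed
  define E where "E = {e. e dvd n \<and> sqfree_smooth z e \<and> \<not> a dvd e}"
  define g where "g d = mu d * (of_bool (d \<le> D) + of_bool (D < d \<and> d \<le> D * a \<and> a dvd d))" for d
  have finE: "finite E" by (rule finite_subset[of _ "{d. d dvd n}"]) (use n in \<open>auto simp: E_def intro!: finite_divisors_nat\<close>)
  have E0: "e > 0" if "e \<in> E" for e using that n by (auto simp: E_def intro!: Nat.gr0I)
  have split: "{d. d dvd n \<and> sqfree_smooth z d} = E \<union> (\<lambda>e. a * e) ` E"
  proof (intro equalityI subsetI)
    fix d assume d: "d \<in> {d. d dvd n \<and> sqfree_smooth z d}"
    show "d \<in> E \<union> (\<lambda>e. a * e) ` E"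
    proof (cases "a dvd d")
      case True
      then obtain e where e: "d = a * e" by (auto simp: dvd_def)
      have sq: "squarefree d" using d by (simp add: sqfree_smooth_def)
      have "\<not> a dvd e"
      proof
        assume "a dvd e"
        then have "a ^ 2 dvd d" by (simp add: e power2_eq_square mult_dvd_mono)
        then have "a dvd 1" using sq by (auto simp: squarefree_def)
        then show False using a2 by simp
      qed
      moreover have "e dvd d" by (simp add: e)
      moreover have "squarefree e" using sq \<open>e dvd d\<close> by (rule squarefree_mono[rotated])
      ultimately have "e \<in> E" using d by (auto simp: E_def sqfree_smooth_def intro: dvd_trans)
      then show ?thesis using e by auto
    qed (use d in \<open>auto simp: E_def\<close>)
  next
    fix d assume "d \<in> E \<union> (\<lambda>e. a * e) ` E"
    then consider "d \<in> E" | e where "e \<in> E" "d = a * e" by auto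
    then show "d \<in> {d. d dvd n \<and> sqfree_smooth z d}"
    proof cases
      case 2
      have cop: "coprime a e" using 2 a(1) by (auto simp: E_def intro: prime_imp_coprime)
      then have "a * e dvd n" using 2 a(2) by (auto simp: E_def intro: divides_mult)
      moreover have "squarefree (a * e)"
        using 2 a(1)
        by (intro squarefree_mult_coprime cop)
          (auto simp: E_def sqfree_smooth_def intro: squarefree_prime)
      ultimately show ?thesis
        using 2 a by (auto simp: E_def sqfree_smooth_def prime_dvd_mult_iff dest: primes_dvd_imp_eq)
    qed (auto simp: E_def)
  qed
  have "(\<Sum>d\<in>{d. d dvd n}. sieve_weight z D d (n div d)) = (\<Sum>d\<in>{d. d dvd n}. if sqfree_smooth z d then g d else 0)"
    by (intro sum.cong refl) (simp add: wt g_def)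
  also have "\<dots> = (\<Sum>d\<in>{d. d dvd n \<and> sqfree_smooth z d}. g d)"
  proof -
    have "{d. d dvd n \<and> sqfree_smooth z d} = {d \<in> {d. d dvd n}. sqfree_smooth z d}" by auto
    then show ?thesis using n by (simp only: sum.inter_filter finite_divisors_nat)
  qed
  also have "\<dots> = (\<Sum>d\<in>E. g d) + (\<Sum>d\<in>(\<lambda>e. a * e) ` E. g d)"
    unfolding split using finE by (intro sum.union_disjoint) (auto simp: E_def)
  also have "(\<Sum>d\<in>(\<lambda>e. a * e) ` E. g d) = (\<Sum>e\<in>E. g (a * e))"
    using a2 by (subst sum.reindex) (auto simp: inj_on_def)
  also have "(\<Sum>d\<in>E. g d) + (\<Sum>e\<in>E. g (a * e)) = (\<Sum>e\<in>E. g e + g (a * e))"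
    by (simp add: sum.distrib)
  also have "\<dots> = 0"
  proof (intro sum.neutral ballI)
    fix e assume e: "e \<in> E"
    have na: "\<not> a dvd e" using e by (simp add: E_def)
    \<comment> \<open>The two brackets for a e cover a e \<le> D and D < a e \<le> D a, which
      together say e \<le> D; the second bracket for e is empty as \<open>a\<close> does not divide
      e.\<close>
    have "a * e \<le> D * a \<longleftrightarrow> e \<le> D" using a2 by (simp add: mult.commute)
    moreover have "a * e \<le> D \<Longrightarrow> e \<le> D"
      using a2 by (metis le_trans mult_le_mono1 nat_mult_1 one_le_numeral)
    ultimately show "g e + g (a * e) = 0"
      using na mu_mult_prime[OF a(1) na E0[OF e]] by (auto simp: g_def of_bool_def)
  qed
  finally show ?thesis using True by simp
qed

lemma sum_divisor_pairs:
  fixes F :: "nat \<Rightarrow> nat \<Rightarrow> complex"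
  shows "(\<Sum>n\<in>{1..X}. \<Sum>d\<in>{d. d dvd n}. F d (n div d)) = (\<Sum>d\<in>{1..X}. \<Sum>l\<in>{1..X div d}. F d l)"
proof -
  have "(\<Sum>n\<in>{1..X}. \<Sum>d\<in>{d. d dvd n}. F d (n div d))
      = (\<Sum>(n, d)\<in>(SIGMA n:{1..X}. {d. d dvd n}). F d (n div d))"
    by (rule sum.Sigma) (auto intro!: finite_divisors_nat)
  also have "\<dots> = (\<Sum>(d, l)\<in>(SIGMA d:{1..X}. {1..X div d}). F d l)"
  proof (rule sum.reindex_bij_witness[of _ "\<lambda>(d, l). (d * l, d)" "\<lambda>(n, d). (d, n div d)"])
    fix p assume "p \<in> (SIGMA n:{1..X}. {d. d dvd n})"
    then obtain n d where p: "p = (n, d)" "1 \<le> n" "n \<le> X" "d dvd n" by auto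
    then have "d > 0" "d \<le> n" by (auto intro!: Nat.gr0I dvd_imp_le)
    then show "(case case p of (n, d) \<Rightarrow> (d, n div d) of (d, l) \<Rightarrow> (d * l, d)) = p"
      "(case p of (n, d) \<Rightarrow> (d, n div d)) \<in> (SIGMA d:{1..X}. {1..X div d})"
      using p by (auto simp: div_le_mono div_greater_zero_iff Suc_le_eq)
    show "(case case p of (n, d) \<Rightarrow> (d, n div d) of (d, l) \<Rightarrow> F d l) = (case p of (n, d) \<Rightarrow> F d (n div d))"
      by (simp add: p)
  next
    fix p assume "p \<in> (SIGMA d:{1..X}. {1..X div d})"
    then obtain d l where p: "p = (d, l)" "1 \<le> d" "d \<le> X" "1 \<le> l" "l \<le> X div d" by auto
    have "d * l \<le> X" using p by (metis div_times_less_eq_dividend le_trans mult.commute mult_le_mono2)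
    then show "(case case p of (d, l) \<Rightarrow> (d * l, d) of (n, d) \<Rightarrow> (d, n div d)) = p"
      "(case p of (d, l) \<Rightarrow> (d * l, d)) \<in> (SIGMA n:{1..X}. {d. d dvd n})"
      using p by auto
  qed
  also have "\<dots> = (\<Sum>d\<in>{1..X}. \<Sum>l\<in>{1..X div d}. F d l)"
    by (rule sum.Sigma[symmetric]) auto
  finally show ?thesis .
qed

lemma rough_imp_prime:
  fixes n z X :: nat
  assumes "n \<le> X" "X < (z + 1)\<^sup>2" "n > 1" "\<not> (\<exists>p. prime p \<and> p dvd n \<and> p \<le> z)"
  shows "prime n"
proof (rule ccontr)
  assume np: "\<not> prime n"
  have "n \<noteq> 1" using assms(3) by simp
  then obtain a where a: "prime a" "a dvd n" using lpf by blast
  then obtain m where m: "n = a * m" by (auto simp: dvd_def)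
  have m1: "m \<noteq> 1" using m np a by auto
  have m0: "m > 0" using m assms(3) by (auto intro!: Nat.gr0I)
  have "lpf m dvd n" using lpf(2)[OF m1] by (simp add: m)
  then have "lpf m > z" using assms(4) lpf(1)[OF m1] by (meson not_le)
  moreover have "lpf m \<le> m" using lpf(2)[OF m1] m0 by (rule dvd_imp_le)
  moreover have "a > z" using assms(4) a by (meson not_le)
  ultimately have "z + 1 \<le> a" "z + 1 \<le> m" by auto
  then have "(z + 1) * (z + 1) \<le> a * m" by (rule mult_le_mono)
  then show False using m assms(1,2) by (simp add: power2_eq_square)
qed

text \<open>By \<open>sieve_identity\<close> the double sum runs over the n \<le> X without prime
  factors up to z. As X < (z + 1)^2, these are 1 and the primes in (z, X]; the error consists of the
  primes up to z and of n = 1.\<close>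

lemma prime_sum_decomposition:
  fixes F :: "nat \<Rightarrow> complex"
  assumes D: "D > 0" and X: "X < (z + 1)\<^sup>2" and F: "\<And>n. cmod (F n) \<le> 1"
  shows "cmod (\<Sum>p\<in>{p. prime p \<and> p \<le> X}. F p) \<le> real z + 1 +
    cmod (\<Sum>d\<in>{1..X}. \<Sum>l\<in>{1..X div d}. of_int (sieve_weight z D d l) * F (d * l))"
proof -
  define R where "R = {n\<in>{1..X}. \<not> (\<exists>p. prime p \<and> p dvd n \<and> p \<le> z)}"
  define P where "P = {p. prime p \<and> p \<le> X}"
  have fin: "finite R" "finite P" by (simp_all add: R_def P_def)
  have "(\<Sum>d\<in>{1..X}. \<Sum>l\<in>{1..X div d}. of_int (sieve_weight z D d l) * F (d * l))
      = (\<Sum>n\<in>{1..X}. \<Sum>d\<in>{d. d dvd n}. of_int (sieve_weight z D d (n div d)) * F (d * (n div d)))"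
    by (rule sum_divisor_pairs[symmetric])
  also have "\<dots> = (\<Sum>n\<in>{1..X}. of_int (\<Sum>d\<in>{d. d dvd n}. sieve_weight z D d (n div d)) * F n)"
    by (intro sum.cong refl) (simp add: sum_distrib_right)
  also have "\<dots> = (\<Sum>n\<in>{1..X}. if \<not> (\<exists>p. prime p \<and> p dvd n \<and> p \<le> z) then F n else 0)"
    by (intro sum.cong refl, subst sieve_identity[OF _ D]) auto
  also have "\<dots> = (\<Sum>n\<in>R. F n)" unfolding R_def by (rule sum.inter_filter[symmetric]) simp
  finally have eq: "(\<Sum>d\<in>{1..X}. \<Sum>l\<in>{1..X div d}. of_int (sieve_weight z D d l) * F (d * l)) = (\<Sum>n\<in>R. F n)" .
  have "(\<Sum>p\<in>P. F p) = (\<Sum>p\<in>P \<inter> R. F p) + (\<Sum>p\<in>P - R. F p)"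
    using fin by (simp add: sum.Int_Diff)
  moreover have "(\<Sum>n\<in>R. F n) = (\<Sum>p\<in>P \<inter> R. F p) + (\<Sum>p\<in>R - P. F p)"
    using fin by (simp add: sum.Int_Diff[of R _ P] Int_commute)
  ultimately have "(\<Sum>p\<in>P. F p) = (\<Sum>n\<in>R. F n) + (\<Sum>p\<in>P - R. F p) - (\<Sum>p\<in>R - P. F p)" by simp
  then have "cmod (\<Sum>p\<in>P. F p) \<le> cmod (\<Sum>n\<in>R. F n) + cmod (\<Sum>p\<in>P - R. F p) + cmod (\<Sum>p\<in>R - P. F p)"
    by (metis norm_triangle_ineq4 norm_triangle_ineq add_right_mono order.trans)
  moreover have "cmod (\<Sum>p\<in>P - R. F p) \<le> real z"
  proof -
    have "P - R \<subseteq> {1..z}"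
    proof
      fix p assume p: "p \<in> P - R"
      then have pp: "prime p" "p \<le> X" by (auto simp: P_def)
      then have "\<exists>r. prime r \<and> r dvd p \<and> r \<le> z" using p prime_ge_1_nat[OF pp(1)] by (auto simp: R_def)
      then have "p \<le> z" using pp(1) primes_dvd_imp_eq by blast
      then show "p \<in> {1..z}" using prime_ge_1_nat[OF pp(1)] by simp
    qed
    then have "card (P - R) \<le> card {1..z}" by (intro card_mono) auto
    then have c: "card (P - R) \<le> z" by simp
    have "cmod (\<Sum>p\<in>P - R. F p) \<le> (\<Sum>p\<in>P - R. 1)" by (rule sum_norm_le) (rule F)
    then show ?thesis using c by simp
  qed
  moreover have "cmod (\<Sum>p\<in>R - P. F p) \<le> 1"
  proof -
    have "R - P \<subseteq> {1}"
    proof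
      fix n assume n: "n \<in> R - P"
      show "n \<in> {1}"
      proof (rule ccontr)
        assume "n \<notin> {1}"
        then have "prime n" using n X by (intro rough_imp_prime[of n X z]) (auto simp: R_def)
        then show False using n by (auto simp: R_def P_def)
      qed
    qed
    then have "card (R - P) \<le> card {1::nat}" by (intro card_mono) auto
    then have c: "card (R - P) \<le> 1" by simp
    have "cmod (\<Sum>p\<in>R - P. F p) \<le> (\<Sum>p\<in>R - P. 1)" by (rule sum_norm_le) (rule F)
    then show ?thesis using c by simp
  qed
  ultimately show ?thesis unfolding eq P_def by simp
qed

section \<open>Dyadic blocks and the bound for primes\<close>

lemma bilin_bound_decouple':
  assumes "bilin_bound \<phi> A B S" "\<And>m. u m < q" "\<And>n. Y n < q"
  shows "bilin_bound (\<lambda>m n. (if u m \<le> Y n then 1 else 0) * \<phi> m n) A B (interval_coeff_l1 q * S)"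
  using bilin_bound_swap[OF bilin_bound_decouple[OF bilin_bound_swap[OF assms(1)], of Y q u]] assms(2,3)
  by simp

lemma bilin_bound_mono:
  "bilin_bound \<phi> A B S \<Longrightarrow> S \<le> S' \<Longrightarrow> bilin_bound \<phi> A B S'"
  unfolding bilin_bound_def by (meson order.trans)

definition buchstab_weight :: "nat \<Rightarrow> nat \<Rightarrow> nat \<Rightarrow> nat \<Rightarrow> int" where
  "buchstab_weight z D d l = (if sqfree_smooth z d \<and> D < d \<and> d \<le> D * lpf d \<and>
     (\<forall>p. prime p \<longrightarrow> p dvd l \<longrightarrow> lpf d \<le> p) then mu d else 0)"

lemma sieve_weight_split:
  "sieve_weight z D d l = (if sqfree_smooth z d \<and> d \<le> D then mu d else 0) + buchstab_weight z D d l"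
  by (auto simp: sieve_weight_def buchstab_weight_def)

lemma abs_mu: "\<bar>mu d\<bar> = 1"
  by (simp add: mu_def power_abs)

lemma lpf_le_self: "n > 1 \<Longrightarrow> lpf n \<le> n"
  using lpf(2)[of n] by (intro dvd_imp_le) auto

text \<open>The conditions \<open>l \<le> X div d\<close> and ``no prime factor of \<open>l\<close> is below that of \<open>d\<close>'' are the only
  links between \<open>d\<close> and \<open>l\<close>; each is removed by Fourier completion.\<close>

lemma dyadic_block_bound:
  assumes q: "2 * M < q" and X: "X < q" and M: "M > 0" and D: "D > 0"
    and S: "bilin_bound (kloosterman_kernel q h) {1..2 * M} {1..X div M} S"
  shows "cmod (\<Sum>d\<in>{M<..2 * M}. \<Sum>l\<in>{1..X div d}.
      of_int (buchstab_weight z D d l) * kloosterman_kernel q h d l) \<le> interval_coeff_l1 q * (interval_coeff_l1 q * S)"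
proof -
  define \<alpha> :: "nat \<Rightarrow> complex" where
    "\<alpha> d = (if M < d \<and> sqfree_smooth z d \<and> D < d \<and> d \<le> D * lpf d then of_int (mu d) else 0)" for d
  \<comment> \<open>The truncations at q - 1 only serve \<open>bilin_bound_decouple\<close>, which
    asks for values below \<open>q\<close> everywhere. On the relevant ranges n \<le> X < q and lpf
    m \<le> m < q, so they change nothing.\<close>
  define u1 where "u1 n = min n (q - 1)" for n
  define Y1 where "Y1 m = X div m" for m
  define u2 where "u2 m = min (lpf m) (q - 1)" for m
  \<comment> \<open>At n = 1 there is no prime factor, so the condition must hold for every m; the
    largest admissible value replaces the unspecified \<open>lpf 1\<close>.\<close>
  define Y2 where "Y2 n = (if n = 1 then q - 1 else min (lpf n) (q - 1))" for n
  have q0: "q > 0" using q by simp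
  have "bilin_bound (\<lambda>m n. (if u1 n \<le> Y1 m then 1 else 0) * kloosterman_kernel q h m n)
      {1..2 * M} {1..X div M} (interval_coeff_l1 q * S)"
  proof (rule bilin_bound_decouple[OF S])
    show "Y1 m < q" for m unfolding Y1_def using X by (rule le_less_trans[OF div_le_dividend])
    show "u1 n < q" for n using q0 by (simp add: u1_def)
  qed
  then have "bilin_bound (\<lambda>m n. (if u2 m \<le> Y2 n then 1 else 0) *
      ((if u1 n \<le> Y1 m then 1 else 0) * kloosterman_kernel q h m n))
      {1..2 * M} {1..X div M} (interval_coeff_l1 q * (interval_coeff_l1 q * S))"
    by (rule bilin_bound_decouple') (use q0 in \<open>auto simp: u2_def Y2_def\<close>)
  then have "cmod (\<Sum>m\<in>{1..2 * M}. \<Sum>n\<in>{1..X div M}. \<alpha> m * 1 * ((if u2 m \<le> Y2 n then 1 else 0) *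
      ((if u1 n \<le> Y1 m then 1 else 0) * kloosterman_kernel q h m n))) \<le> interval_coeff_l1 q * (interval_coeff_l1 q * S)"
  proof (rule bilin_boundD)
    have "cmod (of_int (mu m)) = 1" for m
      by (simp add: abs_mu flip: of_int_abs)
    then show "cmod (\<alpha> m) \<le> 1" for m by (simp add: \<alpha>_def)
  qed simp
  also have "(\<Sum>m\<in>{1..2 * M}. \<Sum>n\<in>{1..X div M}. \<alpha> m * 1 * ((if u2 m \<le> Y2 n then 1 else 0) *
      ((if u1 n \<le> Y1 m then 1 else 0) * kloosterman_kernel q h m n)))
    = (\<Sum>d\<in>{M<..2 * M}. \<Sum>l\<in>{1..X div d}. of_int (buchstab_weight z D d l) * kloosterman_kernel q h d l)"
  proof (rule sum.mono_neutral_cong_right)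
    show "\<forall>m\<in>{1..2 * M} - {M<..2 * M}. (\<Sum>n\<in>{1..X div M}. \<alpha> m * 1 * ((if u2 m \<le> Y2 n then 1 else 0) *
      ((if u1 n \<le> Y1 m then 1 else 0) * kloosterman_kernel q h m n))) = 0"
      by (auto simp: \<alpha>_def)
  next
    fix m assume m: "m \<in> {M<..2 * M}"
    show "(\<Sum>n\<in>{1..X div M}. \<alpha> m * 1 * ((if u2 m \<le> Y2 n then 1 else 0) *
      ((if u1 n \<le> Y1 m then 1 else 0) * kloosterman_kernel q h m n)))
      = (\<Sum>l\<in>{1..X div m}. of_int (buchstab_weight z D m l) * kloosterman_kernel q h m l)"
    proof (rule sum.mono_neutral_cong_right)
      have "X div m \<le> X div M" using m M by (intro div_le_mono2) auto
      then show "{1..X div m} \<subseteq> {1..X div M}" by auto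
      show "\<forall>n\<in>{1..X div M} - {1..X div m}. \<alpha> m * 1 * ((if u2 m \<le> Y2 n then 1 else 0) *
        ((if u1 n \<le> Y1 m then 1 else 0) * kloosterman_kernel q h m n)) = 0"
      proof
        fix n assume n: "n \<in> {1..X div M} - {1..X div m}"
        have "n \<le> X" using n by (auto intro: order.trans[OF _ div_le_dividend])
        then have "u1 n = n" using X by (simp add: u1_def)
        then show "\<alpha> m * 1 * ((if u2 m \<le> Y2 n then 1 else 0) *
          ((if u1 n \<le> Y1 m then 1 else 0) * kloosterman_kernel q h m n)) = 0"
          using n by (auto simp: Y1_def)
      qed
    next
      fix n assume n: "n \<in> {1..X div m}"
      have nX: "n \<le> X" using n by (auto intro: order.trans[OF _ div_le_dividend])
      then have u1: "u1 n = n" using X by (simp add: u1_def)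
      have rough: "u2 m \<le> Y2 n \<longleftrightarrow> (\<forall>p. prime p \<longrightarrow> p dvd n \<longrightarrow> lpf m \<le> p)" if "D < m"
      proof -
        have m1: "m > 1" using that D by simp
        have lm: "lpf m \<le> q - 1" 
        proof -
          have "m < q" using m q by simp
          then show ?thesis using lpf_le_self[OF m1] by linarith
        qed
        show ?thesis
        proof (cases "n = 1")
          case True
          then show ?thesis using lm by (auto simp: u2_def Y2_def)
        next
          case False
          then have "n > 1" using n by simp
          then have "lpf n \<le> q - 1" using lpf_le_self[of n] nX X by simp
          then have "u2 m \<le> Y2 n \<longleftrightarrow> lpf m \<le> lpf n" using lm False by (auto simp: u2_def Y2_def)
          also have "\<dots> \<longleftrightarrow> (\<forall>p. prime p \<longrightarrow> p dvd n \<longrightarrow> lpf m \<le> p)"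
            using lpf[OF False] lpf_le by (meson order.trans)
          finally show ?thesis .
        qed
      qed
      show "\<alpha> m * 1 * ((if u2 m \<le> Y2 n then 1 else 0) *
        ((if u1 n \<le> Y1 m then 1 else 0) * kloosterman_kernel q h m n))
        = of_int (buchstab_weight z D m n) * kloosterman_kernel q h m n"
        using m n rough by (auto simp: \<alpha>_def buchstab_weight_def u1 Y1_def)
    qed auto
  qed auto
  finally show ?thesis .
qed

lemma sum_dyadic:
  fixes f :: "nat \<Rightarrow> complex"
  shows "(\<Sum>d\<in>{D<..D * 2 ^ J}. f d) = (\<Sum>j<J. \<Sum>d\<in>{D * 2 ^ j<..2 * (D * 2 ^ j)}. f d)"
proof (induction J)
  case (Suc J)
  have "{D<..2 * E} = {D<..E} \<union> {E<..2 * E}" if "D \<le> E" for E using that by auto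
  from this[of "D * 2 ^ J"] have "{D<..D * 2 ^ Suc J} = {D<..D * 2 ^ J} \<union> {D * 2 ^ J<..2 * (D * 2 ^ J)}"
    by (simp add: mult.left_commute)
  then have "(\<Sum>d\<in>{D<..D * 2 ^ Suc J}. f d)
    = (\<Sum>d\<in>{D<..D * 2 ^ J}. f d) + (\<Sum>d\<in>{D * 2 ^ J<..2 * (D * 2 ^ J)}. f d)"
    by (simp only:) (rule sum.union_disjoint, auto)
  then show ?case using Suc by simp
qed simp

text \<open>The part with d \<le> D is bounded by D inner sums. In the other part d \<le> D lpf d
  \<le> D z, so J doublings of D reach every d; each block pays for two Fourier completions.\<close>

lemma prime_kloosterman_reduction:
  assumes X: "X < q" and D: "0 < D" "D \<le> X" and z: "X < (z + 1)\<^sup>2" "z \<le> 2 ^ J"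
    and S1: "\<And>d. d \<in> {1..D} \<Longrightarrow>
      cmod (\<Sum>l\<in>{1..X div d}. add_char q ((h * modinv q (int d)) * modinv q (int l))) \<le> S1"
    and S2: "\<And>j. j < J \<Longrightarrow> 2 * (D * 2 ^ j) < q"
      "\<And>j. j < J \<Longrightarrow> bilin_bound (kloosterman_kernel q h) {1..2 * (D * 2 ^ j)} {1..X div (D * 2 ^ j)} S2"
  shows "cmod (\<Sum>p\<in>{p. prime p \<and> p \<le> X}. add_char q (h * modinv q (int p)))
    \<le> real z + 1 + real D * S1 + real J * (interval_coeff_l1 q * (interval_coeff_l1 q * S2))"
proof -
  define F where "F n = add_char q (h * modinv q (int n))" for n
  have Fk: "F (d * l) = kloosterman_kernel q h d l" for d l
    by (simp add: F_def kloosterman_kernel_def modinv_mult mult.assoc)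
  define w where "w d = (if sqfree_smooth z d \<and> d \<le> D then mu d else 0)" for d
  have "(\<Sum>d\<in>{1..X}. \<Sum>l\<in>{1..X div d}. of_int (sieve_weight z D d l) * F (d * l))
     = (\<Sum>d\<in>{1..X}. \<Sum>l\<in>{1..X div d}. of_int (w d) * F (d * l))
     + (\<Sum>d\<in>{1..X}. \<Sum>l\<in>{1..X div d}. of_int (buchstab_weight z D d l) * F (d * l))"
    by (simp add: sieve_weight_split w_def distrib_right sum.distrib)
  also have "cmod \<dots> \<le> real D * S1 + real J * (interval_coeff_l1 q * (interval_coeff_l1 q * S2))"
  proof (rule order.trans[OF norm_triangle_ineq add_mono])
    have "(\<Sum>d\<in>{1..X}. \<Sum>l\<in>{1..X div d}. of_int (w d) * F (d * l))
      = (\<Sum>d\<in>{1..D}. of_int (w d) * (\<Sum>l\<in>{1..X div d}. F (d * l)))"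
      by (rule sum.mono_neutral_cong_right) (use D in \<open>auto simp: w_def sum_distrib_left\<close>)
    also have "cmod \<dots> \<le> (\<Sum>d\<in>{1..D}. S1)"
    proof (rule sum_norm_le)
      fix d assume d: "d \<in> {1..D}"
      have "cmod (of_int (w d)) \<le> 1"
        by (simp add: w_def abs_mu flip: of_int_abs)
      moreover have "cmod (\<Sum>l\<in>{1..X div d}. F (d * l)) \<le> S1"
        using S1[OF d] by (simp add: Fk kloosterman_kernel_def)
      ultimately have "cmod (of_int (w d)) * cmod (\<Sum>l\<in>{1..X div d}. F (d * l)) \<le> 1 * S1"
        by (intro mult_mono) auto
      then show "cmod (of_int (w d) * (\<Sum>l\<in>{1..X div d}. F (d * l))) \<le> S1"
        by (simp add: norm_mult)
    qed
    finally show "cmod (\<Sum>d\<in>{1..X}. \<Sum>l\<in>{1..X div d}. of_int (w d) * F (d * l)) \<le> real D * S1"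
      by simp
  next
    define f where "f d = (\<Sum>l\<in>{1..X div d}. of_int (buchstab_weight z D d l) * F (d * l))" for d
    have f0: "f d = 0" if "d \<notin> {D<..D * 2 ^ J}" for d
    proof -
      have "buchstab_weight z D d l = 0" for l
      proof (rule ccontr)
        assume "buchstab_weight z D d l \<noteq> 0"
        then have d: "sqfree_smooth z d" "D < d" "d \<le> D * lpf d"
          by (auto simp: buchstab_weight_def split: if_splits)
        then have "prime (lpf d)" "lpf d dvd d" using lpf[of d] D by auto
        then have "lpf d \<le> z" using d by (auto simp: sqfree_smooth_def)
        then have "d \<le> D * 2 ^ J" using d z(2) by (meson le_trans mult_le_mono2)
        then show False using d that by simp
      qed
      then show ?thesis by (simp add: f_def)
    qed
    have "(\<Sum>d\<in>{1..X}. f d) = (\<Sum>d\<in>{1..X} \<inter> {D<..D * 2 ^ J}. f d)"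
      by (rule sum.mono_neutral_right) (use f0 in auto)
    also have "\<dots> = (\<Sum>d\<in>{D<..D * 2 ^ J}. f d)"
    proof (rule sum.mono_neutral_left)
      show "\<forall>d\<in>{D<..D * 2 ^ J} - {1..X} \<inter> {D<..D * 2 ^ J}. f d = 0"
      proof
        fix d assume d: "d \<in> {D<..D * 2 ^ J} - {1..X} \<inter> {D<..D * 2 ^ J}"
        then have "X < d" by auto
        then show "f d = 0" by (simp add: f_def)
      qed
    qed auto
    also have "\<dots> = (\<Sum>j<J. \<Sum>d\<in>{D * 2 ^ j<..2 * (D * 2 ^ j)}. f d)" by (rule sum_dyadic)
    also have "cmod \<dots> \<le> (\<Sum>j<J. interval_coeff_l1 q * (interval_coeff_l1 q * S2))"
    proof (rule sum_norm_le)
      fix j assume "j \<in> {..<J}"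
      then show "cmod (\<Sum>d\<in>{D * 2 ^ j<..2 * (D * 2 ^ j)}. f d) \<le> interval_coeff_l1 q * (interval_coeff_l1 q * S2)"
        unfolding f_def Fk using S2 X D by (intro dyadic_block_bound) auto
    qed
    finally show "cmod (\<Sum>d\<in>{1..X}. \<Sum>l\<in>{1..X div d}. of_int (buchstab_weight z D d l) * F (d * l))
      \<le> real J * (interval_coeff_l1 q * (interval_coeff_l1 q * S2))"
      by (simp add: f_def)
  qed
  finally show ?thesis
    using prime_sum_decomposition[OF D(1) z(1), of F] by (simp add: F_def)
qed

lemma ln_le_powr: "x \<ge> 1 \<Longrightarrow> \<epsilon> > 0 \<Longrightarrow> ln x \<le> x powr \<epsilon> / \<epsilon>" for x \<epsilon> :: real
  using ln_powr_bound by blast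

lemma real_div_ge_half:
  fixes X d :: nat
  assumes "0 < d" "d \<le> X"
  shows "real X / (2 * real d) \<le> real (X div d)"
proof -
  have "1 \<le> X div d" using assms by (simp add: div_greater_zero_iff Suc_le_eq)
  have "X < d * (X div d) + d" using assms by (metis add.commute dividend_less_times_div)
  also have "\<dots> \<le> d * (X div d) + d * (X div d)" using \<open>1 \<le> X div d\<close> by simp
  finally have "X \<le> 2 * d * (X div d)" by simp
  then have "real X \<le> real (2 * d * (X div d))" by (simp only: of_nat_le_iff)
  then show ?thesis using assms by (simp add: divide_le_eq mult_ac)
qed

lemma prime_kloosterman_bound:
  fixes \<eta> :: real
  assumes \<eta>: "\<eta> > 0"
  shows "\<exists>\<delta>>0. \<exists>Q\<ge>1. \<exists>q0. \<forall>q h X. prime q \<longrightarrow> q0 \<le> real q \<longrightarrow> \<not> int q dvd h \<longrightarrow> X < q \<longrightarrow>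
     real q powr (1/2 + \<eta>) \<le> real X \<longrightarrow>
     cmod (\<Sum>p\<in>{p. prime p \<and> p \<le> X}. add_char q (h * modinv q (int p))) \<le> Q * real X * real q powr - \<delta>"
proof -
  have \<eta>2: "\<eta> / 2 > 0" using \<eta> by simp
  obtain \<delta>1 Q1 where \<delta>1: "\<delta>1 > 0" and Q1: "Q1 \<ge> 1" and TI: "\<And>q h Y. prime q \<Longrightarrow> q > 2 \<Longrightarrow> \<not> int q dvd h \<Longrightarrow> Y < q \<Longrightarrow>
     real q powr (1/2 + \<eta> / 2) \<le> real Y \<Longrightarrow>
     cmod (\<Sum>n\<in>{1..Y}. add_char q (h * modinv q (int n))) \<le> Q1 * real Y * real q powr - \<delta>1"
    using incomplete_kloosterman_bound[OF \<eta>2] by blast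
  \<comment> \<open>The level is q^\<theta>. The bound \<eta> / 4 keeps X / d above q^(1/2 +
    \<eta>/2) for d \<le> D; \<delta>1 / 2 lets the saving in the inner sums survive D of them; 1/16
    keeps the block lengths below \<open>q\<close> and both variables of a block above
    q^\<theta>.\<close>
  define \<theta> where "\<theta> = min (min (\<eta> / 4) (\<delta>1 / 2)) (1/16)"
  have \<theta>: "\<theta> > 0" "\<theta> \<le> \<eta> / 4" "\<theta> \<le> \<delta>1 / 2" "\<theta> \<le> 1/16" using \<eta> \<delta>1 by (auto simp: \<theta>_def)
  obtain \<delta>2 Q2 where \<delta>2: "\<delta>2 > 0" and Q2: "Q2 \<ge> 1" and TII: "\<And>q h M N. prime q \<Longrightarrow> q > 2 \<Longrightarrow> \<not> int q dvd h \<Longrightarrow> M < q \<Longrightarrow> N < q \<Longrightarrow>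
     real q powr \<theta> \<le> real M \<Longrightarrow> real q powr \<theta> \<le> real N \<Longrightarrow>
     real q powr (1/2 + \<eta>) \<le> real M * real N \<Longrightarrow>
     bilin_bound (kloosterman_kernel q h) {1..M} {1..N} (Q2 * (real M * real N) * real q powr - \<delta>2)"
    using type_II_bound[OF \<eta> \<theta>(1)] by blast
  \<comment> \<open>Three logarithmic factors occur, the number of blocks and two completions. Each
    is at most (3 + 2 / (\<delta>2 / 6)) q^(\<delta>2/6), so together they consume half of
    \<delta>2.\<close>
  define L where "L = (3 + 2 / (\<delta>2 / 6)) ^ 3"
  have L0: "L \<ge> 0" using \<delta>2 by (simp add: L_def)
  define Q where "Q = 2 + Q1 + 2 * Q2 * L"
  \<comment> \<open>The bound 1/4 is for the error z + 1, which is at most 2 sqrt X, with sqrt X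
    \<ge> q^(1/4).\<close>
  define \<delta> where "\<delta> = min (min (\<delta>1 / 2) (\<delta>2 / 2)) (1/4)"
  have \<delta>: "\<delta> > 0" "\<delta> \<le> \<delta>1 / 2" "\<delta> \<le> \<delta>2 / 2" "\<delta> \<le> 1/4" using \<delta>1 \<delta>2 by (auto simp: \<delta>_def)
  have "Q \<ge> 1" using Q1 Q2 L0 by (simp add: Q_def add_nonneg_nonneg)
  \<comment> \<open>65536 is 4^8 and gives q^(1/8) \<ge> 4; the second term gives q^(\<eta>/4) \<ge>
    2. Both absorb the constants lost by rounding.\<close>
  define q0 :: real where "q0 = max 65536 (2 powr (4 / \<eta>))"
  show ?thesis
  proof (rule exI[of _ \<delta>], rule conjI[OF \<delta>(1)], rule exI[of _ Q], rule conjI[OF \<open>Q \<ge> 1\<close>], rule exI[of _ q0], intro allI impI)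
    fix q :: nat and h :: int and X :: nat
    assume q: "prime q" "q0 \<le> real q" and h: "\<not> int q dvd h" and X: "X < q" "real q powr (1/2 + \<eta>) \<le> real X"
    have qbig: "real q \<ge> 65536" "real q \<ge> 2 powr (4 / \<eta>)" using q by (auto simp: q0_def)
    have q2: "q > 2" and q1: "real q > 1" using qbig by auto
    have q8: "4 \<le> real q powr (1/8)"
    proof -
      have "(4 :: real) = (4 powr 8) powr (1/8)" by (simp only: powr_powr) simp
      also have "\<dots> \<le> real q powr (1/8)" using qbig by (intro powr_mono2) (auto simp: powr_numeral)
      finally show ?thesis .
    qed
    have q\<eta>: "2 \<le> real q powr (\<eta> / 4)"
    proof -
      have "(2 :: real) = (2 powr (4 / \<eta>)) powr (\<eta> / 4)" using \<eta> by (simp add: powr_powr)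
      also have "\<dots> \<le> real q powr (\<eta> / 4)" using qbig \<eta> by (intro powr_mono2) auto
      finally show ?thesis .
    qed
    have Xhalf: "real q powr (1/2) \<le> real X"
      using X(2) q1 \<eta> powr_mono[of "1/2" "1/2 + \<eta>" "real q"] by linarith
    have X0: "real X > 0" 
    proof -
      have "0 < real q powr (1/2)" using q1 by simp
      then show ?thesis using Xhalf by linarith
    qed
    have sqX: "real q powr (1/4) \<le> sqrt (real X)"
    proof -
      have "real q powr (1/4) = (real q powr (1/2)) powr (1/2)" by (simp add: powr_powr)
      also have "\<dots> \<le> real X powr (1/2)" using Xhalf by (intro powr_mono2) auto
      finally show ?thesis by (simp add: powr_half_sqrt)
    qed
    have sqX1: "sqrt (real X) \<ge> 1" using X0 by simp
    define z where "z = nat \<lfloor>sqrt (real X)\<rfloor>"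
    have zr: "real z \<le> sqrt (real X)" "sqrt (real X) < real z + 1" "real z \<ge> 1"
    proof -
      have "1 \<le> \<lfloor>sqrt (real X)\<rfloor>" using sqX1 by (simp only: le_floor_iff of_int_1)
      then have e: "real z = real_of_int \<lfloor>sqrt (real X)\<rfloor>" "real z \<ge> 1" by (simp_all add: z_def)
      show "real z \<le> sqrt (real X)" "sqrt (real X) < real z + 1" "real z \<ge> 1" using e by linarith+
    qed
    have zX: "X < (z + 1)\<^sup>2"
    proof -
      have "sqrt (real X) * sqrt (real X) < (real z + 1) * (real z + 1)"
        using zr sqX1 by (intro mult_strict_mono) auto
      then have "real X < real ((z + 1)\<^sup>2)" by (simp add: power2_eq_square algebra_simps)
      then show ?thesis by (simp only: of_nat_less_iff)
    qed
    define D where "D = nat \<lfloor>real q powr \<theta>\<rfloor>"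
    have Dr: "real D \<le> real q powr \<theta>" "real q powr \<theta> \<le> 2 * real D" "real D \<ge> 1"
    proof -
      have "1 \<le> real q powr \<theta>" using q1 \<theta> by (intro ge_one_powr_ge_zero) auto
      then have "1 \<le> \<lfloor>real q powr \<theta>\<rfloor>" by (simp only: le_floor_iff of_int_1)
      then have e: "real D = real_of_int \<lfloor>real q powr \<theta>\<rfloor>" "real D \<ge> 1" by (simp_all add: D_def)
      show "real D \<le> real q powr \<theta>" "real q powr \<theta> \<le> 2 * real D" "real D \<ge> 1" using e by linarith+
    qed
    have D0: "D > 0" using Dr by simp
    have DX: "D \<le> X"
    proof -
      have "real q powr \<theta> \<le> real q powr (1/2)" using q1 \<theta> by (intro powr_mono) auto
      then have "real D \<le> real X" using Dr Xhalf by linarith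
      then show ?thesis by simp
    qed
    define J where "J = (LEAST j. z \<le> 2 ^ j)"
    have Jz: "z \<le> 2 ^ J" unfolding J_def by (rule LeastI[of _ z]) (simp add: less_imp_le)
    have Jless: "2 ^ j < z" if "j < J" for j using not_less_Least[of j "\<lambda>j. z \<le> 2 ^ j"] that by (simp add: J_def)
    have z_q: "real z \<le> real q powr (1/2)"
      using zr(1) X(1) by (simp add: powr_half_sqrt) (meson order.trans less_imp_le of_nat_less_iff real_sqrt_le_iff)
    have J_le: "real J \<le> 3 + 2 * ln (real q)"
    proof (cases "J = 0")
      case True
      then show ?thesis using q1 by simp
    next
      case False
      then have "2 ^ (J - 1) < z" by (intro Jless) simp
      then have "real (2 ^ (J - 1)) < real z" by (simp only: of_nat_less_iff)
      then have "2 ^ (J - 1) \<le> real q powr 1"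
        using z_q powr_mono[of "1/2" 1 "real q"] q1 by simp
      then have "ln (2 ^ (J - 1)) \<le> ln (real q)" using q1 by (subst ln_le_cancel_iff) auto
      then have "real (J - 1) * ln 2 \<le> ln (real q)" by (simp add: ln_realpow)
      moreover have "real (J - 1) * (1/2) \<le> real (J - 1) * ln 2"
        using ln_le_minus_one[of "1/2 :: real"] by (intro mult_left_mono) (auto simp: ln_div)
      ultimately show ?thesis using False by (simp add: of_nat_diff)
    qed
    define S1 where "S1 = Q1 * real X * real q powr - \<delta>1"
    define S2 where "S2 = 2 * Q2 * real X * real q powr - \<delta>2"
    have main: "cmod (\<Sum>p\<in>{p. prime p \<and> p \<le> X}. add_char q (h * modinv q (int p)))
      \<le> real z + 1 + real D * S1 + real J * (interval_coeff_l1 q * (interval_coeff_l1 q * S2))"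
    proof (rule prime_kloosterman_reduction[OF X(1) D0 DX zX Jz])
      fix d assume d: "d \<in> {1..D}"
      have dq: "\<not> int q dvd int d" using d DX X by (intro not_dvd_small) auto
      have hd: "\<not> int q dvd h * modinv q (int d)"
        using h modinv_not_dvd[OF q(1) dq] prime_int_q[OF q(1)] by (simp add: prime_dvd_mult_iff)
      have Xd: "X div d < q" using X(1) by (rule le_less_trans[OF div_le_dividend])
      have "real q powr (1/2 + \<eta> / 2) \<le> real (X div d)"
      proof -
        have "real q powr (1/2 + \<eta> / 2) * (2 * real d) \<le> real q powr (1/2 + \<eta> / 2) * (real q powr (\<eta> / 4) * real q powr (\<eta> / 4))"
        proof (intro mult_left_mono mult_mono)
          have "real d \<le> real D" using d by simp
          also have "\<dots> \<le> real q powr \<theta>" by (rule Dr(1))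
          also have "\<dots> \<le> real q powr (\<eta> / 4)" using q1 \<theta> by (intro powr_mono) auto
          finally show "real d \<le> real q powr (\<eta> / 4)" .
        qed (use q\<eta> in auto)
        also have "\<dots> = real q powr (1/2 + \<eta>)" unfolding powr_add[symmetric] by (simp add: add.commute)
        also have "\<dots> \<le> real X" by (rule X(2))
        finally have "real q powr (1/2 + \<eta> / 2) \<le> real X / (2 * real d)" using d by (simp add: le_divide_eq)
        also have "\<dots> \<le> real (X div d)" using d DX by (intro real_div_ge_half) auto
        finally show ?thesis .
      qed
      from TI[OF q(1) q2 hd Xd this]
      have "cmod (\<Sum>l\<in>{1..X div d}. add_char q ((h * modinv q (int d)) * modinv q (int l))) \<le> Q1 * real (X div d) * real q powr - \<delta>1" .
      also have "\<dots> \<le> S1" unfolding S1_def using Q1 by (intro mult_right_mono mult_left_mono) auto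
      finally show "cmod (\<Sum>l\<in>{1..X div d}. add_char q ((h * modinv q (int d)) * modinv q (int l))) \<le> S1" .
    next
      fix j assume j: "j < J"
      define M where "M = D * 2 ^ j"
      have M0: "M > 0" using D0 by (simp add: M_def)
      have Mz: "real M \<le> real q powr \<theta> * real z"
      proof -
        have "real (2 ^ j) < real z" using Jless[OF j] by (simp only: of_nat_less_iff)
        then show ?thesis unfolding M_def of_nat_mult using Dr by (intro mult_mono) auto
      qed
      have q16: "real q powr \<theta> \<le> real q powr (1/16)" using q1 \<theta> by (intro powr_mono) auto
      have M2: "2 * M < q"
      proof -
        have "2 * real M \<le> 2 * (real q powr (1/16) * real q powr (1/2))"
          using Mz q16 z_q mult_mono[OF q16 z_q] by fastforce
        also have "\<dots> < real q powr (1/8) * (real q powr (1/16) * real q powr (1/2))"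
          using q8 q1 by (intro mult_strict_right_mono) auto
        also have "\<dots> = real q powr (11/16)" unfolding powr_add[symmetric] by simp
        also have "\<dots> \<le> real q powr 1" using q1 by (intro powr_mono) auto
        finally have "real (2 * M) < real q" using q1 by simp
        then show ?thesis by (simp only: of_nat_less_iff)
      qed
      then show "2 * (D * 2 ^ j) < q" by (simp add: M_def)
      have zz: "real z * real z \<le> real X"
        using mult_mono[OF zr(1) zr(1)] by simp
      have zq: "real q powr (1/4) \<le> 2 * real z" using sqX zr by linarith
      \<comment> \<open>Since M \<le> q^\<theta> z and z^2 \<le> X, the quotient X / (2 M) is at
        least z / (2 q^\<theta>); this inequality makes that at least q^\<theta>.\<close>
      have z16: "real q powr \<theta> * (2 * real q powr \<theta>) \<le> real z"
      proof -
        have "real q powr \<theta> * (4 * real q powr \<theta>) \<le> real q powr (1/16) * (real q powr (1/8) * real q powr (1/16))"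
          by (intro mult_mono q8 q16) auto
        also have "\<dots> = real q powr (1/4)" unfolding powr_add[symmetric] by simp
        finally show ?thesis using zq by linarith
      qed
      have MX: "M \<le> X"
      proof -
        have "real q powr \<theta> \<le> real q powr \<theta> * (2 * real q powr \<theta>)"
          using ge_one_powr_ge_zero[of "real q" \<theta>] q1 \<theta> by simp
        then have "real q powr \<theta> \<le> real z" using z16 by linarith
        then have "real q powr \<theta> * real z \<le> real z * real z" by (rule mult_right_mono) simp
        then have "real M \<le> real X" using Mz zz by linarith
        then show ?thesis by simp
      qed
      have XM: "real X / (2 * real M) \<le> real (X div M)" using M0 MX by (rule real_div_ge_half)
      have N\<theta>: "real q powr \<theta> \<le> real (X div M)"
      proof -
        have "real q powr \<theta> * (2 * real M) \<le> real q powr \<theta> * (2 * (real q powr \<theta> * real z))"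
          using Mz by (intro mult_left_mono) auto
        also have "\<dots> = real q powr \<theta> * (2 * real q powr \<theta>) * real z" by simp
        also have "\<dots> \<le> real z * real z" using z16 by (rule mult_right_mono) simp
        also have "\<dots> \<le> real X" by (rule zz)
        finally have "real q powr \<theta> \<le> real X / (2 * real M)" using M0 by (simp add: le_divide_eq)
        then show ?thesis using XM by linarith
      qed
      have M\<theta>: "real q powr \<theta> \<le> real (2 * M)"
      proof -
        have "D * 1 \<le> D * 2 ^ j" by (intro mult_le_mono2) simp
        then have "real D \<le> real M" unfolding M_def by (simp only: of_nat_le_iff mult_1_right)
        then show ?thesis using Dr(2) by simp
      qed
      have prod: "real X \<le> real (2 * M) * real (X div M)"
        using XM M0 by (simp add: divide_le_eq mult.commute)
      then have prod': "real q powr (1/2 + \<eta>) \<le> real (2 * M) * real (X div M)" using X(2) by linarith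
      have Nq: "X div M < q" using X(1) by (rule le_less_trans[OF div_le_dividend])
      have "bilin_bound (kloosterman_kernel q h) {1..2 * M} {1..X div M}
          (Q2 * (real (2 * M) * real (X div M)) * real q powr - \<delta>2)"
        by (rule TII[OF q(1) q2 h M2 Nq M\<theta> N\<theta> prod'])
      moreover have "Q2 * (real (2 * M) * real (X div M)) * real q powr - \<delta>2 \<le> S2"
      proof -
        have "M * (X div M) \<le> X" by simp
        then have "real (M * (X div M)) \<le> real X" by (simp only: of_nat_le_iff)
        then have "real (2 * M) * real (X div M) \<le> 2 * real X" by simp
        then have "Q2 * (real (2 * M) * real (X div M)) * real q powr - \<delta>2 \<le> Q2 * (2 * real X) * real q powr - \<delta>2"
          using Q2 by (intro mult_right_mono mult_left_mono) auto
        then show ?thesis by (simp add: S2_def mult_ac)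
      qed
      ultimately show "bilin_bound (kloosterman_kernel q h) {1..2 * (D * 2 ^ j)} {1..X div (D * 2 ^ j)} S2"
        unfolding M_def by (rule bilin_bound_mono)
    qed
    have "real z + 1 \<le> 2 * (real X * real q powr - \<delta>)"
    proof -
      have "sqrt (real X) * real q powr (1/4) \<le> sqrt (real X) * sqrt (real X)"
        using sqX by (intro mult_left_mono) auto
      then have "sqrt (real X) * (real q powr (1/4) * real q powr (-1/4)) \<le> real X * real q powr (-1/4)"
        by (simp add: mult_right_mono flip: mult.assoc)
      moreover have "real q powr (1/4) * real q powr (-1/4) = 1" using q1 by (simp flip: powr_add)
      moreover have "real X * real q powr (-1/4) \<le> real X * real q powr - \<delta>"
        using \<delta> q1 by (intro mult_left_mono powr_mono) auto
      ultimately show ?thesis using zr by simp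
    qed
    moreover have "real D * S1 \<le> Q1 * (real X * real q powr - \<delta>)"
    proof -
      have "real D * S1 \<le> real q powr \<theta> * S1"
        using Dr Q1 by (intro mult_right_mono) (auto simp: S1_def)
      also have "\<dots> = Q1 * (real X * (real q powr \<theta> * real q powr - \<delta>1))" by (simp add: S1_def mult_ac)
      also have "\<dots> \<le> Q1 * (real X * real q powr - \<delta>)"
        unfolding powr_add[symmetric] using Q1 q1 \<theta> \<delta> by (intro mult_left_mono powr_mono) auto
      finally show ?thesis .
    qed
    moreover have "real J * (interval_coeff_l1 q * (interval_coeff_l1 q * S2)) \<le> 2 * Q2 * L * (real X * real q powr - \<delta>)"
    proof -
      define y where "y = (3 + 2 / (\<delta>2 / 6)) * real q powr (\<delta>2 / 6)"
      have ly: "3 + 2 * ln (real q) \<le> y"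
      proof -
        have "ln (real q) \<le> real q powr (\<delta>2 / 6) / (\<delta>2 / 6)" using q1 \<delta>2 by (intro ln_le_powr) auto
        moreover have "3 * 1 \<le> 3 * real q powr (\<delta>2 / 6)"
          using q1 \<delta>2 by (intro mult_left_mono ge_one_powr_ge_zero) auto
        ultimately show ?thesis by (simp add: y_def distrib_right)
      qed
      have S20: "S2 \<ge> 0" using Q2 by (simp add: S2_def)
      have Jy: "real J \<le> y" and fy: "interval_coeff_l1 q \<le> y"
        using J_le ly interval_coeff_l1_le[of q] q2 by auto
      have "real J * (interval_coeff_l1 q * (interval_coeff_l1 q * S2)) \<le> y * (y * (y * S2))"
        using Jy fy interval_coeff_l1_nonneg[of q] S20 by (intro mult_mono mult_nonneg_nonneg) auto
      also have "\<dots> = y ^ 3 * S2" by (simp add: power3_eq_cube mult_ac)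
      also have "y ^ 3 = L * real q powr (\<delta>2 / 2)"
        using q1 by (simp add: y_def L_def power_mult_distrib powr_power)
      also have "L * real q powr (\<delta>2 / 2) * S2 = 2 * Q2 * L * (real X * (real q powr (\<delta>2 / 2) * real q powr - \<delta>2))"
        by (simp add: S2_def mult_ac)
      also have "\<dots> \<le> 2 * Q2 * L * (real X * real q powr - \<delta>)"
        unfolding powr_add[symmetric] using Q2 L0 q1 \<delta> by (intro mult_left_mono powr_mono) auto
      finally show ?thesis .
    qed
    ultimately have "cmod (\<Sum>p\<in>{p. prime p \<and> p \<le> X}. add_char q (h * modinv q (int p)))
      \<le> 2 * (real X * real q powr - \<delta>) + Q1 * (real X * real q powr - \<delta>) + 2 * Q2 * L * (real X * real q powr - \<delta>)"
      using main by linarith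
    also have "\<dots> = Q * real X * real q powr - \<delta>" by (simp add: Q_def algebra_simps)
    finally show "cmod (\<Sum>p\<in>{p. prime p \<and> p \<le> X}. add_char q (h * modinv q (int p))) \<le> Q * real X * real q powr - \<delta>" .
  qed
qed

section \<open>Lehmer numbers\<close>

text \<open>\<open>v\<close> is half of the inverse b modulo \<open>q\<close>. Hence b is 2 v if v
  lies in the lower half and 2 v - q otherwise, and the latter is odd because \<open>q\<close>
  is.\<close>

lemma even_inverse_iff:
  fixes q p :: nat
  assumes q: "prime q" "odd q" and p: "0 < p" "p < q"
  defines "v \<equiv> nat ((modinv q 2 * modinv q (int p)) mod int q)"
  shows "even (inverse_mod (int q) (int p)) \<longleftrightarrow> v \<le> (q - 1) div 2"
proof -
  define b where "b = inverse_mod (int q) (int p)"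
  have q3: "q \<ge> 3" using q prime_ge_2_nat[OF q(1)] by (cases "q = 2") auto
  have np: "\<not> int q dvd int p" using p by (intro not_dvd_small) auto
  have "coprime (int p) (int q)"
    using np prime_int_q[OF q(1)] by (metis coprime_commute prime_imp_coprime)
  then have b: "1 \<le> b" "b \<le> int q - 1" "[int p * b = 1] (mod int q)"
    using inverse_mod[of "int q" "int p"] q3 by (simp_all add: b_def)
  have "[int p * b = int p * modinv q (int p)] (mod int q)"
    using b(3) modinv_right[OF q(1) np] by (meson cong_sym cong_trans)
  then have b_inv: "[b = modinv q (int p)] (mod int q)"
    using cong_mult_lcancel_prime[OF q(1) np] by blast
  have "\<not> int q dvd 2" using q3 not_dvd_small[of 2 q] by simp
  then have two: "[2 * modinv q 2 = 1] (mod int q)" by (rule modinv_right[OF q(1)])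
  have v: "v < q" "int v = (modinv q 2 * modinv q (int p)) mod int q"
    using q3 by (auto simp: v_def nat_less_iff)
  have "[2 * int v = 2 * (modinv q 2 * modinv q (int p))] (mod int q)"
    unfolding v(2) by (intro cong_scalar_left) (simp add: Cong.cong_def)
  moreover have "[(2 * modinv q 2) * modinv q (int p) = 1 * modinv q (int p)] (mod int q)"
    using two by (rule cong_scalar_right)
  ultimately have vb: "[2 * int v = b] (mod int q)"
    using b_inv by (metis cong_sym cong_trans mult.assoc mult_1)
  show ?thesis
  proof (cases "v \<le> (q - 1) div 2")
    case True
    then have "2 * v < q" using q3 by linarith
    then have "2 * int v = b" using vb b by (simp add: Cong.cong_def)
    then have "even b" by (metis dvd_triv_left)
    then show ?thesis using True by (simp add: b_def)
  next
    case False
    then have big: "int q < 2 * int v" using q(2) by (auto elim!: oddE)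
    have "[2 * int v - int q = b] (mod int q)"
      using cong_diff[OF vb, of "int q" 0] by (simp add: cong_0_iff)
    then have "(2 * int v - int q) mod int q = b mod int q" by (simp only: Cong.cong_def)
    moreover have "(2 * int v - int q) mod int q = 2 * int v - int q"
      using big v(1) by (intro mod_pos_pos_trivial) auto
    moreover have "b mod int q = b" using b by (intro mod_pos_pos_trivial) auto
    ultimately have "2 * int v - int q = b" by simp
    moreover have "odd (2 * int v - int q)" using q(2) by simp
    ultimately show ?thesis using False by (simp add: b_def)
  qed
qed

text \<open>Frequency 0 contributes the proportion (q + 1) / (2 q) of the primes, which differs from
  one half by at most 1 in the count. For the other frequencies h / 2 is again nonzero modulo
  \<open>q\<close>, so B applies, and the coefficients sum to at most
  \<open>interval_coeff_l1 q\<close>.\<close>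

lemma half_count_discrepancy:
  fixes q X :: nat
  assumes q: "prime q" "odd q" and X: "X < q"
    and B: "\<And>h. \<not> int q dvd h \<Longrightarrow> cmod (\<Sum>p\<in>{p. prime p \<and> p \<le> X}. add_char q (h * modinv q (int p))) \<le> B"
  shows "\<bar>real (card {p. prime p \<and> p \<le> X \<and> nat ((modinv q 2 * modinv q (int p)) mod int q) \<le> (q - 1) div 2})
      - 1/2 * real (card {p. prime p \<and> p \<le> X})\<bar> \<le> interval_coeff_l1 q * B + 1"
proof -
  define P where "P = {p. prime p \<and> p \<le> X}"
  define v where "v p = nat ((modinv q 2 * modinv q (int p)) mod int q)" for p
  define m where "m = (q - 1) div 2"
  have q3: "q \<ge> 3" using q prime_ge_2_nat[OF q(1)] by (cases "q = 2") auto
  have finP: "finite P" by (simp add: P_def)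
  have two: "\<not> int q dvd 2" using q3 not_dvd_small[of 2 q] by simp
  have mq: "m < q" using q3 by (simp add: m_def)
  have v: "v p < q" "[int (v p) = modinv q 2 * modinv q (int p)] (mod int q)" for p
    using q3 by (auto simp: v_def nat_less_iff Cong.cong_def)
  define c where "c = real (card {p\<in>P. v p \<le> m})"
  define T where "T h = (\<Sum>p\<in>P. add_char q (int h * modinv q 2 * modinv q (int p)))" for h :: nat
  have "complex_of_real c = (\<Sum>p\<in>P. if v p \<le> m then 1 else 0)"
    using finP unfolding c_def by (simp flip: sum.inter_filter)
  also have "\<dots> = (\<Sum>p\<in>P. \<Sum>h<q. interval_coeff q m h * add_char q (int h * int (v p)))"
    by (intro sum.cong refl sum_interval_coeff[symmetric] mq v)
  also have "\<dots> = (\<Sum>h<q. \<Sum>p\<in>P. interval_coeff q m h * add_char q (int h * int (v p)))" by (rule sum.swap)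
  also have "\<dots> = (\<Sum>h<q. interval_coeff q m h * T h)"
  proof (intro sum.cong refl)
    fix h
    have "add_char q (int h * int (v p)) = add_char q (int h * modinv q 2 * modinv q (int p))" for p
    proof (rule add_char_cong)
      show "[int h * int (v p) = int h * modinv q 2 * modinv q (int p)] (mod int q)"
        using cong_scalar_left[OF v(2)[of p], of "int h"] by (simp only: mult.assoc)
    qed (use q3 in simp)
    then show "(\<Sum>p\<in>P. interval_coeff q m h * add_char q (int h * int (v p))) = interval_coeff q m h * T h"
      by (simp add: T_def sum_distrib_left)
  qed
  also have "{..<q} = insert 0 {1..<q}" using q3 by auto
  also have "(\<Sum>h\<in>insert 0 {1..<q}. interval_coeff q m h * T h) = interval_coeff q m 0 * T 0 + (\<Sum>h\<in>{1..<q}. interval_coeff q m h * T h)"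
    by simp
  also have "interval_coeff q m 0 * T 0 = complex_of_real (real (Suc m) / real q * real (card P))"
    by (simp add: interval_coeff_0 T_def)
  finally have "complex_of_real (c - real (Suc m) / real q * real (card P)) = (\<Sum>h\<in>{1..<q}. interval_coeff q m h * T h)"
    by (simp del: of_nat_Suc)
  then have "\<bar>c - real (Suc m) / real q * real (card P)\<bar> = cmod (\<Sum>h\<in>{1..<q}. interval_coeff q m h * T h)"
    by (metis norm_of_real real_norm_def)
  also have "\<dots> \<le> (\<Sum>h\<in>{1..<q}. interval_coeff_bound q h * B)"
  proof (rule sum_norm_le)
    fix h assume h: "h \<in> {1..<q}"
    have "\<not> int q dvd int h" using h by (intro not_dvd_small) auto
    then have "\<not> int q dvd int h * modinv q 2"
      using modinv_not_dvd[OF q(1) two] prime_int_q[OF q(1)] by (simp add: prime_dvd_mult_iff)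
    then have "cmod (T h) \<le> B" unfolding T_def P_def by (rule B)
    moreover have "cmod (interval_coeff q m h) \<le> interval_coeff_bound q h" using h mq by (intro norm_interval_coeff) auto
    ultimately show "cmod (interval_coeff q m h * T h) \<le> interval_coeff_bound q h * B"
      unfolding norm_mult using interval_coeff_bound_pos[of h q] h by (intro mult_mono) (auto intro: less_imp_le)
  qed
  also have "\<dots> \<le> interval_coeff_l1 q * B"
  proof -
    have "0 \<le> B" using B[OF two] norm_ge_zero order.trans by blast
    moreover have "(\<Sum>h\<in>{1..<q}. interval_coeff_bound q h) \<le> interval_coeff_l1 q"
      unfolding interval_coeff_l1_def by (intro sum_mono2) (auto intro: less_imp_le interval_coeff_bound_pos)
    ultimately show ?thesis by (simp add: mult_right_mono flip: sum_distrib_right)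
  qed
  finally have *: "\<bar>c - real (Suc m) / real q * real (card P)\<bar> \<le> interval_coeff_l1 q * B" .
  have "card P \<le> card {1..X}"
    by (intro card_mono) (auto simp: P_def dest: prime_ge_1_nat)
  then have cP: "real (card P) \<le> real q" using X by simp
  have "2 * Suc m = q + 1" using q(2) by (auto simp: m_def elim!: oddE)
  then have "real (2 * Suc m) = real (q + 1)" by (simp only:)
  then have "real (Suc m) = (real q + 1) / 2" by simp
  then have "real (Suc m) / real q = 1/2 + 1 / (2 * real q)"
    using q3 by (simp add: field_simps del: of_nat_Suc)
  then have "real (Suc m) / real q * real (card P) = 1/2 * real (card P) + real (card P) / (2 * real q)"
    by (simp add: distrib_right)
  moreover have "0 \<le> real (card P) / (2 * real q)" "real (card P) / (2 * real q) \<le> 1"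
    using cP q3 by (simp_all add: divide_le_eq)
  ultimately have "\<bar>c - 1/2 * real (card P)\<bar> \<le> interval_coeff_l1 q * B + 1"
    using * by linarith
  moreover have "{p\<in>P. v p \<le> m} = {p. prime p \<and> p \<le> X \<and> v p \<le> m}" by (auto simp: P_def)
  ultimately show ?thesis by (simp add: c_def P_def v_def m_def)
qed

lemma prime_pi_eq:
  assumes "N \<ge> 0"
  shows "prime_pi N = card {p :: nat. prime p \<and> p \<le> nat \<lfloor>N\<rfloor>}"
proof -
  have "{p \<in> primes. real_of_int p \<le> N} = int ` {p :: nat. prime p \<and> p \<le> nat \<lfloor>N\<rfloor>}"
  proof (intro equalityI subsetI)
    fix p assume p: "p \<in> {p \<in> primes. real_of_int p \<le> N}"
    then have *: "p \<ge> 0" "prime p" "p \<le> \<lfloor>N\<rfloor>" by (auto simp: primes_def le_floor_iff prime_ge_0_int)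
    then obtain n where n: "p = int n" using zero_le_imp_eq_int by blast
    then have "prime n" "n \<le> nat \<lfloor>N\<rfloor>" using * by (simp, linarith)
    then show "p \<in> int ` {p :: nat. prime p \<and> p \<le> nat \<lfloor>N\<rfloor>}" by (simp add: n)
  next
    fix p assume "p \<in> int ` {p :: nat. prime p \<and> p \<le> nat \<lfloor>N\<rfloor>}"
    then show "p \<in> {p \<in> primes. real_of_int p \<le> N}"
      using assms by (auto simp: primes_def le_nat_iff le_floor_iff)
  qed
  then show ?thesis by (simp add: prime_pi_def card_image)
qed

lemma lehmer_primes_eq:
  fixes q :: nat and N :: real
  assumes q: "prime q" and N: "N \<ge> 0" "N \<le> real q - 1"
  shows "card (lehmer_numbers_upto N (int q) \<inter> primes)
    = card {p :: nat. prime p \<and> p \<le> nat \<lfloor>N\<rfloor> \<and> odd (int p + inverse_mod (int q) (int p))}"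
proof -
  have "lehmer_numbers_upto N (int q) \<inter> primes
    = int ` {p :: nat. prime p \<and> p \<le> nat \<lfloor>N\<rfloor> \<and> odd (int p + inverse_mod (int q) (int p))}"
  proof (intro equalityI subsetI)
    fix p assume p: "p \<in> lehmer_numbers_upto N (int q) \<inter> primes"
    then have *: "p \<ge> 0" "prime p" "p \<le> \<lfloor>N\<rfloor>" "odd (p + inverse_mod (int q) p)"
      by (simp_all add: primes_def le_floor_iff lehmer_numbers_upto_def lehmer_numbers_def)
    then obtain n where n: "p = int n" using zero_le_imp_eq_int by blast
    then have "prime n" "n \<le> nat \<lfloor>N\<rfloor>" using * by (simp, linarith)
    then show "p \<in> int ` {p :: nat. prime p \<and> p \<le> nat \<lfloor>N\<rfloor> \<and> odd (int p + inverse_mod (int q) (int p))}"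
      using *(4) unfolding n by (intro imageI CollectI conjI)
  next
    fix p assume "p \<in> int ` {p :: nat. prime p \<and> p \<le> nat \<lfloor>N\<rfloor> \<and> odd (int p + inverse_mod (int q) (int p))}"
    then obtain n :: nat where n: "p = int n" "prime n" "n \<le> nat \<lfloor>N\<rfloor>" "odd (p + inverse_mod (int q) p)" by auto
    have n1: "n \<ge> 1" using n(2) by (rule prime_ge_1_nat)
    have nN: "real n \<le> N" using n(3) N by (simp add: le_nat_iff le_floor_iff)
    then have nq: "n < q" using N by linarith
    have "\<not> int q dvd int n" using n1 nq by (intro not_dvd_small) auto
    then have "coprime (int n) (int q)"
      using prime_int_q[OF q] by (metis coprime_commute prime_imp_coprime)
    then show "p \<in> lehmer_numbers_upto N (int q) \<inter> primes"
      using n n1 nN nq by (auto simp: primes_def lehmer_numbers_upto_def lehmer_numbers_def)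
  qed
  then show ?thesis by (simp add: card_image)
qed

text \<open>For odd p the parity of p plus its inverse is decided by the inverse alone. The two sets
  can differ only in the prime 2, which adds 1 to the error.\<close>

lemma lehmer_count_discrepancy:
  fixes q :: nat and N :: real
  assumes q: "prime q" "odd q" and N: "N \<ge> 0" "N \<le> real q - 1"
    and B: "\<And>h. \<not> int q dvd h \<Longrightarrow> cmod (\<Sum>p\<in>{p. prime p \<and> p \<le> nat \<lfloor>N\<rfloor>}. add_char q (h * modinv q (int p))) \<le> B"
  shows "\<bar>real (card (lehmer_numbers_upto N (int q) \<inter> primes)) - 1/2 * real (prime_pi N)\<bar> \<le> interval_coeff_l1 q * B + 2"
proof -
  define X where "X = nat \<lfloor>N\<rfloor>"
  have Xq: "X < q" unfolding X_def using N by linarith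
  define A where "A = {p :: nat. prime p \<and> p \<le> X \<and> odd (int p + inverse_mod (int q) (int p))}"
  define A' where "A' = {p. prime p \<and> p \<le> X \<and> nat ((modinv q 2 * modinv q (int p)) mod int q) \<le> (q - 1) div 2}"
  have fin: "finite A" "finite A'" by (simp_all add: A_def A'_def)
  have eq: "p \<in> A \<longleftrightarrow> p \<in> A'" if "p \<noteq> 2" for p
  proof (cases "prime p \<and> p \<le> X")
    case True
    have p1: "0 < p" "p < q" using True Xq prime_gt_0_nat by auto
    have "odd p" using True that primes_dvd_imp_eq two_is_prime_nat by blast
    then have "odd (int p + inverse_mod (int q) (int p)) \<longleftrightarrow> even (inverse_mod (int q) (int p))" by simp
    then show ?thesis using True even_inverse_iff[OF q p1] by (auto simp: A_def A'_def)
  qed (auto simp: A_def A'_def)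
  have "A \<subseteq> insert 2 A'" "A' \<subseteq> insert 2 A" using eq by auto
  then have "card A \<le> card (insert 2 A')" "card A' \<le> card (insert 2 A)"
    using fin by (auto intro!: card_mono)
  moreover have "card (insert 2 A') \<le> Suc (card A')" "card (insert 2 A) \<le> Suc (card A)"
    by (rule card_insert_le_m1; simp)+
  ultimately have "card A \<le> Suc (card A')" "card A' \<le> Suc (card A)" by linarith+
  then have "\<bar>real (card A) - real (card A')\<bar> \<le> 1" by linarith
  moreover have "\<bar>real (card A') - 1/2 * real (card {p :: nat. prime p \<and> p \<le> X})\<bar> \<le> interval_coeff_l1 q * B + 1"
    unfolding A'_def using B by (intro half_count_discrepancy q Xq) (auto simp: X_def)
  ultimately show ?thesis
    unfolding lehmer_primes_eq[OF q(1) N] prime_pi_eq[OF N(1)] X_def[symmetric] A_def[symmetric] by linarith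
qed

theorem theorem2:
  shows "\<forall>\<eta>::real. \<eta> > 0 \<longrightarrow>
    (\<exists>\<delta>::real. \<exists>K::real. \<exists>q\<^sub>0::real. \<delta> > 0 \<and> K > 0 \<and>
      (\<forall>q::int. \<forall>N::real.
        prime q \<longrightarrow> odd q \<longrightarrow> real_of_int q \<ge> q\<^sub>0 \<longrightarrow>
        real_of_int q powr (1/2 + \<eta>) < N \<longrightarrow> N \<le> real_of_int q - 1 \<longrightarrow>
        \<bar>real (card (lehmer_numbers_upto N q \<inter> primes)) - 1/2 * real (prime_pi N)\<bar>
          \<le> K * N powr (1 - \<delta>)))"
proof (intro allI impI)
  fix \<eta> :: real assume \<eta>: "\<eta> > 0"
  \<comment> \<open>Half of \<eta> pays for replacing N by its integer part: for q \<ge>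
    2^(2/\<eta>) the lower bound for N is at least 2 q^(1/2 + \<eta>/2).\<close>
  then have \<eta>2: "\<eta> / 2 > 0" by simp
  obtain \<delta>1 Q q1 where \<delta>1: "\<delta>1 > 0" and Q: "Q \<ge> 1" and main: "\<And>q h X. prime q \<Longrightarrow> q1 \<le> real q \<Longrightarrow> \<not> int q dvd h \<Longrightarrow> X < q \<Longrightarrow>
     real q powr (1/2 + \<eta> / 2) \<le> real X \<Longrightarrow>
     cmod (\<Sum>p\<in>{p. prime p \<and> p \<le> X}. add_char q (h * modinv q (int p))) \<le> Q * real X * real q powr - \<delta>1"
    using prime_kloosterman_bound[OF \<eta>2] by blast
  \<comment> \<open>The other half of \<delta>1 absorbs the logarithm of the Fourier completion;
    \<delta> \<le> 1 makes N^(1-\<delta>) at least 1, so it absorbs the additive error 2.\<close>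
  define \<delta> where "\<delta> = min (\<delta>1 / 2) 1"
  have \<delta>: "\<delta> > 0" "\<delta> \<le> \<delta>1 / 2" "\<delta> \<le> 1" using \<delta>1 by (auto simp: \<delta>_def)
  define c where "c = 3 + 2 / (\<delta>1 / 2)"
  have c: "c \<ge> 0" using \<delta>1 by (simp add: c_def)
  define K where "K = c * Q + 2"
  have K: "K > 0" using c Q by (simp add: K_def add_nonneg_pos)
  show "\<exists>\<delta>::real. \<exists>K::real. \<exists>q\<^sub>0::real. \<delta> > 0 \<and> K > 0 \<and>
      (\<forall>q::int. \<forall>N::real.
        prime q \<longrightarrow> odd q \<longrightarrow> real_of_int q \<ge> q\<^sub>0 \<longrightarrow>
        real_of_int q powr (1/2 + \<eta>) < N \<longrightarrow> N \<le> real_of_int q - 1 \<longrightarrow>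
        \<bar>real (card (lehmer_numbers_upto N q \<inter> primes)) - 1/2 * real (prime_pi N)\<bar>
          \<le> K * N powr (1 - \<delta>))"
  proof (rule exI[of _ \<delta>], rule exI[of _ K], rule exI[of _ "max q1 (2 powr (2 / \<eta>))"],
      rule conjI[OF \<delta>(1)], rule conjI[OF K], intro allI impI)
    fix q :: int and N :: real
    assume q: "prime q" "odd q" "real_of_int q \<ge> max q1 (2 powr (2 / \<eta>))"
      and N: "real_of_int q powr (1/2 + \<eta>) < N" "N \<le> real_of_int q - 1"
    define p where "p = nat q"
    have qp: "q = int p" using q(1) prime_gt_0_int[of q] by (simp add: p_def)
    have p: "prime p" "odd p" using q by (auto simp: qp)
    have pbig: "q1 \<le> real p" "2 powr (2 / \<eta>) \<le> real p" using q(3) by (auto simp: qp)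
    have p1: "real p > 1" using prime_gt_1_nat[OF p(1)] by simp
    have N': "real p powr (1/2 + \<eta>) < N" "N \<le> real p - 1" using N by (simp_all add: qp)
    have "1 \<le> real p powr (1/2 + \<eta>)" using p1 \<eta> by (intro ge_one_powr_ge_zero) auto
    then have N1: "N > 1" using N' by linarith
    define X where "X = nat \<lfloor>N\<rfloor>"
    have X: "real X \<le> N" "N - 1 < real X" using N1 by (simp_all add: X_def)
    have Xp: "X < p" using X N' by linarith
    have X\<eta>: "real p powr (1/2 + \<eta> / 2) \<le> real X"
    proof -
      have "(2 :: real) = (2 powr (2 / \<eta>)) powr (\<eta> / 2)" using \<eta> by (simp add: powr_powr)
      also have "\<dots> \<le> real p powr (\<eta> / 2)" using pbig \<eta> by (intro powr_mono2) auto
      finally have "2 * real p powr (1/2 + \<eta> / 2) \<le> real p powr (\<eta> / 2) * real p powr (1/2 + \<eta> / 2)"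
        by (rule mult_right_mono) simp
      also have "\<dots> = real p powr (1/2 + \<eta>)" unfolding powr_add[symmetric] by (simp add: add.commute)
      finally have "2 * real p powr (1/2 + \<eta> / 2) \<le> N" using N' by linarith
      moreover have "1 \<le> real p powr (1/2 + \<eta> / 2)" using p1 \<eta> by (intro ge_one_powr_ge_zero) auto
      ultimately show ?thesis using X by linarith
    qed
    define B where "B = Q * real X * real p powr - \<delta>1"
    have "cmod (\<Sum>r\<in>{r. prime r \<and> r \<le> nat \<lfloor>N\<rfloor>}. add_char p (h * modinv p (int r))) \<le> B" if "\<not> int p dvd h" for h
      using main[OF p(1) pbig(1) that Xp X\<eta>] by (simp add: B_def X_def)
    then have "\<bar>real (card (lehmer_numbers_upto N (int p) \<inter> primes)) - 1/2 * real (prime_pi N)\<bar> \<le> interval_coeff_l1 p * B + 2"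
      using N1 N' by (intro lehmer_count_discrepancy p) auto
    also have "interval_coeff_l1 p * B + 2 \<le> c * Q * N powr (1 - \<delta>) + 2 * N powr (1 - \<delta>)"
    proof (rule add_mono)
      have "interval_coeff_l1 p \<le> c * real p powr (\<delta>1 / 2)"
      proof -
        have "ln (real p) \<le> real p powr (\<delta>1 / 2) / (\<delta>1 / 2)" using p1 \<delta>1 by (intro ln_le_powr) auto
        moreover have "3 * 1 \<le> 3 * real p powr (\<delta>1 / 2)"
          using p1 \<delta>1 by (intro mult_left_mono ge_one_powr_ge_zero) auto
        moreover have "interval_coeff_l1 p \<le> 3 + 2 * ln (real p)" using p1 by (intro interval_coeff_l1_le) simp
        ultimately show ?thesis by (simp add: c_def distrib_right)
      qed
      then have "interval_coeff_l1 p * B \<le> c * real p powr (\<delta>1 / 2) * B"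
        using Q by (intro mult_right_mono) (auto simp: B_def)
      also have "\<dots> = c * Q * (real X * (real p powr (\<delta>1 / 2) * real p powr - \<delta>1))"
        by (simp add: B_def mult_ac)
      also have "\<dots> = c * Q * (real X * real p powr - (\<delta>1 / 2))" unfolding powr_add[symmetric] by simp
      also have "\<dots> \<le> c * Q * (N * N powr - \<delta>)"
      proof (intro mult_left_mono mult_mono X)
        have "real p powr - (\<delta>1 / 2) \<le> real p powr - \<delta>" using p1 \<delta> by (intro powr_mono) auto
        \<comment> \<open>A saving in powers of the modulus is also one in powers of N, because N is
          smaller than the modulus.\<close>
        also have "\<dots> \<le> N powr - \<delta>" using N1 N' \<delta> by (intro powr_mono2') auto
        finally show "real p powr - (\<delta>1 / 2) \<le> N powr - \<delta>" .
      qed (use c Q N1 in auto)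
      also have "N * N powr - \<delta> = N powr (1 - \<delta>)"
        using N1 powr_add[of N 1 "- \<delta>"] by simp
      finally show "interval_coeff_l1 p * B \<le> c * Q * N powr (1 - \<delta>)" .
      have "1 \<le> N powr (1 - \<delta>)" using N1 \<delta> by (intro ge_one_powr_ge_zero) auto
      then show "2 \<le> 2 * N powr (1 - \<delta>)" by simp
    qed
    also have "\<dots> = K * N powr (1 - \<delta>)" by (simp add: K_def distrib_right)
    finally show "\<bar>real (card (lehmer_numbers_upto N q \<inter> primes)) - 1/2 * real (prime_pi N)\<bar>
          \<le> K * N powr (1 - \<delta>)" by (simp add: qp)
  qed
qed

end
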